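(* (Strong maximum principle) Let $w$ be a non-negative eigenfunction of problem (P) associated to $\lambda_1$, put $\delta=\sup_\Omega w$ (which is finite), and assume that $$\int_{0}^{\delta}\frac{ds}{H^{-1}(M(s))}=+\infty,\qquad\text{where } H(t)=tm(t)-M(t)\ \text{ for } t\ge0.$$ Then $w>0$ in $\Omega$.
   Context: $\Omega\subset\mathbb{R}^N$, $N\ge 2$, is a bounded domain having the segment property. $\phi:(0,\infty)\to(0,\infty)$ is continuous and $m(t)=\phi(|t|)t$ (with $m(0)=0$; likewise $\phi(|\xi|)\xi$ is read as $0$ at $\xi=0$) is strictly increasing with $m(t)\to0$ as $t\to0$ and $m(t)\to\infty$ as $t\to\infty$. $M(t)=\int_0^{|t|}m(s)\,ds$ and $\overline{M}(s)=\sup_{t\ge0}\{st-M(t)\}$ is its complementary function; one has $H(t)=\overline M(m(t))$. No $\Delta_2$-condition is assumed. The weight $\rho\in L^\infty(\Omega)$ satisfies $\rho\ge0$ a.e. in $\Omega$ and $\rho\ne0$. $L_M(\Omega)$ is the Orlicz space of measurable $u:\Omega\to\mathbb{R}$ with $\int_\Omega M(|u|/\lambda)\,dx<\infty$ for some $\lambda>0$, with norm $\|u\|_M=\inf\{\lambda>0:\int_\Omega M(|u|/\lambda)dx\le1\}$ (and similarly $L_{\overline M}(\Omega)$). $E_{M}(\Omega)$ (similarly $E_{\overline M}(\Omega)$) is the closure in $L_M(\Omega)$ of the bounded measurable functions with compact support in $\overline\Omega$. $W^1L_M(\Omega)=\{u\in L_M(\Omega):\partial_iu\in L_M(\Omega),\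 i=1,\dots,N\}$, and $W^1_0L_M(\Omega)$ is the closure of $C_0^\infty(\Omega)$ in $W^1L_M(\Omega)$ for the weak* topology $\sigma(\Pi L_M,\Pi E_{\overline M})$ (where $u$ is identified with $(u,\partial_1u,\dots,\partial_Nu)$). Problem (P): $-\mathrm{div}(\phi(|\nabla u|)\nabla u)=\lambda\rho(x)\phi(|u|)u$ in $\Omega$, $u=0$ on $\partial\Omega$. A weak solution of (P) associated with $\lambda\in\mathbb{R}$ is a function $u\in W^1_0L_M(\Omega)$ with $m(|\nabla u|)\in L_{\overline M}(\Omega)$ and $\int_\Omega\phi(|\nabla u|)\nabla u\cdot\nabla\psi\,dx=\lambda\int_\Omega\rho(x)\phi(|u|)u\psi\,dx$ for all $\psi\in W^1_0L_M(\Omega)$. $\lambda$ is an eigenvalue of (P) if there is a weak solution $v\ne0$ associated with $\lambda$; such $v$ is called an eigenfunction associated with $\lambda$. $\lambda_{1}=\inf\{\int_{\Omega}M(|\nabla u|)\,dx: u\in W^{1}_{0}L_{M}(\Omega),\ \int_{\Omega}\rho(x)M(|u|)\,dx=1\}$. Eigenfunctions are identified with their continuous representatives. *)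

theory Defs
  imports "HOL-Analysis.Analysis"
begin

section \<open>N-functions\<close>

(* phi is only meaningful on the open half-line; its value at 0 is irrelevant here, so m(0) = 0. *)
definition m_fun :: "(real \<Rightarrow> real) \<Rightarrow> real \<Rightarrow> real" where
  "m_fun \<phi> t = \<phi> \<bar>t\<bar> * t"

definition M_fun :: "(real \<Rightarrow> real) \<Rightarrow> real \<Rightarrow> real" where
  "M_fun \<phi> t = integral {0..\<bar>t\<bar>} (m_fun \<phi>)"

definition complementary :: "(real \<Rightarrow> real) \<Rightarrow> real \<Rightarrow> real" where
  "complementary A s = (SUP t\<in>{0..}. s * t - A t)"

definition H_fun :: "(real \<Rightarrow> real) \<Rightarrow> real \<Rightarrow> real" where
  "H_fun \<phi> t = t * m_fun \<phi> t - M_fun \<phi> t"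

(* H is an increasing bijection of [0,oo), and it is inverted there. *)
definition H_inv :: "(real \<Rightarrow> real) \<Rightarrow> real \<Rightarrow> real" where
  "H_inv \<phi> = inv_into {0..} (H_fun \<phi>)"


section \<open>Domains\<close>

definition segment_property :: "'a::real_normed_vector set \<Rightarrow> bool" where
  "segment_property \<Omega> \<longleftrightarrow>
     (\<forall>x\<in>frontier \<Omega>. \<exists>U y. open U \<and> x \<in> U \<and> y \<noteq> 0 \<and>
        (\<forall>z\<in>closure \<Omega> \<inter> U. \<forall>t. 0 < t \<and> t < 1 \<longrightarrow> z + t *\<^sub>R y \<in> \<Omega>))"


section \<open>Orlicz spaces\<close>

(* Throughout, elements of function spaces are represented by functions on the whole space, of which
   only the values on \<Omega> matter; they are not quotiented by equality almost everywhere. *)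

definition orlicz_space ::
    "(real \<Rightarrow> real) \<Rightarrow> 'a::euclidean_space set \<Rightarrow> ('a \<Rightarrow> real) set" where
  "orlicz_space A \<Omega> =
     {u \<in> borel_measurable (lebesgue_on \<Omega>).
        \<exists>k>0. (\<integral>\<^sup>+x. ennreal (A (\<bar>u x\<bar> / k)) \<partial>lebesgue_on \<Omega>) < \<infinity>}"

definition orlicz_norm ::
    "(real \<Rightarrow> real) \<Rightarrow> 'a::euclidean_space set \<Rightarrow> ('a \<Rightarrow> real) \<Rightarrow> real" where
  "orlicz_norm A \<Omega> u =
     Inf {k. 0 < k \<and> (\<integral>\<^sup>+x. ennreal (A (\<bar>u x\<bar> / k)) \<partial>lebesgue_on \<Omega>) \<le> 1}"

definition bounded_compact_support :: "'a::euclidean_space set \<Rightarrow> ('a \<Rightarrow> real) set" where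
  "bounded_compact_support \<Omega> =
     {v \<in> borel_measurable (lebesgue_on \<Omega>). bounded (v ` \<Omega>) \<and>
        (\<exists>K. compact K \<and> K \<subseteq> closure \<Omega> \<and> (\<forall>x\<in>\<Omega> - K. v x = 0))}"

definition orlicz_E ::
    "(real \<Rightarrow> real) \<Rightarrow> 'a::euclidean_space set \<Rightarrow> ('a \<Rightarrow> real) set" where
  "orlicz_E A \<Omega> =
     {u \<in> orlicz_space A \<Omega>. \<forall>e>0. \<exists>v\<in>bounded_compact_support \<Omega> \<inter> orlicz_space A \<Omega>.
        orlicz_norm A \<Omega> (\<lambda>x. u x - v x) < e}"


section \<open>Test functions and weak derivatives\<close>

definition partial_deriv :: "'n::finite \<Rightarrow> (real^'n \<Rightarrow> real) \<Rightarrow> real^'n \<Rightarrow> real" where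
  "partial_deriv i f x = frechet_derivative f (at x) (axis i 1)"

fun iterated_partial :: "'n::finite list \<Rightarrow> (real^'n \<Rightarrow> real) \<Rightarrow> real^'n \<Rightarrow> real" where
  "iterated_partial [] f = f"
| "iterated_partial (i # is) f = partial_deriv i (iterated_partial is f)"

(* If all iterated partial derivatives are (Frechet) differentiable everywhere, they are in
   particular all continuous, so this is membership in C^\<infinity>. *)
definition C_infinity :: "(real^'n \<Rightarrow> real) \<Rightarrow> bool" where
  "C_infinity f \<longleftrightarrow> (\<forall>is x. iterated_partial is f differentiable (at x))"

definition test_functions :: "(real^'n) set \<Rightarrow> (real^'n \<Rightarrow> real) set" where
  "test_functions \<Omega> =
     {f. C_infinity f \<and> compact (closure {x. f x \<noteq> 0}) \<and> closure {x. f x \<noteq> 0} \<subseteq> \<Omega>}"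

definition locally_integrable_on :: "('a::euclidean_space \<Rightarrow> real) \<Rightarrow> 'a set \<Rightarrow> bool" where
  "locally_integrable_on u \<Omega> \<longleftrightarrow> (\<forall>K. compact K \<and> K \<subseteq> \<Omega> \<longrightarrow> integrable (lebesgue_on K) u)"

definition has_weak_partial ::
    "(real^'n) set \<Rightarrow> 'n \<Rightarrow> (real^'n \<Rightarrow> real) \<Rightarrow> (real^'n \<Rightarrow> real) \<Rightarrow> bool" where
  "has_weak_partial \<Omega> i u g \<longleftrightarrow>
     locally_integrable_on u \<Omega> \<and> locally_integrable_on g \<Omega> \<and>
     (\<forall>\<psi>\<in>test_functions \<Omega>.
        (\<integral>x. u x * partial_deriv i \<psi> x \<partial>lebesgue_on \<Omega>) = - (\<integral>x. g x * \<psi> x \<partial>lebesgue_on \<Omega>))"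

(* Weak derivatives are determined up to a null set; a representative is chosen. *)
definition weak_partial :: "(real^'n) set \<Rightarrow> 'n \<Rightarrow> (real^'n \<Rightarrow> real) \<Rightarrow> real^'n \<Rightarrow> real" where
  "weak_partial \<Omega> i u = (SOME g. has_weak_partial \<Omega> i u g)"

definition weak_grad :: "(real^'n) set \<Rightarrow> (real^'n \<Rightarrow> real) \<Rightarrow> real^'n \<Rightarrow> real^'n" where
  "weak_grad \<Omega> u x = (\<chi> i. weak_partial \<Omega> i u x)"


section \<open>Orlicz--Sobolev spaces\<close>

definition W1L :: "(real \<Rightarrow> real) \<Rightarrow> (real^'n) set \<Rightarrow> (real^'n \<Rightarrow> real) set" where
  "W1L A \<Omega> =
     {u \<in> orlicz_space A \<Omega>. \<forall>i. \<exists>g\<in>orlicz_space A \<Omega>. has_weak_partial \<Omega> i u g}"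

(* The identification of u with (u, d_1 u, ..., d_N u); None indexes the component u itself. *)
definition jet :: "(real^'n) set \<Rightarrow> (real^'n \<Rightarrow> real) \<Rightarrow> 'n option \<Rightarrow> real^'n \<Rightarrow> real" where
  "jet \<Omega> u j = (case j of None \<Rightarrow> u | Some i \<Rightarrow> weak_partial \<Omega> i u)"

definition prod_L ::
    "(real \<Rightarrow> real) \<Rightarrow> (real^'n) set \<Rightarrow> ('n option \<Rightarrow> real^'n \<Rightarrow> real) set" where
  "prod_L A \<Omega> = {U. \<forall>j. U j \<in> orlicz_space A \<Omega>}"

definition prod_E ::
    "(real \<Rightarrow> real) \<Rightarrow> (real^'n) set \<Rightarrow> ('n option \<Rightarrow> real^'n \<Rightarrow> real) set" where
  "prod_E A \<Omega> = {V. \<forall>j. V j \<in> orlicz_E A \<Omega>}"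

definition pairing ::
    "(real^'n::finite) set \<Rightarrow> ('n option \<Rightarrow> real^'n \<Rightarrow> real) \<Rightarrow> ('n option \<Rightarrow> real^'n \<Rightarrow> real) \<Rightarrow> real" where
  "pairing \<Omega> U V = (\<Sum>j\<in>UNIV. \<integral>x. U j x * V j x \<partial>lebesgue_on \<Omega>)"

(* The topology sigma(prod L_A, prod E_B), B complementary to A: the coarsest topology on prod L_A
   making all pairings with elements of prod E_B continuous. *)
definition weak_star_topology ::
    "(real \<Rightarrow> real) \<Rightarrow> (real^'n) set \<Rightarrow> ('n option \<Rightarrow> real^'n \<Rightarrow> real) topology" where
  "weak_star_topology A \<Omega> =
     pullback_topology (prod_L A \<Omega>)
       (\<lambda>U. \<lambda>V\<in>prod_E (complementary A) \<Omega>. pairing \<Omega> U V)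
       (powertop_real (prod_E (complementary A) \<Omega>))"

definition W10L :: "(real \<Rightarrow> real) \<Rightarrow> (real^'n) set \<Rightarrow> (real^'n \<Rightarrow> real) set" where
  "W10L A \<Omega> =
     {u \<in> W1L A \<Omega>. jet \<Omega> u \<in> weak_star_topology A \<Omega> closure_of (jet \<Omega> ` test_functions \<Omega>)}"


section \<open>The eigenvalue problem\<close>

(* The integrability clauses say that the integrals in the weak formulation exist; without them
   the integral of a non-integrable function would silently be 0. *)
definition weak_solution ::
    "(real^'n) set \<Rightarrow> (real \<Rightarrow> real) \<Rightarrow> (real^'n \<Rightarrow> real) \<Rightarrow> real \<Rightarrow> (real^'n \<Rightarrow> real) \<Rightarrow> bool" where
  "weak_solution \<Omega> \<phi> \<rho> lam u \<longleftrightarrow>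
     u \<in> W10L (M_fun \<phi>) \<Omega> \<and>
     (\<lambda>x. m_fun \<phi> (norm (weak_grad \<Omega> u x))) \<in> orlicz_space (complementary (M_fun \<phi>)) \<Omega> \<and>
     (\<forall>\<psi>\<in>W10L (M_fun \<phi>) \<Omega>.
        integrable (lebesgue_on \<Omega>)
          (\<lambda>x. (\<phi> (norm (weak_grad \<Omega> u x)) *\<^sub>R weak_grad \<Omega> u x) \<bullet> weak_grad \<Omega> \<psi> x) \<and>
        integrable (lebesgue_on \<Omega>) (\<lambda>x. \<rho> x * (\<phi> \<bar>u x\<bar> * u x) * \<psi> x) \<and>
        (\<integral>x. (\<phi> (norm (weak_grad \<Omega> u x)) *\<^sub>R weak_grad \<Omega> u x) \<bullet> weak_grad \<Omega> \<psi> x \<partial>lebesgue_on \<Omega>) =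
          lam * (\<integral>x. \<rho> x * (\<phi> \<bar>u x\<bar> * u x) * \<psi> x \<partial>lebesgue_on \<Omega>))"

definition eigenfunction ::
    "(real^'n) set \<Rightarrow> (real \<Rightarrow> real) \<Rightarrow> (real^'n \<Rightarrow> real) \<Rightarrow> real \<Rightarrow> (real^'n \<Rightarrow> real) \<Rightarrow> bool" where
  "eigenfunction \<Omega> \<phi> \<rho> lam v \<longleftrightarrow>
     weak_solution \<Omega> \<phi> \<rho> lam v \<and> \<not> (AE x in lebesgue_on \<Omega>. v x = 0)"

(* The modular of the gradient may be infinite for some u, so the infimum is taken in [0,oo];
   it is finite because multiples of test functions are admissible. *)
definition lambda1 :: "(real^'n) set \<Rightarrow> (real \<Rightarrow> real) \<Rightarrow> (real^'n \<Rightarrow> real) \<Rightarrow> real" where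
  "lambda1 \<Omega> \<phi> \<rho> = enn2real
     (INF u\<in>{u \<in> W10L (M_fun \<phi>) \<Omega>.
               (\<integral>\<^sup>+x. ennreal (\<rho> x * M_fun \<phi> \<bar>u x\<bar>) \<partial>lebesgue_on \<Omega>) = 1}.
        \<integral>\<^sup>+x. ennreal (M_fun \<phi> (norm (weak_grad \<Omega> u x))) \<partial>lebesgue_on \<Omega>)"

end

theory Submission
  imports Defs "HOL-Real_Asymp.Real_Asymp"
begin

text \<open>
  Since \<open>\<lambda>\<^sub>1 \<ge> 0\<close>, the function \<open>w\<close> is a non-negative supersolution of \<open>div (\<phi>(\<bar>\<nabla>w\<bar>) \<nabla>w) \<le> 0\<close>, with no zero-order
  term left over, and for such functions the strong maximum principle follows by comparison alone.
  If \<open>w > 0\<close> at the centre of a closed ball contained in \<open>\<Omega>\<close>, compare \<open>w\<close> on the annulus between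
  a small concentric ball and the given one with the radial barrier \<open>v\<close> whose flux
  \<open>\<phi>(\<bar>\<nabla>v\<bar>) \<nabla>v\<close> is \<open>- c exp (- \<alpha> \<bar>x\<bar>\<^sup>2) x\<close>, a field of non-negative divergence there. Hence \<open>w\<close> is positive on the
  open ball. This makes both \<open>{w > 0}\<close> and \<open>{w = 0}\<close> open, and \<open>\<Omega>\<close> is connected.

  In the comparison principle the test function \<open>(v - w)\<^sup>+\<close> is replaced by \<open>((v - \<kappa> - w * \<eta>)\<^sup>+)\<^sup>2\<close>
  with a mollifier \<open>\<eta>\<close>, which is of class \<open>C\<^sup>1\<close> with compact support. In this way no chain rule and no
  density theorem in the Orlicz--Sobolev space is needed, and the absence of a \<open>\<Delta>\<^sub>2\<close>-condition is
  harmless: Young's inequality bounds the products of \<open>\<phi>(\<bar>\<nabla>w\<bar>) \<nabla>w\<close> and \<open>\<nabla>w * \<eta>\<close> from below by mollified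
  integrable functions, and Fatou's lemma applies.
\<close>

text \<open>Testing the equation with \<open>w\<close> itself makes |W| m(|W|) integrable, where W =
  grad w. Integrability of M(|W|) and of the flux follows, since M(t) \<le> t m(t) and m(t) \<le>
  m(1) + t m(t) for t \<ge> 0.

  The barrier is built backwards, from its flux. As m is a bijection of the line, every radial field
  s(|x|) x/|x| is the flux of a radial function whose slope is the inverse of m at s. The divergence
  condition is thus met by a field that ignores \<phi>, and \<phi> enters only in the size of the
  slope.

  The limit of the tested inequalities yields grad v = W almost everywhere on {v - \<kappa> > w}.
  That this set is empty follows without a Poincare inequality: for q_n = (v - \<kappa> - w *
  \<eta>)^+ the integral of x_i d_i(q_n^2) is minus the integral of q_n^2, and it tends to 0 because
  d_i(q_n^2) is 2 q_n times a difference of gradients. The shift \<kappa> places the support of q_n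
  inside the annulus and leaves room for the mollification error; the square turns the gradient of
  the test function into a bounded weight times that difference.\<close>

lemma partial_deriv_eq:
  fixes h :: "real^'n \<Rightarrow> real"
  assumes "(h has_derivative (\<lambda>k. v \<bullet> k)) (at x)"
  shows "partial_deriv i h x = v $ i"
proof -
  have "frechet_derivative h (at x) = (\<lambda>k. v \<bullet> k)"
    using frechet_derivative_at[OF assms] by simp
  then show ?thesis by (simp add: partial_deriv_def inner_axis)
qed

lemma has_derivative_partials:
  fixes h :: "real^'n \<Rightarrow> real"
  assumes "h differentiable (at x)"
  shows "(h has_derivative (\<lambda>k. (\<chi> i. partial_deriv i h x) \<bullet> k)) (at x)"
proof -
  let ?D = "frechet_derivative h (at x)"
  have D: "(h has_derivative ?D) (at x)" using assms frechet_derivative_works by blast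
  then have "linear ?D" by (rule has_derivative_linear)
  have "?D k = (\<chi> i. partial_deriv i h x) \<bullet> k" for k
  proof -
    have "k = (\<Sum>i\<in>UNIV. (k $ i) *\<^sub>R axis i 1)"
      using basis_expansion[of k] by (simp add: scalar_mult_eq_scaleR)
    then have "?D k = ?D (\<Sum>i\<in>UNIV. (k $ i) *\<^sub>R axis i 1)" by simp
    also have "\<dots> = (\<Sum>i\<in>UNIV. (k $ i) * ?D (axis i 1))"
      using \<open>linear ?D\<close> by (simp add: linear_sum linear_scale)
    finally have "?D k = (\<Sum>i\<in>UNIV. (k $ i) * ?D (axis i 1))" .
    then show ?thesis by (simp add: inner_vec_def partial_deriv_def mult.commute)
  qed
  then have "?D = (\<lambda>k. (\<chi> i. partial_deriv i h x) \<bullet> k)" by blast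
  with D show ?thesis by metis
qed

text \<open>Induction on the index list never leaves \<open>S\<close>. In use \<open>S\<close>
  consists of all convolutions with, or all reflections of, members of
  \<open>smooth_kernels\<close>, so no formula for higher derivatives is required.\<close>

lemma C_infinity_coinduct:
  fixes f :: "real^'n \<Rightarrow> real"
  assumes "f \<in> S"
    and "\<And>h x. h \<in> S \<Longrightarrow> h differentiable (at x)"
    and "\<And>h i. h \<in> S \<Longrightarrow> partial_deriv i h \<in> S"
  shows "C_infinity f"
proof -
  have "iterated_partial is f \<in> S" for "is" by (induction "is") (use assms in auto)
  then show ?thesis using assms(2) by (auto simp: C_infinity_def)
qed

section \<open>A smooth kernel\<close>

text \<open>For \<open>p = 1\<close> this is the classical function exp(-1/t), flat at 0. The
  polynomial in 1/t is carried along because differentiation produces such factors: the family is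
  closed under derivatives.\<close>

definition flat_exp :: "real poly \<Rightarrow> real \<Rightarrow> real" where
  "flat_exp p t = (if t > 0 then poly p (1/t) * exp (- (1/t)) else 0)"

lemma poly_times_exp_neg_tendsto_0: "((\<lambda>s::real. poly p s * exp (- s)) \<longlongrightarrow> 0) at_top"
proof -
  have "((\<lambda>s::real. \<Sum>i\<le>degree p. coeff p i * (s ^ i * exp (- s))) \<longlongrightarrow> (\<Sum>i\<le>degree p. coeff p i * 0)) at_top"
    by (intro tendsto_intros) real_asymp
  then show ?thesis by (simp add: poly_altdef sum_distrib_right mult.assoc)
qed

text \<open>In the variable s = 1/t, d/dt is -s^2 d/ds, and d/ds (p e^{-s}) = (p' - p) e^{-s}; this
  accounts for the polynomial \<open>[:0,0,1:] * (p - pderiv p)\<close>. At 0 the right difference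
  quotient is s p(s) e^{-s} with s tending to infinity.\<close>

lemma flat_exp_DERIV:
  "(flat_exp p has_real_derivative flat_exp ([:0,0,1:] * (p - pderiv p)) t) (at t)"
proof -
  consider "t > 0" | "t < 0" | "t = 0" by linarith
  then show ?thesis
  proof cases
    case 1
    have ev: "eventually (\<lambda>s. s \<in> {0<..}) (nhds t)" using 1 by (intro eventually_nhds_in_open) auto
    have "((\<lambda>t. poly p (1/t) * exp (- (1/t))) has_real_derivative
        poly (pderiv p) (1/t) * (- 1/t^2) * exp (-(1/t)) + poly p (1/t) * (exp (-(1/t)) * (1/t^2))) (at t)"
      using 1 by (auto intro!: derivative_eq_intros DERIV_chain2[OF poly_DERIV] simp: power2_eq_square divide_simps)
    moreover have "poly (pderiv p) (1/t) * (- 1/t^2) * exp (-(1/t)) + poly p (1/t) * (exp (-(1/t)) * (1/t^2))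
       = flat_exp ([:0,0,1:] * (p - pderiv p)) t"
      using 1 by (simp add: flat_exp_def algebra_simps power2_eq_square)
    ultimately show ?thesis
      by (subst DERIV_cong_ev[OF refl _ refl]) (use ev in \<open>auto elim!: eventually_mono simp: flat_exp_def\<close>)
  next
    case 2
    have ev: "eventually (\<lambda>s. s \<in> {..<0}) (nhds t)" using 2 by (intro eventually_nhds_in_open) auto
    have "((\<lambda>t. 0) has_real_derivative flat_exp ([:0,0,1:] * (p - pderiv p)) t) (at t)"
      using 2 by (auto simp: flat_exp_def)
    then show ?thesis
      by (subst DERIV_cong_ev[OF refl _ refl]) (use ev in \<open>auto elim!: eventually_mono simp: flat_exp_def\<close>)
  next
    case 3
    have r: "((\<lambda>h. flat_exp p h / h) \<longlongrightarrow> 0) (at_right 0)"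
    proof -
      have "((\<lambda>s::real. poly (pCons 0 p) s * exp (- s)) \<longlongrightarrow> 0) at_top" by (rule poly_times_exp_neg_tendsto_0)
      then have "((\<lambda>h::real. poly (pCons 0 p) (inverse h) * exp (- inverse h)) \<longlongrightarrow> 0) (at_right 0)"
        by (rule filterlim_compose) (rule filterlim_inverse_at_top_right)
      then show ?thesis
        by (rule Lim_transform_eventually)
           (auto simp: flat_exp_def eventually_at_right_field divide_simps intro!: exI[of _ 1])
    qed
    have l: "((\<lambda>h. flat_exp p h / h) \<longlongrightarrow> 0) (at_left 0)"
      by (rule tendsto_eventually) (auto simp: flat_exp_def eventually_at_left_field intro!: exI[of _ "-1"])
    have "((\<lambda>h. flat_exp p h / h) \<longlongrightarrow> 0) (at 0)" using r l filterlim_split_at by blast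
    then show ?thesis using 3 by (simp add: DERIV_def flat_exp_def)
  qed
qed

inductive_set kernel_algebra :: "real \<Rightarrow> (real^'n \<Rightarrow> real) set" for c where
  const: "(\<lambda>x. a) \<in> kernel_algebra c"
| coord: "(\<lambda>x. x $ i) \<in> kernel_algebra c"
| flat: "(\<lambda>x. flat_exp p (c - x \<bullet> x)) \<in> kernel_algebra c"
| add: "f \<in> kernel_algebra c \<Longrightarrow> g \<in> kernel_algebra c \<Longrightarrow> (\<lambda>x. f x + g x) \<in> kernel_algebra c"
| mult: "f \<in> kernel_algebra c \<Longrightarrow> g \<in> kernel_algebra c \<Longrightarrow> (\<lambda>x. f x * g x) \<in> kernel_algebra c"

lemma kernel_algebra_derivative:
  fixes f :: "real^'n \<Rightarrow> real"
  assumes "f \<in> kernel_algebra c"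
  shows "\<exists>d. (\<forall>i. (\<lambda>x. d x $ i) \<in> kernel_algebra c) \<and> (\<forall>x. (f has_derivative (\<lambda>k. d x \<bullet> k)) (at x))"
  using assms
proof induction
  case (const a)
  show ?case by (rule exI[of _ "\<lambda>x. 0"]) (auto intro: kernel_algebra.const)
next
  case (coord i)
  have "(\<lambda>x. x $ i) = (\<lambda>x::real^'n. axis i 1 \<bullet> x)" by (auto simp: inner_axis inner_commute)
  then have "((\<lambda>x. x $ i) has_derivative (\<lambda>k. axis i 1 \<bullet> k)) (at x)" for x :: "real^'n"
    by (metis bounded_linear_imp_has_derivative bounded_linear_inner_right)
  then show ?case by (intro exI[of _ "\<lambda>x. axis i 1"]) (auto simp: axis_def intro: kernel_algebra.const)
next
  case (flat p)
  let ?q = "[:0,0,1:] * (p - pderiv p)"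
  let ?d = "\<lambda>x::real^'n. (- 2 * flat_exp ?q (c - x \<bullet> x)) *\<^sub>R x"
  have "((\<lambda>x. flat_exp p (c - x \<bullet> x)) has_derivative (\<lambda>k. ?d x \<bullet> k)) (at x)" for x :: "real^'n"
    using flat_exp_DERIV[of p "c - x \<bullet> x", unfolded has_field_derivative_def]
    by (rule has_derivative_eq_rhs[OF diff_chain_at[where f = "\<lambda>x. c - x \<bullet> x" and g = "flat_exp p", unfolded o_def, rotated]])
       (auto intro!: derivative_eq_intros simp: inner_commute algebra_simps)
  moreover have "(\<lambda>x. ?d x $ i) \<in> kernel_algebra c" for i
  proof -
    have eq: "(\<lambda>x. ?d x $ i) = (\<lambda>x. (- 2) * (flat_exp ?q (c - x \<bullet> x) * x $ i))" by (auto simp: mult.assoc)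
    show ?thesis unfolding eq by (intro kernel_algebra.intros)
  qed
  ultimately show ?case by (intro exI[of _ ?d]) blast
next
  case (add f g)
  then obtain d e where de: "\<forall>i. (\<lambda>x. d x $ i) \<in> kernel_algebra c" "\<forall>x. (f has_derivative (\<lambda>k. d x \<bullet> k)) (at x)"
    "\<forall>i. (\<lambda>x. e x $ i) \<in> kernel_algebra c" "\<forall>x. (g has_derivative (\<lambda>k. e x \<bullet> k)) (at x)" by blast
  show ?case
    by (rule exI[of _ "\<lambda>x. d x + e x"])
       (use de in \<open>auto intro: kernel_algebra.intros has_derivative_add simp: inner_add_left\<close>)
next
  case (mult f g)
  then obtain d e where de: "\<forall>i. (\<lambda>x. d x $ i) \<in> kernel_algebra c" "\<forall>x. (f has_derivative (\<lambda>k. d x \<bullet> k)) (at x)"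
    "\<forall>i. (\<lambda>x. e x $ i) \<in> kernel_algebra c" "\<forall>x. (g has_derivative (\<lambda>k. e x \<bullet> k)) (at x)" by blast
  show ?case
  proof (intro exI[of _ "\<lambda>x. f x *\<^sub>R e x + g x *\<^sub>R d x"] conjI allI)
    fix i show "(\<lambda>x. (f x *\<^sub>R e x + g x *\<^sub>R d x) $ i) \<in> kernel_algebra c"
      using de mult.hyps by (auto intro!: kernel_algebra.add kernel_algebra.mult)
  next
    fix x show "((\<lambda>x. f x * g x) has_derivative (\<lambda>k. (f x *\<^sub>R e x + g x *\<^sub>R d x) \<bullet> k)) (at x)"
      using has_derivative_mult[OF de(2)[rule_format, of x] de(4)[rule_format, of x]]
      by (rule has_derivative_eq_rhs) (auto simp: inner_add_left algebra_simps)
  qed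
qed

definition smooth_kernels :: "real \<Rightarrow> (real^'n \<Rightarrow> real) set" where
  "smooth_kernels r = {f \<in> kernel_algebra (r^2). \<forall>x. norm x > r \<longrightarrow> f x = 0}"

text \<open>The gradient is an explicit argument because it gets integrated componentwise. Only a
  norm bound on the support is recorded; where the support has to lie in an open set, a compact
  \<open>K\<close> is supplied separately.\<close>

definition C1_compact :: "(real^'n \<Rightarrow> real) \<Rightarrow> (real^'n \<Rightarrow> real^'n) \<Rightarrow> bool" where
  "C1_compact h h' \<longleftrightarrow> (\<forall>x. (h has_derivative (\<lambda>k. h' x \<bullet> k)) (at x)) \<and> continuous_on UNIV h' \<and>
     (\<exists>R. \<forall>x. norm x > R \<longrightarrow> h x = 0)"

lemma gradient_zero_outside:
  fixes h :: "real^'n \<Rightarrow> real"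
  assumes "(h has_derivative (\<lambda>k. v \<bullet> k)) (at x)" "open S" "x \<in> S" "\<And>y. y \<in> S \<Longrightarrow> h y = 0"
  shows "v = 0"
proof -
  have "((\<lambda>x. 0) has_derivative (\<lambda>k. v \<bullet> k)) (at x)"
    by (rule has_derivative_transform_within_open[OF assms(1-3)]) (use assms(4) in auto)
  then have "(\<lambda>k. v \<bullet> k) = (\<lambda>k. 0)" using has_derivative_unique has_derivative_const by blast
  then have "v \<bullet> v = 0" by metis
  then show ?thesis by simp
qed

lemma open_norm_greater: "open {x::'a::real_normed_vector. norm x > r}"
  by (intro open_Collect_less continuous_intros)

lemma smooth_kernels_derivative:
  fixes f :: "real^'n \<Rightarrow> real"
  assumes "f \<in> smooth_kernels r"
  obtains d where "C1_compact f d" "\<And>i. (\<lambda>x. d x $ i) \<in> smooth_kernels r"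
    "\<And>i x. partial_deriv i f x = d x $ i"
proof -
  have f: "f \<in> kernel_algebra (r^2)" "\<And>x. norm x > r \<Longrightarrow> f x = 0"
    using assms by (auto simp: smooth_kernels_def)
  obtain d where d: "\<forall>i. (\<lambda>x. d x $ i) \<in> kernel_algebra (r^2)" "\<forall>x. (f has_derivative (\<lambda>k. d x \<bullet> k)) (at x)"
    using kernel_algebra_derivative[OF f(1)] by blast
  have "d x = 0" if "norm x > r" for x
    by (rule gradient_zero_outside[OF d(2)[rule_format] open_norm_greater]) (use that f in auto)
  then have k: "(\<lambda>x. d x $ i) \<in> smooth_kernels r" for i using d by (auto simp: smooth_kernels_def)
  have "continuous_on UNIV (\<lambda>x. d x $ i)" for i
    using kernel_algebra_derivative[OF d(1)[rule_format, of i]]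
    by (meson continuous_at_imp_continuous_on has_derivative_continuous)
  then have "continuous_on UNIV (\<lambda>x. \<chi> i. d x $ i)" by (rule continuous_on_vec_lambda)
  then have "C1_compact f d" using d(2) f(2) unfolding C1_compact_def by auto
  then show ?thesis using that k partial_deriv_eq d(2) by blast
qed

definition bump :: "real \<Rightarrow> real^'n \<Rightarrow> real" where
  "bump r x = flat_exp 1 (r^2 - x \<bullet> x)"

lemma bump_facts:
  fixes x :: "real^'n"
  assumes "r > 0"
  shows "(bump r :: real^'n \<Rightarrow> real) \<in> smooth_kernels r" "bump r x \<ge> 0" "norm x < r \<Longrightarrow> bump r x > 0" "bump r (- x) = bump r x"
proof -
  have "x \<bullet> x > r^2" if "norm x > r" for x :: "real^'n"
    using that assms by (metis dot_square_norm less_imp_le pos2 power_strict_mono)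
  then have "\<forall>x::real^'n. norm x > r \<longrightarrow> bump r x = 0"
    by (force simp: flat_exp_def bump_def)
  moreover have "(bump r :: real^'n \<Rightarrow> real) \<in> kernel_algebra (r^2)"
    unfolding bump_def[abs_def] by (rule kernel_algebra.flat)
  ultimately show "(bump r :: real^'n \<Rightarrow> real) \<in> smooth_kernels r" by (simp add: smooth_kernels_def)
  show "norm x < r \<Longrightarrow> bump r x > 0"
    by (simp add: bump_def flat_exp_def power2_norm_eq_inner[symmetric] power_strict_mono)
qed (auto simp: bump_def flat_exp_def)

section \<open>Functions with compact support\<close>

lemma borel_measurable_lebesgue_continuous:
  fixes f :: "'a::euclidean_space \<Rightarrow> 'b::real_normed_vector"
  shows "continuous_on UNIV f \<Longrightarrow> f \<in> borel_measurable lebesgue"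
  by (intro measurable_completion) (simp add: borel_measurable_continuous_onI)

lemma compact_support_uniformly_continuous:
  fixes f :: "'a::euclidean_space \<Rightarrow> 'b::real_normed_vector"
  assumes "continuous_on UNIV f" "\<And>x. norm x > R \<Longrightarrow> f x = 0"
  shows "uniformly_continuous_on UNIV f"
  unfolding uniformly_continuous_on_def
proof (intro allI impI)
  fix e :: real assume "e > 0"
  \<comment> \<open>The margin 1 covers mixed pairs: two points at distance below 1 either both lie
    in this ball or both have norm above \<open>R\<close>, where \<open>f\<close> vanishes.\<close>
  have "uniformly_continuous_on (cball 0 (R+1)) f"
    by (rule compact_uniformly_continuous) (auto intro: continuous_on_subset[OF assms(1)])
  then obtain d where d: "d > 0" "\<And>x y. norm x \<le> R+1 \<Longrightarrow> norm y \<le> R+1 \<Longrightarrow> dist y x < d \<Longrightarrow> dist (f y) (f x) < e"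
    using \<open>e > 0\<close> unfolding uniformly_continuous_on_def by (metis mem_cball_0)
  have "dist (f y) (f x) < e" if "dist y x < min d 1" for x y
  proof (cases "norm x > R \<and> norm y > R")
    case True
    then show ?thesis using assms(2) \<open>e > 0\<close> by simp
  next
    case False
    have "norm x \<le> norm y + dist y x" "norm y \<le> norm x + dist y x"
      by (metis dist_norm norm_triangle_sub dist_commute)+
    with False that have "norm x \<le> R+1" "norm y \<le> R+1" by auto
    then show ?thesis using d(2) that by auto
  qed
  then show "\<exists>d>0. \<forall>x\<in>UNIV. \<forall>y\<in>UNIV. dist y x < d \<longrightarrow> dist (f y) (f x) < e"
    using d(1) by (intro exI[of _ "min d 1"]) auto
qed

lemma compact_support_bounded:
  fixes f :: "'a::euclidean_space \<Rightarrow> 'b::real_normed_vector"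
  assumes "continuous_on UNIV f" "\<And>x. norm x > R \<Longrightarrow> f x = 0"
  obtains B where "B > 0" "\<And>x. norm (f x) \<le> B"
proof -
  have "compact (f ` cball 0 R)"
    by (rule compact_continuous_image) (auto intro: continuous_on_subset[OF assms(1)])
  then obtain B where B: "B > 0" "\<And>x. norm x \<le> R \<Longrightarrow> norm (f x) \<le> B"
    by (metis bounded_pos compact_imp_bounded imageI mem_cball_0)
  then have "norm (f x) \<le> B" for x using assms(2)[of x] by (cases "norm x \<le> R") auto
  then show ?thesis using B(1) that by blast
qed

lemma compact_support_integrable:
  fixes f :: "'a::euclidean_space \<Rightarrow> 'b::{banach, second_countable_topology}"
  assumes "continuous_on UNIV f" "\<And>x. norm x > R \<Longrightarrow> f x = 0"
  shows "integrable lebesgue f"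
proof -
  have "integrable lborel (\<lambda>x. indicator (cball 0 R) x *\<^sub>R f x)"
    by (rule borel_integrable_compact) (auto intro: continuous_on_subset[OF assms(1)])
  moreover have "(\<lambda>x. indicator (cball 0 R) x *\<^sub>R f x) = f"
    using assms(2) by (force simp: indicator_def)
  ultimately have "integrable lborel f" by simp
  then show ?thesis
    using integrable_completion[of f lborel] borel_measurable_continuous_onI[OF assms(1)] by simp
qed

lemma integrable_mult_bounded:
  fixes f g :: "'a \<Rightarrow> real"
  assumes "integrable M g" "f \<in> borel_measurable M" "\<And>x. \<bar>f x\<bar> \<le> B"
  shows "integrable M (\<lambda>x. f x * g x)"
proof (rule Bochner_Integration.integrable_bound)
  show "integrable M (\<lambda>x. B * \<bar>g x\<bar>)" using assms by simp
  have "\<bar>f x\<bar> * \<bar>g x\<bar> \<le> \<bar>B\<bar> * \<bar>g x\<bar>" for x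
    using assms(3)[of x] by (intro mult_right_mono) auto
  then show "AE x in M. norm (f x * g x) \<le> norm (B * \<bar>g x\<bar>)" by (simp add: abs_mult)
  show "(\<lambda>x. f x * g x) \<in> borel_measurable M" using assms by simp
qed

lemma C1_compactE:
  fixes h :: "real^'n \<Rightarrow> real"
  assumes "C1_compact h h'"
  obtains R where "R > 0" "\<And>x. norm x > R \<Longrightarrow> h x = 0" "\<And>x. norm x > R \<Longrightarrow> h' x = 0"
    "continuous_on UNIV h" "continuous_on UNIV h'" "\<And>x. (h has_derivative (\<lambda>k. h' x \<bullet> k)) (at x)"
proof -
  have d: "\<And>x. (h has_derivative (\<lambda>k. h' x \<bullet> k)) (at x)" and c: "continuous_on UNIV h'"
    using assms by (auto simp: C1_compact_def)
  obtain R where R: "\<And>x. norm x > R \<Longrightarrow> h x = 0" using assms by (auto simp: C1_compact_def)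
  have z: "h' x = 0" if "norm x > R" for x
    by (rule gradient_zero_outside[OF d open_norm_greater[of R]]) (use that R in auto)
  have "continuous_on UNIV h" using d by (meson continuous_at_imp_continuous_on has_derivative_continuous)
  then show ?thesis using that[of "max R 1"] R z c d by auto
qed

text \<open>The gradient is uniformly continuous, and on a ball where it varies by less than
  \<open>e\<close> the mean value inequality bounds the remainder. Uniformity in \<open>x\<close>
  lets the estimate be integrated, over translates in \<open>integral_partial_eq_0\<close> and under
  the convolution in \<open>conv_has_derivative\<close>.\<close>

lemma C1_compact_uniform_linearization:
  fixes h :: "real^'n \<Rightarrow> real"
  assumes "C1_compact h h'" "e > 0"
  obtains d where "d > 0" "\<And>x k. norm k < d \<Longrightarrow> \<bar>h (x + k) - h x - h' x \<bullet> k\<bar> \<le> e * norm k"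
proof -
  obtain R where R: "\<And>x. norm x > R \<Longrightarrow> h' x = 0" "continuous_on UNIV h'"
    "\<And>x. (h has_derivative (\<lambda>k. h' x \<bullet> k)) (at x)" using C1_compactE[OF assms(1)] by metis
  have "uniformly_continuous_on UNIV h'" using compact_support_uniformly_continuous R(1,2) by blast
  then obtain d where d: "d > 0" "\<And>x y. dist y x < d \<Longrightarrow> dist (h' y) (h' x) < e"
    using assms(2) unfolding uniformly_continuous_on_def by (metis UNIV_I)
  have "\<bar>h (x + k) - h x - h' x \<bullet> k\<bar> \<le> e * norm k" if "norm k < d" for x k
  proof -
    have "norm (h (x + k) - h x - h' x \<bullet> (x + k - x)) \<le> norm (x + k - x) * e"
    proof (rule differentiable_bound_linearization[where S = "ball x d" and f' = "\<lambda>y k. h' y \<bullet> k"])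
      show "x \<in> ball x d" using d(1) by simp
    next
      show "((h has_derivative (\<lambda>k. h' y \<bullet> k)) (at y within ball x d))" for y
        using R(3) by (rule has_derivative_at_withinI)
    next
      fix t :: real assume "t \<in> {0..1}"
      then have "\<bar>t\<bar> * norm k < d" using that by (smt (verit) atLeastAtMost_iff mult_left_le_one_le norm_ge_zero)
      then show "x + t *\<^sub>R (x + k - x) \<in> ball x d" by (simp add: dist_norm)
    next
      fix y assume "y \<in> ball x d"
      then have "norm (h' y - h' x) \<le> e" using d(2)[of y x] by (simp add: dist_norm norm_minus_commute)
      then show "onorm ((\<lambda>k. h' y \<bullet> k) - (\<lambda>k. h' x \<bullet> k)) \<le> e"
      proof (intro onorm_bound)
        fix k
        have "\<bar>(h' y - h' x) \<bullet> k\<bar> \<le> norm (h' y - h' x) * norm k" by (rule Cauchy_Schwarz_ineq2)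
        also have "\<dots> \<le> e * norm k" using \<open>norm (h' y - h' x) \<le> e\<close> by (rule mult_right_mono) simp
        finally show "norm (((\<lambda>k. h' y \<bullet> k) - (\<lambda>k. h' x \<bullet> k)) k) \<le> e * norm k" by (simp add: inner_diff_left)
      qed (use assms(2) in simp)
    qed
    then show ?thesis by (simp add: mult.commute)
  qed
  then show ?thesis using that d(1) by blast
qed

lemma C1_compact_mult:
  fixes g h :: "real^'n \<Rightarrow> real"
  assumes "C1_compact h h'" "\<And>x. (g has_derivative (\<lambda>k. g' x \<bullet> k)) (at x)" "continuous_on UNIV g'"
  shows "C1_compact (\<lambda>x. g x * h x) (\<lambda>x. g x *\<^sub>R h' x + h x *\<^sub>R g' x)"
proof -
  obtain R where R: "\<And>x. norm x > R \<Longrightarrow> h x = 0" "continuous_on UNIV h" "continuous_on UNIV h'"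
    "\<And>x. (h has_derivative (\<lambda>k. h' x \<bullet> k)) (at x)" using C1_compactE[OF assms(1)] by metis
  have "continuous_on UNIV g" using assms(2) by (meson continuous_at_imp_continuous_on has_derivative_continuous)
  then have "continuous_on UNIV (\<lambda>x. g x *\<^sub>R h' x + h x *\<^sub>R g' x)"
    using R assms(3) by (intro continuous_intros)
  moreover have "((\<lambda>x. g x * h x) has_derivative (\<lambda>k. (g x *\<^sub>R h' x + h x *\<^sub>R g' x) \<bullet> k)) (at x)" for x
    using has_derivative_mult[OF assms(2) R(4)]
    by (rule has_derivative_eq_rhs) (auto simp: inner_add_left algebra_simps)
  ultimately show ?thesis using R(1) unfolding C1_compact_def by auto
qed

section \<open>Integration by parts on the whole space\<close>

lemma lebesgue_translation:
  fixes f :: "'a::euclidean_space \<Rightarrow> real"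
  assumes "continuous_on UNIV f"
  shows "integral\<^sup>L lebesgue (\<lambda>x. f (c + x)) = integral\<^sup>L lebesgue f"
proof -
  have m: "f \<in> borel_measurable borel" using assms by (rule borel_measurable_continuous_onI)
  have "integral\<^sup>L lebesgue (\<lambda>x. f (c + x)) = integral\<^sup>L lborel (\<lambda>x. f (c + x))"
    using borel_measurable_continuous_onI[OF continuous_on_compose2[OF assms, of UNIV "\<lambda>x. c + x"]]
    by (intro integral_completion) (simp add: continuous_intros)
  also have "\<dots> = integral\<^sup>L (distr lborel borel ((+) c)) f"
    using m by (intro integral_distr[symmetric]) auto
  also have "\<dots> = integral\<^sup>L lebesgue f"
    using m by (simp add: lborel_distr_plus integral_completion)
  finally show ?thesis .
qed

lemma C1_compact_integrable:
  assumes "C1_compact h h'"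
  shows "integrable lebesgue h" "integrable lebesgue h'" "integrable lebesgue (\<lambda>x. h' x $ i)"
proof -
  obtain R where R: "\<And>x. norm x > R \<Longrightarrow> h x = 0" "\<And>x. norm x > R \<Longrightarrow> h' x = 0"
    "continuous_on UNIV h" "continuous_on UNIV h'" using C1_compactE[OF assms(1)] by metis
  then show "integrable lebesgue h" "integrable lebesgue h'"
    using compact_support_integrable by blast+
  have "continuous_on UNIV (\<lambda>x. h' x $ i)" using R(4) by (rule continuous_on_component)
  then show "integrable lebesgue (\<lambda>x. h' x $ i)" using compact_support_integrable[of "\<lambda>x. h' x $ i" R] R(2) by simp
qed

text \<open>Translation invariance takes the place of Fubini: the integral of h(x + t e_i) - h(x)
  vanishes, and by uniform linearization it differs from t times the integral of the partial
  derivative by at most e t V. Here V is the volume of a ball holding both supports; radius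
  \<open>R + 1\<close> suffices since t \<le> 1.\<close>

lemma integral_partial_eq_0:
  fixes h :: "real^'n \<Rightarrow> real"
  assumes "C1_compact h h'"
  shows "integral\<^sup>L lebesgue (\<lambda>x. h' x $ i) = 0"
proof -
  obtain R where R: "R > 0" "\<And>x. norm x > R \<Longrightarrow> h x = 0" "\<And>x. norm x > R \<Longrightarrow> h' x = 0"
    "continuous_on UNIV h" using C1_compactE[OF assms(1)] by metis
  define V where "V = integral\<^sup>L lebesgue (indicator (cball (0::real^'n) (R+1)) :: _ \<Rightarrow> real)"
  have iV: "integrable lebesgue (indicator (cball (0::real^'n) (R+1)) :: _ \<Rightarrow> real)"
    using emeasure_lborel_cball_finite[of "0::real^'n" "R + 1"] by (simp add: integrable_indicator_iff)
  have "V \<ge> 0" by (simp add: V_def)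
  have "\<bar>integral\<^sup>L lebesgue (\<lambda>x. h' x $ i)\<bar> \<le> e * V" if e: "e > 0" for e
  proof -
    obtain d where d: "d > 0" "\<And>x k. norm k < d \<Longrightarrow> \<bar>h (x + k) - h x - h' x \<bullet> k\<bar> \<le> e * norm k"
      using C1_compact_uniform_linearization[OF assms e] by metis
    define t where "t = min (d/2) 1"
    have t: "t > 0" "t < d" "t \<le> 1" using d(1) by (auto simp: t_def)
    let ?k = "t *\<^sub>R axis i 1 :: real^'n"
    have nk: "norm ?k = t" using t by (simp add: norm_axis_1)
    have c: "continuous_on UNIV (\<lambda>x. h (x + ?k))"
      by (rule continuous_on_compose2[OF R(4)]) (auto intro!: continuous_intros)
    have i1: "integrable lebesgue (\<lambda>x. h (x + ?k))"
    proof (rule compact_support_integrable[OF c])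
      fix x :: "real^'n" assume "norm x > R + 1"
      then have "norm (x + ?k) > R" using norm_triangle_ineq2[of x "-?k"] nk t by (simp)
      then show "h (x + ?k) = 0" using R by blast
    qed
    have i2: "integrable lebesgue h" "integrable lebesgue (\<lambda>x. h' x $ i)" using C1_compact_integrable[OF assms] by auto
    have "integral\<^sup>L lebesgue (\<lambda>x. h (x + ?k)) = integral\<^sup>L lebesgue h"
      using lebesgue_translation[OF R(4), of ?k] by (simp add: add.commute)
    then have "t * integral\<^sup>L lebesgue (\<lambda>x. h' x $ i) = - integral\<^sup>L lebesgue (\<lambda>x. h (x + ?k) - h x - t * h' x $ i)"
      using i1 i2 by simp
    then have "t * \<bar>integral\<^sup>L lebesgue (\<lambda>x. h' x $ i)\<bar> = \<bar>integral\<^sup>L lebesgue (\<lambda>x. h (x + ?k) - h x - t * h' x $ i)\<bar>"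
      by (drule_tac arg_cong[where f = abs]) (simp only: abs_minus_cancel abs_mult abs_of_pos[OF t(1)])
    also have "\<dots> \<le> integral\<^sup>L lebesgue (\<lambda>x. \<bar>h (x + ?k) - h x - t * h' x $ i\<bar>)"
      by (rule integral_abs_bound)
    also have "\<dots> \<le> integral\<^sup>L lebesgue (\<lambda>x. e * t * indicator (cball (0::real^'n) (R+1)) x)"
    proof (rule integral_mono)
      show "integrable lebesgue (\<lambda>x. \<bar>h (x + ?k) - h x - t * h' x $ i\<bar>)" using i1 i2 by simp
      show "integrable lebesgue (\<lambda>x. e * t * indicator (cball (0::real^'n) (R+1)) x)" using iV by simp
      fix x :: "real^'n"
      show "\<bar>h (x + ?k) - h x - t * h' x $ i\<bar> \<le> e * t * indicator (cball 0 (R+1)) x"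
      proof (cases "norm x \<le> R + 1")
        case True
        then show ?thesis using d(2)[of ?k x] nk t by (simp add: inner_axis)
      next
        case False
        then have "norm (x + ?k) > R" using norm_triangle_ineq2[of x "-?k"] nk t by (simp)
        then show ?thesis using R False by simp
      qed
    qed
    also have "\<dots> = t * (e * V)" using iV by (simp add: V_def)
    finally show ?thesis using t by simp
  qed
  note le = this
  have "\<bar>integral\<^sup>L lebesgue (\<lambda>x. h' x $ i)\<bar> \<le> e" if "e > 0" for e
  proof -
    have "\<bar>integral\<^sup>L lebesgue (\<lambda>x. h' x $ i)\<bar> \<le> e / (V + 1) * V" by (rule le) (use that \<open>V \<ge> 0\<close> in simp)
    also have "\<dots> \<le> e" using that \<open>V \<ge> 0\<close> by (simp add: divide_simps)
    finally show ?thesis .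
  qed
  then show ?thesis using field_le_epsilon[of "\<bar>integral\<^sup>L lebesgue (\<lambda>x. h' x $ i)\<bar>" 0] by auto
qed

section \<open>Convolution\<close>

definition conv :: "('a::euclidean_space \<Rightarrow> real) \<Rightarrow> ('a \<Rightarrow> real) \<Rightarrow> 'a \<Rightarrow> real" where
  "conv K u x = (\<integral>z. K (x - z) * u z \<partial>lebesgue)"

lemma conv_integrable:
  fixes K :: "'a::euclidean_space \<Rightarrow> real"
  assumes "continuous_on UNIV K" "\<And>x. norm x > r \<Longrightarrow> K x = 0" "integrable lebesgue u"
  shows "integrable lebesgue (\<lambda>z. K (x - z) * u z)"
proof -
  obtain B where "\<And>x. norm (K x) \<le> B" using compact_support_bounded assms(1,2) by blast
  moreover have "continuous_on UNIV (\<lambda>z. K (x - z))"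
    by (rule continuous_on_compose2[OF assms(1)]) (auto intro!: continuous_intros)
  ultimately show ?thesis
    by (intro integrable_mult_bounded[where B = B]) (auto intro: assms borel_measurable_lebesgue_continuous)
qed

lemma conv_diff_bound:
  fixes K :: "'a::euclidean_space \<Rightarrow> real"
  assumes "continuous_on UNIV K" "\<And>x. norm x > r \<Longrightarrow> K x = 0" "integrable lebesgue u"
    "\<And>z. \<bar>K (x - z) - K (y - z)\<bar> \<le> e"
  shows "\<bar>conv K u x - conv K u y\<bar> \<le> e * (\<integral>z. \<bar>u z\<bar> \<partial>lebesgue)"
proof -
  have i: "integrable lebesgue (\<lambda>z. K (x - z) * u z)" for x by (rule conv_integrable[OF assms(1-3)])
  have "conv K u x - conv K u y = (\<integral>z. K (x - z) * u z - K (y - z) * u z \<partial>lebesgue)"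
    using i by (simp add: conv_def)
  also have "\<bar>\<dots>\<bar> \<le> (\<integral>z. \<bar>K (x - z) * u z - K (y - z) * u z\<bar> \<partial>lebesgue)" by (rule integral_abs_bound)
  also have "\<dots> \<le> (\<integral>z. e * \<bar>u z\<bar> \<partial>lebesgue)"
  proof (rule integral_mono)
    show "\<bar>K (x - z) * u z - K (y - z) * u z\<bar> \<le> e * \<bar>u z\<bar>" for z
      using assms(4)[of z] by (simp add: left_diff_distrib[symmetric] abs_mult mult_right_mono)
  qed (use i assms(3) in auto)
  finally show ?thesis by simp
qed

lemma conv_continuous:
  fixes K :: "'a::euclidean_space \<Rightarrow> real"
  assumes "continuous_on UNIV K" "\<And>x. norm x > r \<Longrightarrow> K x = 0" "integrable lebesgue u"
  shows "continuous_on UNIV (conv K u)"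
  unfolding continuous_on_iff
proof (intro ballI allI impI)
  fix x :: 'a and e :: real assume "e > 0"
  define I where "I = (\<integral>z. \<bar>u z\<bar> \<partial>lebesgue)"
  have I: "I \<ge> 0" by (simp add: I_def)
  have "e / (I + 1) > 0" using \<open>e > 0\<close> I by simp
  moreover have "uniformly_continuous_on UNIV K" by (rule compact_support_uniformly_continuous[OF assms(1,2)])
  ultimately obtain d where d: "d > 0" "\<And>x y. dist y x < d \<Longrightarrow> dist (K y) (K x) < e / (I + 1)"
    unfolding uniformly_continuous_on_def by (metis UNIV_I)
  have "dist (conv K u y) (conv K u x) < e" if "dist y x < d" for y
  proof -
    have "\<bar>K (y - z) - K (x - z)\<bar> \<le> e / (I + 1)" for z
      using d(2)[of "y - z" "x - z"] that by (simp add: dist_norm)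
    from conv_diff_bound[OF assms this]
    have "\<bar>conv K u y - conv K u x\<bar> \<le> e / (I + 1) * I"
      unfolding I_def .
    also have "\<dots> < e" using \<open>e > 0\<close> I by (simp add: divide_simps)
    finally show ?thesis by (simp add: dist_norm)
  qed
  then show "\<exists>d>0. \<forall>x'\<in>UNIV. dist x' x < d \<longrightarrow> dist (conv K u x') (conv K u x) < e" using d(1) by blast
qed

lemma conv_bounded:
  fixes K :: "'a::euclidean_space \<Rightarrow> real"
  assumes "continuous_on UNIV K" "\<And>x. norm x > r \<Longrightarrow> K x = 0" "integrable lebesgue u"
  obtains B where "\<And>x. \<bar>conv K u x\<bar> \<le> B"
proof -
  obtain B where B: "\<And>x. norm (K x) \<le> B" using compact_support_bounded assms(1,2) by blast
  have "\<bar>conv K u x\<bar> \<le> B * (\<integral>z. \<bar>u z\<bar> \<partial>lebesgue)" for x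
  proof -
    have "\<bar>conv K u x\<bar> \<le> (\<integral>z. \<bar>K (x - z) * u z\<bar> \<partial>lebesgue)" unfolding conv_def by (rule integral_abs_bound)
    also have "\<dots> \<le> (\<integral>z. B * \<bar>u z\<bar> \<partial>lebesgue)"
    proof (rule integral_mono)
      show "integrable lebesgue (\<lambda>z. \<bar>K (x - z) * u z\<bar>)" using conv_integrable[OF assms] by simp
      show "\<bar>K (x - z) * u z\<bar> \<le> B * \<bar>u z\<bar>" for z using B[of "x - z"] by (simp add: abs_mult mult_right_mono)
    qed (use assms(3) in simp)
    finally show ?thesis by simp
  qed
  then show ?thesis using that by blast
qed

lemma conv_eq_0:
  fixes K :: "'a::euclidean_space \<Rightarrow> real"
  assumes "\<And>x. norm x > r \<Longrightarrow> K x = 0" "\<And>z. dist x z \<le> r \<Longrightarrow> u z = 0"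
  shows "conv K u x = 0"
proof -
  have "(\<lambda>z. K (x - z) * u z) = (\<lambda>z. 0)"
    using assms(1)[of "x - z" for z] assms(2) by (force simp: dist_norm not_le)
  then show ?thesis unfolding conv_def by simp
qed

text \<open>All derivatives fall on the kernel, so \<open>u\<close> need only be integrable. The
  linearization error of the kernel is uniform in the base point; integrating it against |u| costs
  the factor \<open>I\<close>, which the choice of \<open>e'\<close> absorbs.\<close>

lemma conv_has_derivative:
  fixes K :: "real^'n \<Rightarrow> real"
  assumes "C1_compact K K'" "integrable lebesgue u"
  shows "(conv K u has_derivative (\<lambda>k. (\<chi> i. conv (\<lambda>y. K' y $ i) u x) \<bullet> k)) (at x)"
  unfolding has_derivative_at_alt
proof (intro conjI allI impI)
  show "bounded_linear (\<lambda>k. (\<chi> i. conv (\<lambda>y. K' y $ i) u x) \<bullet> k)" by (rule bounded_linear_inner_right)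
  fix e :: real assume "e > 0"
  obtain R where R: "\<And>x. norm x > R \<Longrightarrow> K x = 0" "\<And>x. norm x > R \<Longrightarrow> K' x = 0"
    "continuous_on UNIV K" "continuous_on UNIV K'" using C1_compactE[OF assms(1)] by metis
  have cc: "continuous_on UNIV (\<lambda>x. K' x $ i)" for i using R(4) by (rule continuous_on_component)
  have iK: "integrable lebesgue (\<lambda>z. K (y - z) * u z)" for y
    by (rule conv_integrable[OF R(3,1) assms(2)])
  have iK': "integrable lebesgue (\<lambda>z. K' (x - z) $ i * u z)" for i
    by (rule conv_integrable[OF cc _ assms(2), of R]) (simp add: R)
  define I where "I = (\<integral>z. \<bar>u z\<bar> \<partial>lebesgue)"
  have I: "I \<ge> 0" by (simp add: I_def)
  define e' where "e' = e / (I + 1)"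
  have e': "e' > 0" "e' * I \<le> e" using \<open>e > 0\<close> I by (auto simp: e'_def divide_simps)
  obtain d where d: "d > 0" "\<And>x k. norm k < d \<Longrightarrow> \<bar>K (x + k) - K x - K' x \<bullet> k\<bar> \<le> e' * norm k"
    using C1_compact_uniform_linearization[OF assms(1) e'(1)] by metis
  have "norm (conv K u y - conv K u x - (\<chi> i. conv (\<lambda>y. K' y $ i) u x) \<bullet> (y - x)) \<le> e * norm (y - x)"
    if "norm (y - x) < d" for y
  proof -
    let ?k = "y - x"
    have iD: "integrable lebesgue (\<lambda>z. (K' (x - z) \<bullet> ?k) * u z)"
      unfolding inner_vec_def sum_distrib_right
    proof (intro Bochner_Integration.integrable_sum)
      fix i
      have "integrable lebesgue (\<lambda>z. ?k $ i * (K' (x - z) $ i * u z))" using iK' by (intro integrable_mult_right)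
      then show "integrable lebesgue (\<lambda>z. K' (x - z) $ i \<bullet> ?k $ i * u z)" by (simp add: mult_ac)
    qed
    have "(\<chi> i. conv (\<lambda>y. K' y $ i) u x) \<bullet> ?k = (\<Sum>i\<in>UNIV. \<integral>z. (K' (x - z) $ i * u z) * ?k $ i \<partial>lebesgue)"
      by (simp add: inner_vec_def conv_def)
    also have "\<dots> = (\<integral>z. (\<Sum>i\<in>UNIV. (K' (x - z) $ i * u z) * ?k $ i) \<partial>lebesgue)"
      using iK' by (intro Bochner_Integration.integral_sum[symmetric]) simp
    also have "\<dots> = (\<integral>z. (K' (x - z) \<bullet> ?k) * u z \<partial>lebesgue)"
      by (simp only: inner_vec_def sum_distrib_left inner_real_def mult_ac)
    finally have eq: "conv K u y - conv K u x - (\<chi> i. conv (\<lambda>y. K' y $ i) u x) \<bullet> ?k =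
        (\<integral>z. K (y - z) * u z - K (x - z) * u z - (K' (x - z) \<bullet> ?k) * u z \<partial>lebesgue)"
      using iK iD by (simp add: conv_def)
    have "\<bar>conv K u y - conv K u x - (\<chi> i. conv (\<lambda>y. K' y $ i) u x) \<bullet> ?k\<bar> \<le> (\<integral>z. \<bar>K (y - z) * u z - K (x - z) * u z - (K' (x - z) \<bullet> ?k) * u z\<bar> \<partial>lebesgue)"
      unfolding eq by (rule integral_abs_bound)
    also have "\<dots> \<le> (\<integral>z. (e' * norm ?k) * \<bar>u z\<bar> \<partial>lebesgue)"
    proof (rule integral_mono)
      show "integrable lebesgue (\<lambda>z. \<bar>K (y - z) * u z - K (x - z) * u z - (K' (x - z) \<bullet> ?k) * u z\<bar>)"
        using iK iD by simp
      show "integrable lebesgue (\<lambda>z. (e' * norm ?k) * \<bar>u z\<bar>)" using assms(2) by simp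
      fix z
      have "\<bar>K (y - z) - K (x - z) - K' (x - z) \<bullet> ?k\<bar> \<le> e' * norm ?k"
        using d(2)[OF that, of "x - z"] by simp
      then show "\<bar>K (y - z) * u z - K (x - z) * u z - (K' (x - z) \<bullet> ?k) * u z\<bar> \<le> (e' * norm ?k) * \<bar>u z\<bar>"
        by (simp add: left_diff_distrib[symmetric] abs_mult mult_right_mono)
    qed
    also have "\<dots> = (e' * I) * norm ?k" by (simp add: I_def)
    also have "\<dots> \<le> e * norm ?k" using e' by (simp add: mult_right_mono)
    finally show ?thesis by simp
  qed
  then show "\<exists>d>0. \<forall>y. norm (y - x) < d \<longrightarrow>
      norm (conv K u y - conv K u x - (\<chi> i. conv (\<lambda>y. K' y $ i) u x) \<bullet> (y - x)) \<le> e * norm (y - x)"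
    using d(1) by blast
qed

section \<open>Mollification\<close>

definition mollifier :: "real \<Rightarrow> real^'n \<Rightarrow> real" where
  "mollifier r x = bump r x / integral\<^sup>L lebesgue (bump r :: real^'n \<Rightarrow> real)"

lemma AE_lebesgue_iff_negligible: "(AE x in lebesgue. P x) \<longleftrightarrow> negligible {x. \<not> P x}"
  by (simp add: completion.AE_iff_null_sets negligible_iff_null_sets)

lemma smooth_kernels_continuous:
  assumes "f \<in> smooth_kernels r"
  shows "continuous_on UNIV f" "\<And>x. norm x > r \<Longrightarrow> f x = 0"
proof -
  obtain d where "C1_compact f d" using smooth_kernels_derivative[OF assms] by metis
  then show "continuous_on UNIV f" by (rule C1_compactE)
  show "norm x > r \<Longrightarrow> f x = 0" for x using assms by (simp add: smooth_kernels_def)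
qed

text \<open>Normalisation is legitimate because the integral of \<open>bump r\<close> is positive:
  if it were 0, the open ball on which the bump is positive would be negligible. Evenness and
  translation invariance carry the total mass over to the kernel z -> x - z.\<close>

lemma mollifier:
  fixes x :: "real^'n"
  assumes r: "r > 0"
  shows mollifier_smooth: "(mollifier r :: real^'n \<Rightarrow> real) \<in> smooth_kernels r"
    and mollifier_nonneg: "mollifier r x \<ge> 0"
    and mollifier_integral: "(\<integral>z. mollifier r (x - z) \<partial>lebesgue) = 1"
proof -
  let ?b = "bump r :: real^'n \<Rightarrow> real"
  have b: "?b \<in> smooth_kernels r" using bump_facts(1)[OF r] .
  note bc = smooth_kernels_continuous[OF b]
  have i: "integrable lebesgue ?b" by (rule compact_support_integrable[OF bc])
  have "integral\<^sup>L lebesgue ?b \<noteq> 0"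
  proof
    assume "integral\<^sup>L lebesgue ?b = 0"
    then have "AE x in lebesgue. ?b x = 0"
      using integral_nonneg_eq_0_iff_AE[OF i AE_I2] bump_facts(2)[OF r] by metis
    then have "negligible {x. ?b x \<noteq> 0}" by (simp add: AE_lebesgue_iff_negligible)
    then have "negligible (ball (0::real^'n) r)"
      using bump_facts(3)[OF r] by (elim negligible_subset) (force simp: less_le)
    then show False using open_not_negligible[of "ball (0::real^'n) r"] r by simp
  qed
  moreover have "integral\<^sup>L lebesgue ?b \<ge> 0"
    by (rule Bochner_Integration.integral_nonneg) (rule bump_facts(2)[OF r])
  ultimately have pos: "integral\<^sup>L lebesgue ?b > 0" by simp
  have eq: "mollifier r = (\<lambda>x. (1 / integral\<^sup>L lebesgue ?b) * ?b x)" by (auto simp: mollifier_def)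
  have "(\<lambda>x. (1 / integral\<^sup>L lebesgue ?b) * ?b x) \<in> kernel_algebra (r\<^sup>2)"
    using b by (intro kernel_algebra.mult kernel_algebra.const) (simp add: smooth_kernels_def)
  then show "(mollifier r :: real^'n \<Rightarrow> real) \<in> smooth_kernels r"
    using b unfolding eq smooth_kernels_def by simp
  show "mollifier r x \<ge> 0" using bump_facts(2)[OF r, of x] pos by (simp add: mollifier_def)
  have "(\<integral>z. ?b (x - z) \<partial>lebesgue) = (\<integral>z. ?b ((- x) + z) \<partial>lebesgue)"
    using bump_facts(4)[OF r, of "x - z" for z] by simp
  also have "\<dots> = integral\<^sup>L lebesgue ?b" by (rule lebesgue_translation[OF bc(1)])
  finally show "(\<integral>z. mollifier r (x - z) \<partial>lebesgue) = 1" using pos by (simp add: mollifier_def)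
qed

lemmas mollifier_continuous = smooth_kernels_continuous[OF mollifier_smooth]

lemma mollifier_shift_integrable:
  fixes x :: "real^'n"
  assumes "r > 0"
  shows "integrable lebesgue (\<lambda>z. mollifier r (x - z))"
  \<comment> \<open>A non-integrable function would have Bochner integral 0 by default, whereas this
    integral is 1.\<close>
  using mollifier_integral[OF assms, of x] not_integrable_integral_eq by force

lemma conv_mollifier_integrable:
  fixes u :: "real^'n \<Rightarrow> real"
  assumes "r > 0" "integrable lebesgue u"
  shows "integrable lebesgue (\<lambda>z. mollifier r (x - z) * u z)"
  by (rule conv_integrable[OF mollifier_continuous[OF assms(1)] assms(2)])

text \<open>The kernel is a probability density carried by the ball of radius \<open>r\<close>, so
  the value at \<open>x\<close> is an average of nearby values of \<open>u\<close>. With a = 0 this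
  also gives the sup bound used in \<open>tested_with_C1_compact\<close>.\<close>

lemma conv_mollifier_approx:
  fixes u :: "real^'n \<Rightarrow> real"
  assumes "r > 0" "integrable lebesgue u" "\<And>z. dist x z \<le> r \<Longrightarrow> \<bar>u z - a\<bar> \<le> e"
  shows "\<bar>conv (mollifier r) u x - a\<bar> \<le> e"
proof -
  note i = conv_mollifier_integrable[OF assms(1,2), of x] mollifier_shift_integrable[OF assms(1), of x]
  have "conv (mollifier r) u x - a = (\<integral>z. mollifier r (x - z) * u z - a * mollifier r (x - z) \<partial>lebesgue)"
    using i mollifier_integral[OF assms(1), of x] by (simp add: conv_def)
  also have "\<bar>\<dots>\<bar> \<le> (\<integral>z. \<bar>mollifier r (x - z) * u z - a * mollifier r (x - z)\<bar> \<partial>lebesgue)" by (rule integral_abs_bound)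
  also have "\<dots> \<le> (\<integral>z. e * mollifier r (x - z) \<partial>lebesgue)"
  proof (rule integral_mono)
    fix z
    have "\<bar>mollifier r (x - z) * u z - a * mollifier r (x - z)\<bar> = mollifier r (x - z) * \<bar>u z - a\<bar>"
      using mollifier_nonneg[OF assms(1), of "x - z"]
      by (metis abs_mult abs_of_nonneg mult.commute right_diff_distrib)
    also have "\<dots> \<le> e * mollifier r (x - z)"
    proof (cases "dist x z \<le> r")
      case True
      then have "mollifier r (x - z) * \<bar>u z - a\<bar> \<le> mollifier r (x - z) * e"
        by (intro mult_left_mono assms(3) mollifier_nonneg[OF assms(1)])
      then show ?thesis by (simp only: mult.commute)
    next
      case False
      then show ?thesis using mollifier_continuous(2)[OF assms(1), of "x - z"] by (simp add: dist_norm)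
    qed
    finally show "\<bar>mollifier r (x - z) * u z - a * mollifier r (x - z)\<bar> \<le> e * mollifier r (x - z)" .
  qed (use i in auto)
  also have "\<dots> = e" using mollifier_integral[OF assms(1), of x] by simp
  finally show ?thesis .
qed

text \<open>Tonelli: after exchanging the integrals, each point z contributes |u z| times the mass
  of the kernel, which is 1 by evenness.\<close>

lemma conv_mollifier_L1:
  fixes u :: "real^'n \<Rightarrow> real"
  assumes r: "r > 0" and u: "integrable lebesgue u"
  shows "integrable lebesgue (conv (mollifier r) u)"
    "(\<integral>x. \<bar>conv (mollifier r) u x\<bar> \<partial>lebesgue) \<le> (\<integral>x. \<bar>u x\<bar> \<partial>lebesgue)"
proof -
  let ?m = "mollifier r :: real^'n \<Rightarrow> real"
  \<comment> \<open>The exchange of integrals needs joint Borel measurability, hence a Borel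
    representative of \<open>u\<close>; the integrals over z do not notice the change on a null
    set.\<close>
  obtain u' where u': "u' \<in> borel_measurable lborel" "AE x in lborel. u x = u' x"
    using completion_ex_borel_measurable_real u by (metis borel_measurable_integrable)
  have [measurable]: "u' \<in> borel_measurable borel" using u'(1) by simp
  have ae: "AE x in lebesgue. u x = u' x" using u'(2) by (rule AE_completion)
  have [measurable]: "?m \<in> borel_measurable borel"
    using borel_measurable_continuous_onI[OF mollifier_continuous(1)[OF r]] .
  have c: "continuous_on UNIV (conv ?m u)" by (rule conv_continuous[OF mollifier_continuous[OF r] u])
  have [measurable]: "conv ?m u \<in> borel_measurable borel" using borel_measurable_continuous_onI[OF c] .
  have pt: "ennreal \<bar>conv ?m u x\<bar> \<le> (\<integral>\<^sup>+z. ennreal (?m (x - z) * \<bar>u' z\<bar>) \<partial>lborel)" for x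
  proof -
    have i: "integrable lebesgue (\<lambda>z. ?m (x - z) * u z)" by (rule conv_mollifier_integrable[OF r u])
    have "ennreal \<bar>conv ?m u x\<bar> \<le> (\<integral>\<^sup>+z. norm (?m (x - z) * u z) \<partial>lebesgue)"
      using integral_norm_bound_ennreal[OF i] by (simp add: conv_def)
    also have "\<dots> = (\<integral>\<^sup>+z. ennreal (?m (x - z) * \<bar>u' z\<bar>) \<partial>lebesgue)"
      by (rule nn_integral_cong_AE) (use ae in \<open>auto simp: abs_mult mollifier_nonneg[OF r]\<close>)
    finally show ?thesis by (simp add: nn_integral_completion)
  qed
  have "(\<integral>\<^sup>+x. ennreal \<bar>conv ?m u x\<bar> \<partial>lborel) \<le> (\<integral>\<^sup>+x. (\<integral>\<^sup>+z. ennreal (?m (x - z) * \<bar>u' z\<bar>) \<partial>lborel) \<partial>lborel)"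
    by (intro nn_integral_mono pt)
  also have "\<dots> = (\<integral>\<^sup>+z. (\<integral>\<^sup>+x. ennreal (?m (x - z) * \<bar>u' z\<bar>) \<partial>lborel) \<partial>lborel)"
    by (rule lborel_pair.Fubini') measurable
  also have "\<dots> = (\<integral>\<^sup>+z. ennreal \<bar>u' z\<bar> \<partial>lborel)"
  proof (rule nn_integral_cong)
    fix z
    have "(\<integral>\<^sup>+x. ennreal (?m (x - z)) \<partial>lborel) = (\<integral>\<^sup>+x. ennreal (?m (z - x)) \<partial>lborel)"
      using bump_facts(4)[OF r, of "z - x" for x] by (simp add: mollifier_def)
    also have "\<dots> = (\<integral>\<^sup>+x. ennreal (?m (z - x)) \<partial>lebesgue)" by (simp add: nn_integral_completion)
    also have "\<dots> = ennreal (\<integral>x. ?m (z - x) \<partial>lebesgue)"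
      using mollifier_shift_integrable[OF r, of z] mollifier_nonneg[OF r] by (intro nn_integral_eq_integral) auto
    finally have "(\<integral>\<^sup>+x. ennreal (?m (x - z)) \<partial>lborel) = 1" using mollifier_integral[OF r, of z] by simp
    then show "(\<integral>\<^sup>+x. ennreal (?m (x - z) * \<bar>u' z\<bar>) \<partial>lborel) = ennreal \<bar>u' z\<bar>"
      by (simp add: ennreal_mult'' nn_integral_multc)
  qed
  also have "\<dots> = (\<integral>\<^sup>+z. ennreal \<bar>u z\<bar> \<partial>lebesgue)"
  proof -
    have "(\<integral>\<^sup>+z. ennreal \<bar>u' z\<bar> \<partial>lborel) = (\<integral>\<^sup>+z. ennreal \<bar>u' z\<bar> \<partial>lebesgue)"
      by (rule nn_integral_completion[symmetric])
    also have "\<dots> = (\<integral>\<^sup>+z. ennreal \<bar>u z\<bar> \<partial>lebesgue)"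
      by (rule nn_integral_cong_AE) (use ae in auto)
    finally show ?thesis .
  qed
  also have "\<dots> = ennreal (\<integral>z. \<bar>u z\<bar> \<partial>lebesgue)" using u by (intro nn_integral_eq_integral) auto
  finally have le: "(\<integral>\<^sup>+x. ennreal \<bar>conv ?m u x\<bar> \<partial>lebesgue) \<le> ennreal (\<integral>z. \<bar>u z\<bar> \<partial>lebesgue)"
    by (simp add: nn_integral_completion)
  show i: "integrable lebesgue (conv ?m u)"
    using le borel_measurable_lebesgue_continuous[OF c] by (intro integrableI_bounded) (auto intro: le_less_trans)
  have "ennreal (\<integral>x. \<bar>conv ?m u x\<bar> \<partial>lebesgue) \<le> ennreal (\<integral>z. \<bar>u z\<bar> \<partial>lebesgue)"
    using le i by (simp add: nn_integral_eq_integral)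
  then show "(\<integral>x. \<bar>conv ?m u x\<bar> \<partial>lebesgue) \<le> (\<integral>x. \<bar>u x\<bar> \<partial>lebesgue)" by simp
qed

section \<open>Density of compactly supported continuous functions in L1, and convergence of
  mollifications\<close>

definition L1_approximable :: "('a::euclidean_space \<Rightarrow> real) \<Rightarrow> bool" where
  "L1_approximable u \<longleftrightarrow> (\<forall>e>0. \<exists>g R. continuous_on UNIV g \<and> (\<forall>x. norm x > R \<longrightarrow> g x = 0) \<and>
      (\<integral>x. \<bar>u x - g x\<bar> \<partial>lebesgue) < e)"

lemma L1_approximableE:
  assumes "L1_approximable u" "e > 0"
  obtains g R where "continuous_on UNIV g" "\<And>x. norm x > R \<Longrightarrow> g x = 0"
    "(\<integral>x. \<bar>u x - g x\<bar> \<partial>lebesgue) < e"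
  using assms unfolding L1_approximable_def by blast

text \<open>The bound with factor 2 is the one supplied by the limit case of the induction rule for
  Bochner integrable functions; \<open>3 * \<bar>u x\<bar>\<close> then dominates the
  differences.\<close>

lemma L1_approximable_limit:
  fixes u :: "'a::euclidean_space \<Rightarrow> real"
  assumes "integrable lebesgue u" "\<And>n. integrable lebesgue (s n)" "\<And>n. L1_approximable (s n)"
    "\<And>x. (\<lambda>n. s n x) \<longlonglongrightarrow> u x" "\<And>n x. \<bar>s n x\<bar> \<le> 2 * \<bar>u x\<bar>"
  shows "L1_approximable u"
  unfolding L1_approximable_def
proof (intro allI impI)
  fix e :: real assume "e > 0"
  have "(\<lambda>n. \<integral>x. \<bar>u x - s n x\<bar> \<partial>lebesgue) \<longlonglongrightarrow> (\<integral>x. 0 \<partial>(lebesgue :: 'a measure))"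
  proof (rule integral_dominated_convergence[where w = "\<lambda>x. 3 * \<bar>u x\<bar>"])
    show "AE x in lebesgue. (\<lambda>n. \<bar>u x - s n x\<bar>) \<longlonglongrightarrow> 0"
      using assms(4) by (auto intro!: AE_I2 tendsto_eq_intros)
    show "AE x in lebesgue. norm \<bar>u x - s n x\<bar> \<le> 3 * \<bar>u x\<bar>" for n
      using assms(5)[of n] by (intro AE_I2) (smt (verit) real_norm_def)
  qed (use assms(1,2) in auto)
  then have "eventually (\<lambda>n. (\<integral>x. \<bar>u x - s n x\<bar> \<partial>lebesgue) < e / 2) sequentially"
    using \<open>e > 0\<close> by (intro order_tendstoD) auto
  then obtain n where n: "(\<integral>x. \<bar>u x - s n x\<bar> \<partial>lebesgue) < e / 2" by (auto dest: eventually_happens)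
  obtain g R where g: "continuous_on UNIV g" "\<And>x. norm x > R \<Longrightarrow> g x = 0" "(\<integral>x. \<bar>s n x - g x\<bar> \<partial>lebesgue) < e / 2"
    by (rule L1_approximableE[OF assms(3)[of n], of "e / 2"]) (use \<open>e > 0\<close> in auto)
  have ig: "integrable lebesgue g" using compact_support_integrable g(1,2) by blast
  have "(\<integral>x. \<bar>u x - g x\<bar> \<partial>lebesgue) \<le> (\<integral>x. \<bar>u x - s n x\<bar> + \<bar>s n x - g x\<bar> \<partial>lebesgue)"
    using assms(1,2) ig by (intro integral_mono) auto
  also have "\<dots> = (\<integral>x. \<bar>u x - s n x\<bar> \<partial>lebesgue) + (\<integral>x. \<bar>s n x - g x\<bar> \<partial>lebesgue)"
    using assms(1,2) ig by (intro Bochner_Integration.integral_add) auto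
  finally show "\<exists>g R. continuous_on UNIV g \<and> (\<forall>x. norm x > R \<longrightarrow> g x = 0) \<and> (\<integral>x. \<bar>u x - g x\<bar> \<partial>lebesgue) < e"
    using g n by (intro exI[of _ g] exI[of _ R]) auto
qed

text \<open>The set is squeezed between a closed \<open>C\<close> and an open \<open>T\<close>, each
  with error e/2. A Urysohn function between them differs from the indicator only on
  \<open>T - A\<close> and \<open>A - C\<close>; cutting \<open>T\<close> with a ball makes its
  support bounded.\<close>

lemma L1_approximable_bounded_set:
  fixes A :: "'a::euclidean_space set"
  assumes "A \<in> sets lebesgue" "bounded A"
  shows "L1_approximable (indicator A :: 'a \<Rightarrow> real)"
  unfolding L1_approximable_def
proof (intro allI impI)
  fix e :: real assume "e > 0"
  obtain R where R: "R > 0" "A \<subseteq> ball 0 R" using assms(2) bounded_subset_ballD by blast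
  obtain T where T: "open T" "A \<subseteq> T" "T - A \<in> lmeasurable" "emeasure lebesgue (T - A) < ennreal (e/2)"
    using sets_lebesgue_outer_open[OF assms(1), of "e/2"] \<open>e > 0\<close> by (metis half_gt_zero)
  obtain C where C: "closed C" "C \<subseteq> A" "A - C \<in> lmeasurable" "emeasure lebesgue (A - C) < ennreal (e/2)"
    using sets_lebesgue_inner_closed[OF assms(1), of "e/2"] \<open>e > 0\<close> by (metis half_gt_zero)
  have m: "measure lebesgue (T - A) < e/2" "measure lebesgue (A - C) < e/2"
    using T(3,4) C(3,4) \<open>e > 0\<close> by (auto simp: emeasure_eq_measure2 ennreal_less_iff)
  obtain g :: "'a \<Rightarrow> real" where g: "continuous_on UNIV g" "\<And>x. g x \<in> closed_segment 1 0"
      "\<And>x. x \<in> C \<Longrightarrow> g x = 1" "\<And>x. x \<in> - (T \<inter> ball 0 R) \<Longrightarrow> g x = 0"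
    by (rule Urysohn[of C "- (T \<inter> ball 0 R)" "1::real" 0]) (use C T R in auto)
  have g01: "0 \<le> g x" "g x \<le> 1" for x using g(2)[of x] by (auto simp: closed_segment_eq_real_ivl)
  have g0: "g x = 0" if "norm x > R" for x using g(4)[of x] that by auto
  have ig: "integrable lebesgue g" by (rule compact_support_integrable[OF g(1) g0])
  have iA: "integrable lebesgue (indicator A :: 'a \<Rightarrow> real)"
    using bounded_set_imp_lmeasurable[OF assms(2,1)] by (simp only: lmeasurable_iff_integrable)
  have "(\<integral>x. \<bar>indicator A x - g x\<bar> \<partial>lebesgue) \<le> (\<integral>x. indicator (T - A) x + indicator (A - C) x \<partial>lebesgue)"
  proof (rule integral_mono)
    show "integrable lebesgue (\<lambda>x. indicator (T - A) x + indicator (A - C) x :: real)"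
      using T(3) C(3) by (auto simp: fmeasurable_def less_top)
    show "\<bar>indicator A x - g x\<bar> \<le> indicator (T - A) x + indicator (A - C) x" for x
      using g01[of x] g(3,4)[of x] T(2) by (auto simp: indicator_def)
  qed (use ig iA in auto)
  also have "\<dots> = measure lebesgue (T - A) + measure lebesgue (A - C)"
    using T(3) C(3) by (subst Bochner_Integration.integral_add) (auto simp: fmeasurable_def less_top)
  also have "\<dots> < e" using m by simp
  finally show "\<exists>g R. continuous_on UNIV g \<and> (\<forall>x. norm x > R \<longrightarrow> g x = 0) \<and> (\<integral>x. \<bar>indicator A x - g x\<bar> \<partial>lebesgue) < e"
    using g g0 by blast
qed

lemma L1_approximable_integrable:
  fixes u :: "'a::euclidean_space \<Rightarrow> real"
  assumes "integrable lebesgue u"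
  shows "L1_approximable u"
  using assms
proof induction
  case (base A c)
  \<comment> \<open>A set of finite measure may be unbounded. It is truncated by balls, and
    \<open>L1_approximable_limit\<close> removes the truncation.\<close>
  have "L1_approximable (\<lambda>x. indicator (A \<inter> ball 0 (real n)) x *\<^sub>R c)" for n
    unfolding L1_approximable_def
  proof (intro allI impI)
    fix e :: real assume "e > 0"
    have ap: "L1_approximable (indicator (A \<inter> ball 0 (real n)) :: 'a \<Rightarrow> real)"
      using base by (intro L1_approximable_bounded_set) (auto intro: bounded_subset[OF bounded_ball])
    obtain g R where g: "continuous_on UNIV g" "\<And>x. norm x > R \<Longrightarrow> g x = 0"
        "(\<integral>x. \<bar>indicator (A \<inter> ball 0 (real n)) x - g x\<bar> \<partial>lebesgue) < e / (\<bar>c\<bar> + 1)"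
      by (rule L1_approximableE[OF ap, of "e / (\<bar>c\<bar> + 1)"]) (use \<open>e > 0\<close> in auto)
    have "(\<integral>x. \<bar>indicator (A \<inter> ball 0 (real n)) x *\<^sub>R c - g x * c\<bar> \<partial>lebesgue) =
        (\<integral>x. \<bar>indicator (A \<inter> ball 0 (real n)) x - g x\<bar> * \<bar>c\<bar> \<partial>lebesgue)"
      by (simp add: left_diff_distrib[symmetric] abs_mult)
    also have "\<dots> = (\<integral>x. \<bar>indicator (A \<inter> ball 0 (real n)) x - g x\<bar> \<partial>lebesgue) * \<bar>c\<bar>" by simp
    also have "\<dots> \<le> e / (\<bar>c\<bar> + 1) * \<bar>c\<bar>" using g(3) by (intro mult_right_mono) auto
    also have "\<dots> < e" using \<open>e > 0\<close> by (simp add: divide_simps)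
    finally show "\<exists>g R. continuous_on UNIV g \<and> (\<forall>x. norm x > R \<longrightarrow> g x = 0) \<and>
        (\<integral>x. \<bar>indicator (A \<inter> ball 0 (real n)) x *\<^sub>R c - g x\<bar> \<partial>lebesgue) < e"
      using g(1,2) by (intro exI[of _ "\<lambda>x. g x * c"] exI[of _ R]) (auto intro!: continuous_intros)
  qed
  then show ?case
  proof (rule L1_approximable_limit[rotated 2])
    show "integrable lebesgue (\<lambda>x. indicator A x *\<^sub>R c)" using base by simp
    show "integrable lebesgue (\<lambda>x. indicator (A \<inter> ball 0 (real n)) x *\<^sub>R c)" for n
    proof (rule Bochner_Integration.integrable_bound[OF \<open>integrable lebesgue (\<lambda>x. indicator A x *\<^sub>R c)\<close>])
      have "A \<inter> ball 0 (real n) \<in> sets lebesgue" using base(1) by (intro sets.Int) auto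
      then show "(\<lambda>x. indicator (A \<inter> ball 0 (real n)) x *\<^sub>R c) \<in> borel_measurable lebesgue"
        by (intro borel_measurable_scaleR borel_measurable_indicator borel_measurable_const)
      show "AE x in lebesgue. norm (indicator (A \<inter> ball 0 (real n)) x *\<^sub>R c) \<le> norm (indicator A x *\<^sub>R c)"
        by (intro AE_I2) (simp add: indicator_def)
    qed
    show "(\<lambda>n. indicator (A \<inter> ball 0 (real n)) x *\<^sub>R c) \<longlonglongrightarrow> indicator A x *\<^sub>R c" for x
    proof (rule tendsto_eventually)
      obtain N :: nat where N: "norm x < real N" using reals_Archimedean2 by blast
      show "eventually (\<lambda>n. indicator (A \<inter> ball 0 (real n)) x *\<^sub>R c = indicator A x *\<^sub>R c) sequentially"
        using N by (intro eventually_sequentiallyI[of N]) (auto simp: indicator_def)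
    qed
  qed (auto simp: indicator_def)
next
  case (add f g)
  show ?case unfolding L1_approximable_def
  proof (intro allI impI)
    fix e :: real assume "e > 0"
    obtain h R where h: "continuous_on UNIV h" "\<And>x. norm x > R \<Longrightarrow> h x = 0" "(\<integral>x. \<bar>f x - h x\<bar> \<partial>lebesgue) < e / 2"
      by (rule L1_approximableE[OF add.IH(1), of "e / 2"]) (use \<open>e > 0\<close> in auto)
    obtain k S where k: "continuous_on UNIV k" "\<And>x. norm x > S \<Longrightarrow> k x = 0" "(\<integral>x. \<bar>g x - k x\<bar> \<partial>lebesgue) < e / 2"
      by (rule L1_approximableE[OF add.IH(2), of "e / 2"]) (use \<open>e > 0\<close> in auto)
    have i: "integrable lebesgue h" "integrable lebesgue k" using compact_support_integrable h(1,2) k(1,2) by blast+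
    have "(\<integral>x. \<bar>f x + g x - (h x + k x)\<bar> \<partial>lebesgue) \<le> (\<integral>x. \<bar>f x - h x\<bar> + \<bar>g x - k x\<bar> \<partial>lebesgue)"
      using i add.hyps by (intro integral_mono) auto
    also have "\<dots> = (\<integral>x. \<bar>f x - h x\<bar> \<partial>lebesgue) + (\<integral>x. \<bar>g x - k x\<bar> \<partial>lebesgue)"
      using i add.hyps by (intro Bochner_Integration.integral_add) auto
    also have "\<dots> < e" using h k by simp
    finally show "\<exists>g' R. continuous_on UNIV g' \<and> (\<forall>x. norm x > R \<longrightarrow> g' x = 0) \<and> (\<integral>x. \<bar>f x + g x - g' x\<bar> \<partial>lebesgue) < e"
      using h k by (intro exI[of _ "\<lambda>x. h x + k x"] exI[of _ "max R S"]) (auto intro!: continuous_intros)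
  qed
next
  case (lim f s)
  show ?case by (rule L1_approximable_limit[OF lim.hyps(4) lim.hyps(1) lim.IH]) (use lim.hyps in auto)
qed

text \<open>With \<open>g\<close> continuous of compact support and close to \<open>u\<close> in L1,
  the mollification of \<open>u - g\<close> stays small by the contraction
  \<open>conv_mollifier_L1\<close>, and that of \<open>g\<close> is uniformly close to
  \<open>g\<close> and supported in the ball of radius \<open>R + 1\<close> once r < 1.\<close>

lemma conv_mollifier_tendsto:
  fixes u :: "real^'n \<Rightarrow> real"
  assumes u: "integrable lebesgue u"
  shows "((\<lambda>r. \<integral>x. \<bar>conv (mollifier r) u x - u x\<bar> \<partial>lebesgue) \<longlongrightarrow> 0) (at_right 0)"
proof (rule tendstoI)
  fix e :: real assume "e > 0"
  obtain g R where g: "continuous_on UNIV g" "\<And>x. norm x > R \<Longrightarrow> g x = 0" "(\<integral>x. \<bar>u x - g x\<bar> \<partial>lebesgue) < e / 4"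
    by (rule L1_approximableE[OF L1_approximable_integrable[OF u], of "e / 4"]) (use \<open>e > 0\<close> in auto)
  have ig: "integrable lebesgue g" using compact_support_integrable g(1,2) by blast
  define V where "V = integral\<^sup>L lebesgue (indicator (cball (0::real^'n) (R+1)) :: _ \<Rightarrow> real)"
  have iV: "integrable lebesgue (indicator (cball (0::real^'n) (R+1)) :: _ \<Rightarrow> real)"
    using emeasure_lborel_cball_finite[of "0::real^'n" "R + 1"] by (simp add: integrable_indicator_iff)
  have V: "V \<ge> 0" by (simp add: V_def)
  define e' where "e' = e / 4 / (V + 1)"
  have e': "e' > 0" "e' * V \<le> e / 4" using \<open>e > 0\<close> V by (auto simp: e'_def divide_simps)
  have "uniformly_continuous_on UNIV g" using compact_support_uniformly_continuous g(1,2) by blast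
  then obtain d where d: "d > 0" "\<And>x y. dist y x < d \<Longrightarrow> dist (g y) (g x) < e'"
    using e'(1) unfolding uniformly_continuous_on_def by (metis UNIV_I)
  have "dist (\<integral>x. \<bar>conv (mollifier r) u x - u x\<bar> \<partial>lebesgue) 0 < e" if r: "0 < r" "r < min d 1" for r
  proof -
    let ?c = "\<lambda>u x. conv (mollifier r) u x"
    have i: "integrable lebesgue (?c u)" "integrable lebesgue (?c g)" "integrable lebesgue (?c (\<lambda>x. u x - g x))"
      using conv_mollifier_L1(1)[OF r(1)] u ig by auto
    have diff: "?c (\<lambda>x. u x - g x) x = ?c u x - ?c g x" for x
      using conv_mollifier_integrable[OF r(1) u, of x] conv_mollifier_integrable[OF r(1) ig, of x]
      by (simp add: conv_def right_diff_distrib)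
    have gpt: "\<bar>?c g x - g x\<bar> \<le> e' * indicator (cball 0 (R+1)) x" for x
    proof (cases "norm x \<le> R + 1")
      case True
      have "\<bar>g z - g x\<bar> \<le> e'" if "dist x z \<le> r" for z
        using d(2)[of z x] that r by (simp add: dist_commute dist_real_def)
      then show ?thesis using conv_mollifier_approx[OF r(1) ig, of x "g x" e'] True by simp
    next
      case False
      have "g z = 0" if "dist x z \<le> r" for z
      proof -
        have "norm x \<le> norm z + dist x z" by (metis dist_norm norm_triangle_sub)
        then show ?thesis using False that r g(2)[of z] by auto
      qed
      then have "?c g x = 0" by (intro conv_eq_0[OF mollifier_continuous(2)[OF r(1)]])
      then show ?thesis using False g(2)[of x] by simp
    qed
    have "(\<integral>x. \<bar>?c u x - u x\<bar> \<partial>lebesgue) \<le>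
        (\<integral>x. \<bar>?c (\<lambda>x. u x - g x) x\<bar> + (e' * indicator (cball (0::real^'n) (R+1)) x + \<bar>u x - g x\<bar>) \<partial>lebesgue)"
    proof (rule integral_mono)
      fix x
      show "\<bar>?c u x - u x\<bar> \<le> \<bar>?c (\<lambda>x. u x - g x) x\<bar> + (e' * indicator (cball 0 (R+1)) x + \<bar>u x - g x\<bar>)"
        using gpt[of x] unfolding diff by linarith
    qed (use i u ig iV in auto)
    also have "\<dots> = (\<integral>x. \<bar>?c (\<lambda>x. u x - g x) x\<bar> \<partial>lebesgue) + (e' * V + (\<integral>x. \<bar>u x - g x\<bar> \<partial>lebesgue))"
      using i u ig iV by (simp add: V_def)
    also have "\<dots> \<le> (\<integral>x. \<bar>u x - g x\<bar> \<partial>lebesgue) + (e' * V + (\<integral>x. \<bar>u x - g x\<bar> \<partial>lebesgue))"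
      using conv_mollifier_L1(2)[OF r(1), of "\<lambda>x. u x - g x"] u ig by simp
    also have "\<dots> < e" using g(3) e'(2) \<open>e > 0\<close> by linarith
    finally show ?thesis by simp
  qed
  then show "eventually (\<lambda>r. dist (\<integral>x. \<bar>conv (mollifier r) u x - u x\<bar> \<partial>lebesgue) 0 < e) (at_right 0)"
    using d(1) by (auto simp: eventually_at_right_field intro!: exI[of _ "min d 1"])
qed

section \<open>Test functions and weak derivatives\<close>

lemma smooth_kernels_scale:
  "f \<in> smooth_kernels r \<Longrightarrow> (\<lambda>x. c * f x) \<in> smooth_kernels r"
  by (auto simp: smooth_kernels_def intro!: kernel_algebra.mult kernel_algebra.const)

lemma partial_deriv_conv:
  fixes f :: "real^'n \<Rightarrow> real"
  assumes "f \<in> smooth_kernels r" "integrable lebesgue u"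
  shows "conv f u differentiable (at x)" "partial_deriv i (conv f u) x = conv (partial_deriv i f) u x"
    "partial_deriv i f \<in> smooth_kernels r"
proof -
  obtain d where d: "C1_compact f d" "\<And>i. (\<lambda>x. d x $ i) \<in> smooth_kernels r" "\<And>i x. partial_deriv i f x = d x $ i"
    using smooth_kernels_derivative[OF assms(1)] by metis
  have eq: "partial_deriv i f = (\<lambda>x. d x $ i)" for i using d(3) by auto
  note D = conv_has_derivative[OF d(1) assms(2), of x]
  show "conv f u differentiable (at x)" using D by (rule differentiableI)
  show "partial_deriv i (conv f u) x = conv (partial_deriv i f) u x"
    unfolding eq using partial_deriv_eq[OF D, of i] by simp
  show "partial_deriv i f \<in> smooth_kernels r" using d(2) by (simp add: eq)
qed

lemma conv_C_infinity:
  fixes f :: "real^'n \<Rightarrow> real"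
  assumes "f \<in> smooth_kernels r" "integrable lebesgue u"
  shows "C_infinity (conv f u)"
proof (rule C_infinity_coinduct[where S = "{conv g u | g. g \<in> smooth_kernels r}"])
  fix h and i :: 'n and x
  assume "h \<in> {conv g u | g. g \<in> smooth_kernels r}"
  then obtain g where g: "g \<in> smooth_kernels r" "h = conv g u" by blast
  show "h differentiable (at x)" using partial_deriv_conv(1)[OF g(1) assms(2)] g(2) by simp
  have "partial_deriv i h = conv (partial_deriv i g) u" using partial_deriv_conv(2)[OF g(1) assms(2)] g(2) by auto
  then show "partial_deriv i h \<in> {conv g u | g. g \<in> smooth_kernels r}"
    using partial_deriv_conv(3)[OF g(1) assms(2)] by blast
qed (use assms in auto)

lemma test_functionI:
  assumes "C_infinity f" "compact K" "K \<subseteq> \<Omega>" "\<And>x. x \<notin> K \<Longrightarrow> f x = 0"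
  shows "f \<in> test_functions \<Omega>"
proof -
  have "closure {x. f x \<noteq> 0} \<subseteq> K"
    using assms by (intro closure_minimal) (auto simp: compact_imp_closed)
  moreover from this have "compact (closure {x. f x \<noteq> 0})"
    using assms(2) compact_closure compact_imp_bounded bounded_subset closure_subset by meson
  ultimately show ?thesis using assms by (auto simp: test_functions_def)
qed

lemma conv_test_function:
  fixes f :: "real^'n \<Rightarrow> real"
  assumes "f \<in> smooth_kernels r" "integrable lebesgue u" "compact K" "\<And>z. z \<notin> K \<Longrightarrow> u z = 0"
    "\<And>x z. z \<in> K \<Longrightarrow> dist x z \<le> r \<Longrightarrow> x \<in> \<Omega>"
  shows "conv f u \<in> test_functions \<Omega>"
proof (rule test_functionI[OF conv_C_infinity[OF assms(1,2)]])
  let ?S = "{x + y | x y. x \<in> K \<and> y \<in> cball 0 r}"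
  show "compact ?S" using assms(3) by (intro compact_sums) auto
  have d: "dist (a + b) a = norm b" for a b :: "real^'n" by (simp add: dist_norm)
  show "?S \<subseteq> \<Omega>" using assms(5) d by force
  show "conv f u x = 0" if "x \<notin> ?S" for x
  proof (rule conv_eq_0[OF smooth_kernels_continuous(2)[OF assms(1)]])
    fix z assume "dist x z \<le> r"
    then have "x = z + (x - z)" "x - z \<in> cball 0 r" by (auto simp: dist_norm norm_minus_commute)
    then show "u z = 0" using that assms(4) by blast
  qed
qed

lemma reflected_kernel_deriv:
  fixes f :: "real^'n \<Rightarrow> real"
  assumes "f \<in> smooth_kernels r"
  shows "(\<lambda>z. f (x - z)) differentiable (at z)" "partial_deriv i (\<lambda>z. f (x - z)) z = - partial_deriv i f (x - z)"
    "partial_deriv i f \<in> smooth_kernels r"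
proof -
  obtain d where d: "C1_compact f d" "\<And>i. (\<lambda>x. d x $ i) \<in> smooth_kernels r" "\<And>i x. partial_deriv i f x = d x $ i"
    using smooth_kernels_derivative[OF assms(1)] by metis
  have eq: "partial_deriv i f = (\<lambda>x. d x $ i)" for i using d(3) by auto
  have "(f has_derivative (\<lambda>k. d (x - z) \<bullet> k)) (at (x - z))" using d(1) by (simp add: C1_compact_def)
  then have "((\<lambda>z. f (x - z)) has_derivative (\<lambda>k. d (x - z) \<bullet> (- k))) (at z)"
    by (rule has_derivative_compose[rotated]) (auto intro!: derivative_eq_intros)
  then have D: "((\<lambda>z. f (x - z)) has_derivative (\<lambda>k. (- d (x - z)) \<bullet> k)) (at z)" by simp
  show "(\<lambda>z. f (x - z)) differentiable (at z)" using D by (rule differentiableI)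
  show "partial_deriv i (\<lambda>z. f (x - z)) z = - partial_deriv i f (x - z)"
    using partial_deriv_eq[OF D, of i] d(3) by simp
  show "partial_deriv i f \<in> smooth_kernels r" using d(2) by (simp add: eq)
qed

text \<open>For fixed \<open>x\<close> this is the test function that turns the definition of a weak
  derivative into an identity between convolutions at \<open>x\<close>.\<close>

lemma reflected_kernel_test_function:
  fixes f :: "real^'n \<Rightarrow> real"
  assumes "f \<in> smooth_kernels r" "cball x r \<subseteq> \<Omega>"
  shows "(\<lambda>z. f (x - z)) \<in> test_functions \<Omega>"
proof (rule test_functionI[OF _ compact_cball assms(2)])
  show "f (x - z) = 0" if "z \<notin> cball x r" for z
    using that smooth_kernels_continuous(2)[OF assms(1)] by (simp add: dist_norm)
  show "C_infinity (\<lambda>z. f (x - z))"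
  proof (rule C_infinity_coinduct[where S = "{\<lambda>z. g (x - z) | g. g \<in> smooth_kernels r}"])
    fix h and i :: 'n and y
    assume "h \<in> {\<lambda>z. g (x - z) | g. g \<in> smooth_kernels r}"
    then obtain g where g: "g \<in> smooth_kernels r" "h = (\<lambda>z. g (x - z))" by blast
    show "h differentiable (at y)" using reflected_kernel_deriv(1)[OF g(1)] g(2) by simp
    have "partial_deriv i h = (\<lambda>z. (\<lambda>y. (-1) * partial_deriv i g y) (x - z))"
      using reflected_kernel_deriv(2)[OF g(1)] g(2) by auto
    then show "partial_deriv i h \<in> {\<lambda>z. g (x - z) | g. g \<in> smooth_kernels r}"
      using smooth_kernels_scale[OF reflected_kernel_deriv(3)[OF g(1)], of "-1" i]
      by (intro CollectI exI[of _ "\<lambda>y. (-1) * partial_deriv i g y"]) simp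
  qed (use assms in auto)
qed

section \<open>Mollification of weak derivatives, and their uniqueness\<close>

lemma locally_integrable_indicator:
  fixes u :: "'a::euclidean_space \<Rightarrow> real"
  assumes "locally_integrable_on u \<Omega>" "compact D" "D \<subseteq> \<Omega>"
  shows "integrable lebesgue (\<lambda>z. indicator D z * u z)"
proof -
  have "integrable (lebesgue_on D) u" using assms by (simp add: locally_integrable_on_def)
  moreover have "D \<in> sets lebesgue" using assms(2) by (simp add: lmeasurable_compact fmeasurableD)
  ultimately show ?thesis by (simp add: integrable_restrict_space)
qed

text \<open>The definition of the weak derivative is tested with z -> f(x - z); the sign from the
  reflection cancels the sign in that definition. Cutting off at \<open>D\<close> makes the
  functions integrable on the whole space without changing the values at \<open>x\<close>, since the
  kernel only sees \<open>cball x r\<close>.\<close>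

lemma weak_partial_conv:
  fixes u :: "real^'n \<Rightarrow> real"
  assumes "open \<Omega>" "has_weak_partial \<Omega> i u g" "f \<in> smooth_kernels r" "cball x r \<subseteq> D" "D \<subseteq> \<Omega>"
  shows "conv (partial_deriv i f) (\<lambda>z. indicator D z * u z) x = conv f (\<lambda>z. indicator D z * g z) x"
proof -
  have \<Omega>: "\<Omega> \<inter> space lebesgue \<in> sets lebesgue" using assms(1) by simp
  have t: "(\<lambda>z. f (x - z)) \<in> test_functions \<Omega>"
    using assms by (intro reflected_kernel_test_function[OF assms(3)]) auto
  have red: "indicator \<Omega> z *\<^sub>R (v z * h (x - z)) = h (x - z) * (indicator D z * v z)"
    if "h \<in> smooth_kernels r" for h v z
    using smooth_kernels_continuous(2)[OF that, of "x - z"] assms(4,5)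
    by (cases "dist x z \<le> r") (auto simp: dist_norm indicator_def)
  have "(\<integral>z. u z * (- partial_deriv i f (x - z)) \<partial>lebesgue_on \<Omega>) = - (\<integral>z. g z * f (x - z) \<partial>lebesgue_on \<Omega>)"
  proof -
    have "(\<integral>z. u z * partial_deriv i (\<lambda>z. f (x - z)) z \<partial>lebesgue_on \<Omega>) = - (\<integral>z. g z * f (x - z) \<partial>lebesgue_on \<Omega>)"
      using assms(2) t unfolding has_weak_partial_def by blast
    then show ?thesis unfolding reflected_kernel_deriv(2)[OF assms(3)] .
  qed
  then have "(\<integral>z. u z * partial_deriv i f (x - z) \<partial>lebesgue_on \<Omega>) = (\<integral>z. g z * f (x - z) \<partial>lebesgue_on \<Omega>)"
    by simp
  then show ?thesis
    unfolding integral_restrict_space[OF \<Omega>] red[OF assms(3)] red[OF reflected_kernel_deriv(3)[OF assms(3)]] conv_def .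
qed

text \<open>By \<open>weak_partial_conv\<close> the mollifications of the difference, cut off at a
  ball, vanish on the half ball; as they converge in L1, so does the difference almost everywhere
  there. Negligibility is a local property. The lemma identifies the arbitrary choice made in
  \<open>weak_partial\<close> with a classical derivative when there is one.\<close>

lemma weak_partial_unique:
  fixes u :: "real^'n \<Rightarrow> real"
  assumes "open \<Omega>" "has_weak_partial \<Omega> i u g" "has_weak_partial \<Omega> i u h"
  shows "AE x in lebesgue_on \<Omega>. g x = h x"
proof -
  let ?N = "{x\<in>\<Omega>. g x \<noteq> h x}"
  have "negligible ?N"
    unfolding locally_negligible_alt[of ?N]
  proof
    fix y assume "y \<in> ?N"
    then obtain s where s: "s > 0" "cball y s \<subseteq> \<Omega>" using assms(1) open_contains_cball by blast
    let ?D = "cball y s" and ?E = "cball y (s/2)"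
    define k where "k z = indicator ?D z * (g z - h z)" for z
    have li: "integrable lebesgue (\<lambda>z. indicator ?D z * g z)" "integrable lebesgue (\<lambda>z. indicator ?D z * h z)"
      using assms(2,3) s by (auto simp: has_weak_partial_def intro!: locally_integrable_indicator)
    have k: "k = (\<lambda>z. indicator ?D z * g z - indicator ?D z * h z)" by (auto simp: k_def algebra_simps)
    have ik: "integrable lebesgue k" using li by (simp add: k)
    have cz: "conv (mollifier r) k x = 0" if r: "0 < r" "r < s/2" and x: "x \<in> ?E" for r x
    proof -
      have sub: "cball x r \<subseteq> ?D" using r x by (simp add: subset_cball cball_subset_cball_iff dist_commute)
      have "conv (mollifier r) (\<lambda>z. indicator ?D z * g z) x = conv (mollifier r) (\<lambda>z. indicator ?D z * h z) x"
        using weak_partial_conv[OF assms(1,2) mollifier_smooth[OF r(1)] sub s(2)]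
          weak_partial_conv[OF assms(1,3) mollifier_smooth[OF r(1)] sub s(2)] by simp
      then show ?thesis
        using conv_mollifier_integrable[OF r(1) li(1), of x] conv_mollifier_integrable[OF r(1) li(2), of x]
        by (simp add: k conv_def right_diff_distrib)
    qed
    define I where "I = (\<integral>x. indicator ?E x * \<bar>k x\<bar> \<partial>lebesgue)"
    have iE: "integrable lebesgue (\<lambda>x. indicator ?E x * \<bar>k x\<bar>)"
      using ik
    proof (intro integrable_mult_bounded[where B = 1])
      show "indicator ?E \<in> borel_measurable lebesgue" by (rule borel_measurable_indicator) simp
    qed (auto simp: indicator_def)
    have "I \<le> (\<integral>x. \<bar>conv (mollifier r) k x - k x\<bar> \<partial>lebesgue)" if r: "0 < r" "r < s/2" for r
      unfolding I_def
    proof (rule integral_mono[OF iE])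
      show "integrable lebesgue (\<lambda>x. \<bar>conv (mollifier r) k x - k x\<bar>)"
        using conv_mollifier_L1(1)[OF r(1) ik] ik by simp
      show "indicator ?E x * \<bar>k x\<bar> \<le> \<bar>conv (mollifier r) k x - k x\<bar>" for x
        using cz[OF r, of x] by (cases "x \<in> ?E") auto
    qed
    then have "eventually (\<lambda>r. I \<le> (\<integral>x. \<bar>conv (mollifier r) k x - k x\<bar> \<partial>lebesgue)) (at_right 0)"
      using s(1) by (auto simp: eventually_at_right_field intro!: exI[of _ "s/2"])
    then have "I \<le> 0" using tendsto_lowerbound[OF conv_mollifier_tendsto[OF ik]] by simp
    moreover have "I \<ge> 0" unfolding I_def by (intro Bochner_Integration.integral_nonneg) auto
    ultimately have "I = 0" by simp
    moreover have "AE x in lebesgue. 0 \<le> indicator ?E x * \<bar>k x\<bar>" by simp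
    ultimately have "AE x in lebesgue. indicator ?E x * \<bar>k x\<bar> = 0"
      using integral_nonneg_eq_0_iff_AE[OF iE] unfolding I_def by blast
    then have neg: "negligible {x. indicator ?E x * \<bar>k x\<bar> \<noteq> 0}" by (simp add: AE_lebesgue_iff_negligible)
    have "negligible (?N \<inter> ball y (s/2))"
      by (rule negligible_subset[OF neg]) (use s(1) in \<open>auto simp: k_def indicator_def\<close>)
    then show "\<exists>U. openin (top_of_set ?N) U \<and> y \<in> U \<and> negligible U"
      using \<open>y \<in> ?N\<close> s(1) by (intro exI[of _ "?N \<inter> ball y (s/2)"]) auto
  qed
  moreover have "{x. \<not> (x \<in> \<Omega> \<longrightarrow> g x = h x)} = ?N" by auto
  ultimately show ?thesis
    using assms(1) by (simp add: AE_restrict_space_iff AE_lebesgue_iff_negligible)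
qed

section \<open>Classical derivatives as weak derivatives\<close>

lemma test_function_C1_compact:
  assumes "f \<in> test_functions \<Omega>"
  shows "C1_compact f (\<lambda>x. \<chi> i. partial_deriv i f x)"
proof -
  have C: "C_infinity f" and K: "compact (closure {x. f x \<noteq> 0})" using assms by (auto simp: test_functions_def)
  have d: "f differentiable (at x)" for x using C[unfolded C_infinity_def, rule_format, of "[]"] by simp
  have "partial_deriv i f differentiable (at x)" for i x
    using C[unfolded C_infinity_def, rule_format, of "[i]"] by simp
  then have "continuous_on UNIV (partial_deriv i f)" for i
    by (meson continuous_at_imp_continuous_on differentiable_imp_continuous_within)
  then have "continuous_on UNIV (\<lambda>x. \<chi> i. partial_deriv i f x)" by (intro continuous_on_vec_lambda) auto
  moreover obtain R where "\<And>x. x \<in> closure {x. f x \<noteq> 0} \<Longrightarrow> norm x \<le> R"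
    using K compact_imp_bounded bounded_iff by metis
  then have "\<forall>x. norm x > R \<longrightarrow> f x = 0" using closure_subset[of "{x. f x \<noteq> 0}"] by force
  ultimately show ?thesis unfolding C1_compact_def using has_derivative_partials[OF d] by blast
qed

lemma test_function_eq_0:
  assumes "f \<in> test_functions \<Omega>" "x \<notin> \<Omega>"
  shows "f x = 0"
proof (rule ccontr)
  assume "f x \<noteq> 0"
  then have "x \<in> closure {x. f x \<noteq> 0}" using closure_subset[of "{x. f x \<noteq> 0}"] by blast
  then show False using assms by (auto simp: test_functions_def)
qed

lemma continuous_locally_integrable:
  fixes f :: "'a::euclidean_space \<Rightarrow> real"
  assumes "continuous_on UNIV f"
  shows "locally_integrable_on f \<Omega>"
  unfolding locally_integrable_on_def
proof (intro allI impI)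
  fix K assume K: "compact K \<and> K \<subseteq> \<Omega>"
  have "integrable lborel (\<lambda>x. indicator K x *\<^sub>R f x)"
    using K by (intro borel_integrable_compact continuous_on_subset[OF assms]) auto
  then have "integrable lebesgue (\<lambda>x. indicator K x *\<^sub>R f x)"
    by (subst integrable_completion) (auto dest: borel_measurable_integrable)
  moreover have "K \<in> sets lebesgue" using K by (simp add: lmeasurable_compact fmeasurableD)
  ultimately show "integrable (lebesgue_on K) f" by (simp add: integrable_restrict_space)
qed

text \<open>The product of \<open>f\<close> with a test function is again C1 with compact support,
  and \<open>integral_partial_eq_0\<close> applied to it is the integration by parts. Later uses
  take \<Omega> to be the whole space as well.\<close>

lemma C1_compact_has_weak_partial:
  fixes f :: "real^'n \<Rightarrow> real"
  assumes "open \<Omega>" "C1_compact f f'" "\<And>x. x \<notin> \<Omega> \<Longrightarrow> f x = 0"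
  shows "has_weak_partial \<Omega> i f (\<lambda>x. f' x $ i)"
  unfolding has_weak_partial_def
proof (intro conjI ballI)
  obtain R where R: "\<And>x. norm x > R \<Longrightarrow> f x = 0" and cf: "continuous_on UNIV f" and "continuous_on UNIV f'"
    using C1_compactE[OF assms(2)] by metis
  from continuous_on_component[OF this(3), of i] have cp: "continuous_on UNIV (\<lambda>x. f' x $ i)" by simp
  show "locally_integrable_on f \<Omega>" "locally_integrable_on (\<lambda>x. f' x $ i) \<Omega>"
    using cf cp by (auto intro: continuous_locally_integrable)
  fix p assume p: "p \<in> test_functions \<Omega>"
  note cp' = test_function_C1_compact[OF p]
  have cpp: "continuous_on UNIV p" using C1_compactE[OF cp'] by metis
  have "continuous_on UNIV (\<lambda>x. \<chi> i. partial_deriv i p x)" using cp' by (simp add: C1_compact_def)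
  from continuous_on_component[OF this, of i] have cq: "continuous_on UNIV (partial_deriv i p)" by simp
  obtain S where S: "\<And>x. norm x > S \<Longrightarrow> p x = 0" using C1_compactE[OF cp'] by metis
  have \<Omega>: "\<Omega> \<inter> space lebesgue \<in> sets lebesgue" using assms(1) by simp
  have f0: "f x = 0" "p x = 0" if "x \<notin> \<Omega>" for x
    using test_function_eq_0 assms(3) p that by blast+
  have i: "integrable lebesgue (\<lambda>x. f x * partial_deriv i p x)" "integrable lebesgue (\<lambda>x. f' x $ i * p x)"
    using compact_support_integrable[OF continuous_on_mult[OF cf cq], of R]
      compact_support_integrable[OF continuous_on_mult[OF cp cpp], of S] R S by auto
  have "C1_compact (\<lambda>x. f x * p x) (\<lambda>x. f x *\<^sub>R (\<chi> i. partial_deriv i p x) + p x *\<^sub>R f' x)"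
    using assms(2) cp' by (intro C1_compact_mult) (auto simp: C1_compact_def)
  from integral_partial_eq_0[OF this, of i]
  have "(\<integral>x. f x * partial_deriv i p x + f' x $ i * p x \<partial>lebesgue) = 0" by (simp add: mult.commute)
  then have "(\<integral>x. f x * partial_deriv i p x \<partial>lebesgue) = - (\<integral>x. f' x $ i * p x \<partial>lebesgue)" using i by simp
  moreover have red: "indicator \<Omega> x *\<^sub>R (f x * partial_deriv i p x) = f x * partial_deriv i p x"
      "indicator \<Omega> x *\<^sub>R (f' x $ i * p x) = f' x $ i * p x" for x
    using f0[of x] by (auto simp: indicator_def)
  ultimately show "(\<integral>x. f x * partial_deriv i p x \<partial>lebesgue_on \<Omega>) = - (\<integral>x. f' x $ i * p x \<partial>lebesgue_on \<Omega>)"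
    unfolding integral_restrict_space[OF \<Omega>] red by simp
qed

lemma test_function_has_weak_partial:
  fixes f :: "real^'n \<Rightarrow> real"
  assumes "open \<Omega>" "f \<in> test_functions \<Omega>"
  shows "has_weak_partial \<Omega> i f (partial_deriv i f)"
  using C1_compact_has_weak_partial[OF assms(1) test_function_C1_compact[OF assms(2)] test_function_eq_0[OF assms(2)], of i]
  by simp

lemma weak_partial_works: "has_weak_partial \<Omega> i u g \<Longrightarrow> has_weak_partial \<Omega> i u (weak_partial \<Omega> i u)"
  unfolding weak_partial_def by (rule someI[where P = "has_weak_partial \<Omega> i u"])

lemma weak_grad_test_function:
  fixes f :: "real^'n \<Rightarrow> real"
  assumes "open \<Omega>" "f \<in> test_functions \<Omega>"
  shows "AE x in lebesgue_on \<Omega>. weak_grad \<Omega> f x = (\<chi> i. partial_deriv i f x)"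
proof -
  have "AE x in lebesgue_on \<Omega>. weak_partial \<Omega> i f x = partial_deriv i f x" for i
    using test_function_has_weak_partial[OF assms, of i] weak_partial_works weak_partial_unique[OF assms(1)] by blast
  then have "AE x in lebesgue_on \<Omega>. \<forall>i. weak_partial \<Omega> i f x = partial_deriv i f x"
    by (simp add: AE_all_countable)
  then show ?thesis by eventually_elim (simp add: weak_grad_def vec_eq_iff)
qed

text \<open>The choice in \<open>weak_partial\<close> guarantees local integrability only;
  measurability on all of \<Omega> is recovered from an exhaustion by compact sets.\<close>

lemma locally_integrable_measurable:
  fixes g :: "'a::euclidean_space \<Rightarrow> real"
  assumes "open \<Omega>" "locally_integrable_on g \<Omega>"
  shows "g \<in> borel_measurable (lebesgue_on \<Omega>)"
proof -
  obtain K :: "nat \<Rightarrow> 'a set" where K: "\<And>n. compact (K n)" "\<Union>(range K) = \<Omega>"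
    using open_Union_compact_subsets[OF assms(1)] by metis
  have "(\<lambda>z. indicator (\<Union>i<n. K i) z * g z) \<in> borel_measurable lebesgue" for n
  proof -
    have "compact (\<Union>i<n. K i)" using K(1) by (intro compact_UN) auto
    then show ?thesis
      using K(2) by (intro borel_measurable_integrable[OF locally_integrable_indicator[OF assms(2)]]) auto
  qed
  moreover have "(\<lambda>n. indicator (\<Union>i<n. K i) z * g z) \<longlonglongrightarrow> indicator \<Omega> z * g z" for z
  proof (cases "z \<in> \<Omega>")
    case True
    then obtain m where m: "z \<in> K m" using K(2) by blast
    show ?thesis
      by (intro tendsto_eventually eventually_sequentiallyI[of "Suc m"]) (use m True in \<open>force simp: indicator_def\<close>)
  next
    case False
    then have "z \<notin> K i" for i using K(2) by blast
    then show ?thesis using False by simp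
  qed
  ultimately have "(\<lambda>z. indicator \<Omega> z * g z) \<in> borel_measurable lebesgue"
    by (rule borel_measurable_LIMSEQ_real[rotated])
  then show ?thesis using assms(1) by (simp add: borel_measurable_restrict_space_iff)
qed

section \<open>Membership of test functions in the Orlicz--Sobolev space\<close>

lemma bounded_in_orlicz_space:
  fixes u :: "'a::euclidean_space \<Rightarrow> real"
  assumes "open \<Omega>" "bounded \<Omega>" "continuous_on UNIV A" "u \<in> borel_measurable (lebesgue_on \<Omega>)"
    "AE x in lebesgue_on \<Omega>. \<bar>u x\<bar> \<le> B"
  shows "u \<in> orlicz_space A \<Omega>"
proof -
  have "compact (A ` {0..B})" by (intro compact_continuous_image continuous_on_subset[OF assms(3)]) auto
  then obtain C where C: "\<And>t. t \<in> {0..B} \<Longrightarrow> \<bar>A t\<bar> \<le> C"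
    by (metis bounded_iff compact_imp_bounded imageI real_norm_def)
  have fin: "emeasure lebesgue \<Omega> < \<infinity>"
    using assms(1,2) by (metis bounded_set_imp_lmeasurable fmeasurableD2 infinity_ennreal_def less_top lmeasurable_open)
  have "(\<integral>\<^sup>+x. ennreal (A (\<bar>u x\<bar> / 1)) \<partial>lebesgue_on \<Omega>) \<le> (\<integral>\<^sup>+x. ennreal C \<partial>lebesgue_on \<Omega>)"
  proof (rule nn_integral_mono_AE)
    show "AE x in lebesgue_on \<Omega>. ennreal (A (\<bar>u x\<bar> / 1)) \<le> ennreal C"
      using assms(5)
    proof eventually_elim
      case (elim x)
      then show ?case using C[of "\<bar>u x\<bar>"] by (intro ennreal_leI) simp
    qed
  qed
  also have "\<dots> = ennreal C * emeasure lebesgue \<Omega>" using assms(1) by (simp add: emeasure_restrict_space)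
  also have "\<dots> < \<infinity>" using fin by (simp add: ennreal_mult_less_top)
  finally show ?thesis unfolding orlicz_space_def using assms(4) by (auto intro: exI[of _ 1])
qed

lemma test_function_in_W10L:
  fixes f :: "real^'n \<Rightarrow> real"
  assumes "open \<Omega>" "bounded \<Omega>" "continuous_on UNIV A" "f \<in> test_functions \<Omega>"
  shows "f \<in> W10L A \<Omega>"
proof -
  note c = test_function_C1_compact[OF assms(4)]
  obtain R where R: "\<And>x. norm x > R \<Longrightarrow> f x = 0" "\<And>x. norm x > R \<Longrightarrow> (\<chi> i. partial_deriv i f x) = 0"
      "continuous_on UNIV f" "continuous_on UNIV (\<lambda>x. \<chi> i. partial_deriv i f x)" using C1_compactE[OF c] by metis
  have cp: "continuous_on UNIV (partial_deriv i f)" for i using continuous_on_component[OF R(4), of i] by simp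
  obtain B where B: "\<And>x. norm (f x) \<le> B" using compact_support_bounded[OF R(3,1)] by metis
  obtain B' where B': "\<And>x. norm (\<chi> i. partial_deriv i f x) \<le> B'" using compact_support_bounded[OF R(4,2)] by metis
  have B'i: "\<bar>partial_deriv i f x\<bar> \<le> B'" for i x
    using component_le_norm_cart[of "\<chi> i. partial_deriv i f x" i] B'[of x] by simp
  have m: "g \<in> borel_measurable (lebesgue_on \<Omega>)" if "continuous_on UNIV g" for g :: "real^'n \<Rightarrow> real"
    using borel_measurable_lebesgue_continuous[OF that] measurable_restrict_space1 by blast
  have of: "f \<in> orlicz_space A \<Omega>"
    using B by (intro bounded_in_orlicz_space[OF assms(1-3) m[OF R(3)], of B]) auto
  have op: "partial_deriv i f \<in> orlicz_space A \<Omega>" for i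
    using B'i by (intro bounded_in_orlicz_space[OF assms(1-3) m[OF cp], of i B']) auto
  \<comment> \<open>The jet contains the chosen representative of the derivative, which agrees with
    the classical one only almost everywhere; hence the almost-everywhere bound in
    \<open>bounded_in_orlicz_space\<close>.\<close>
  have ow: "weak_partial \<Omega> i f \<in> orlicz_space A \<Omega>" for i
  proof (rule bounded_in_orlicz_space[OF assms(1-3)])
    have w: "has_weak_partial \<Omega> i f (weak_partial \<Omega> i f)"
      using test_function_has_weak_partial[OF assms(1,4)] weak_partial_works by blast
    then show "weak_partial \<Omega> i f \<in> borel_measurable (lebesgue_on \<Omega>)"
      using locally_integrable_measurable[OF assms(1)] by (simp add: has_weak_partial_def)
    show "AE x in lebesgue_on \<Omega>. \<bar>weak_partial \<Omega> i f x\<bar> \<le> B'"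
      using weak_partial_unique[OF assms(1) w test_function_has_weak_partial[OF assms(1,4)]]
      by eventually_elim (use B'i in simp)
  qed
  have "f \<in> W1L A \<Omega>"
    using of op test_function_has_weak_partial[OF assms(1,4)] unfolding W1L_def by blast
  \<comment> \<open>A closure consists of points of the topological space only, so an element of the
    set lies in its closure once its jet is known to lie in \<open>prod_L\<close>.\<close>
  moreover have "jet \<Omega> f \<in> topspace (weak_star_topology A \<Omega>)"
    using of ow by (auto simp: weak_star_topology_def topspace_pullback_topology prod_L_def jet_def split: option.split)
  then have "jet \<Omega> f \<in> weak_star_topology A \<Omega> closure_of (jet \<Omega> ` test_functions \<Omega>)"
    using assms(4) by (auto simp: in_closure_of)
  ultimately show ?thesis by (simp add: W10L_def)
qed

section \<open>The nonlinearity\<close>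

locale N_function =
  fixes \<phi> :: "real \<Rightarrow> real"
  assumes phi_cont: "continuous_on {0<..} \<phi>" and phi_pos: "\<And>t. t > 0 \<Longrightarrow> \<phi> t > 0"
    and m_mono: "strict_mono (m_fun \<phi>)" and m_0: "(m_fun \<phi> \<longlongrightarrow> 0) (at 0)"
    and m_top: "filterlim (m_fun \<phi>) at_top at_top"
begin

abbreviation m :: "real \<Rightarrow> real" where "m \<equiv> m_fun \<phi>"
abbreviation M :: "real \<Rightarrow> real" where "M \<equiv> M_fun \<phi>"

text \<open>The value \<open>\<phi> 0\<close> is arbitrary, but the factor \<xi> makes the field
  vanish at the origin all the same.\<close>

definition flux :: "real^'n \<Rightarrow> real^'n" where
  "flux \<xi> = \<phi> (norm \<xi>) *\<^sub>R \<xi>"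

lemma m_zero [simp]: "m 0 = 0"
  by (simp add: m_fun_def)

lemma m_odd: "m (- t) = - m t"
  by (simp add: m_fun_def)

lemma m_nonneg: "t \<ge> 0 \<Longrightarrow> m t \<ge> 0"
  using strict_mono_less_eq[OF m_mono, of 0 t] by simp

lemma isCont_m: "isCont m t"
proof -
  consider "t > 0" | "t < 0" | "t = 0" by linarith
  then show ?thesis
  proof cases
    case 3
    then show ?thesis using m_0 by (simp add: isCont_def)
  next
    case 1
    have "isCont \<phi> \<bar>t\<bar>" using 1 phi_cont by (simp add: continuous_on_eq_continuous_at)
    then have "isCont (\<lambda>t. \<phi> \<bar>t\<bar>) t" by (intro isCont_o2[where f = abs and g = \<phi>] continuous_intros)
    then show ?thesis unfolding m_fun_def[abs_def] by (intro continuous_intros)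
  next
    case 2
    have "isCont \<phi> \<bar>t\<bar>" using 2 phi_cont by (simp add: continuous_on_eq_continuous_at)
    then have "isCont (\<lambda>t. \<phi> \<bar>t\<bar>) t" by (intro isCont_o2[where f = abs and g = \<phi>] continuous_intros)
    then show ?thesis unfolding m_fun_def[abs_def] by (intro continuous_intros)
  qed
qed

lemma m_continuous: "continuous_on S m"
  by (simp add: continuous_at_imp_continuous_on isCont_m)

lemma m_integrable: "m integrable_on {a..b}"
  by (intro integrable_continuous_real m_continuous)

section \<open>Convexity of \<open>M\<close>\<close>

lemma M_diff:
  assumes "0 \<le> s" "s \<le> t"
  shows "M t - M s = integral {s..t} m"
  using Henstock_Kurzweil_Integration.integral_combine[OF assms m_integrable] assms by (simp add: M_fun_def)

text \<open>Monotonicity of \<open>m\<close> compares its integral between s and t with the constant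
  \<open>m s\<close>, whichever of the two is larger. Rearranged, this is Young's inequality m(s) t
  \<le> M(t) + (s m(s) - M(s)), with no supremum to evaluate.\<close>

lemma M_tangent:
  assumes "0 \<le> s" "0 \<le> t"
  shows "m s * (t - s) \<le> M t - M s"
proof (cases "s \<le> t")
  case True
  have "m s * (t - s) = integral {s..t} (\<lambda>x. m s)" using True by simp
  also have "\<dots> \<le> integral {s..t} m"
    using m_mono by (intro integral_le m_integrable) (auto simp: strict_mono_less_eq)
  finally show ?thesis using M_diff assms True by simp
next
  case False
  have "integral {t..s} m \<le> integral {t..s} (\<lambda>x. m s)"
    using m_mono by (intro integral_le m_integrable) (auto simp: strict_mono_less_eq)
  also have "\<dots> = - (m s * (t - s))" using False by (simp add: algebra_simps)
  finally show ?thesis using M_diff[of t s] assms False by simp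
qed

lemma M_nonneg: "M t \<ge> 0"
  unfolding M_fun_def by (intro integral_nonneg m_integrable) (auto intro: m_nonneg)

lemma M_zero [simp]: "M 0 = 0"
  by (simp add: M_fun_def)

lemma M_le: "t \<ge> 0 \<Longrightarrow> M t \<le> t * m t"
  using M_tangent[of t 0] by (simp add: mult.commute)

lemma M_continuous: "continuous_on UNIV M"
proof -
  have "continuous_on {0..b} (\<lambda>x. integral {0..x} m)" for b
    by (rule indefinite_integral_continuous_1[OF m_integrable])
  then have "continuous_on {0..} (\<lambda>x. integral {0..x} m)"
    unfolding continuous_on_eq_continuous_within
  proof (intro ballI)
    fix x :: real assume x: "x \<in> {0..}"
    assume a: "\<And>b. \<forall>x\<in>{0..b}. continuous (at x within {0..b}) (\<lambda>x. integral {0..x} m)"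
    have "at x within {0..} = at x within {0..x+1}"
      using x by (intro at_within_nhd[where S = "{..<x+1}"]) auto
    then show "continuous (at x within {0..}) (\<lambda>x. integral {0..x} m)" using a[of "x+1"] x by auto
  qed
  then have "continuous_on UNIV (\<lambda>x::real. integral {0..\<bar>x\<bar>} m)"
    by (rule continuous_on_compose2) (auto intro: continuous_intros)
  then show ?thesis by (simp add: M_fun_def[abs_def])
qed

section \<open>The vector field \<open>flux\<close> and its monotonicity\<close>

lemma norm_flux: "norm (flux \<xi>) = m (norm \<xi>)"
proof (cases "\<xi> = 0")
  case False
  then have "\<phi> (norm \<xi>) > 0" using phi_pos by simp
  then show ?thesis by (simp add: flux_def m_fun_def)
qed (simp add: flux_def)

lemma flux_inner_self: "flux \<xi> \<bullet> \<xi> = norm \<xi> * m (norm \<xi>)"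
  by (simp add: flux_def m_fun_def power2_norm_eq_inner[symmetric] power2_eq_square)

text \<open>At the origin \<phi> may blow up, so continuity there is read off from the norm, which
  is m(|\<xi>|) and tends to 0. Elsewhere \<phi> itself is continuous.\<close>

lemma flux_continuous: "continuous_on UNIV (flux :: real^'n \<Rightarrow> real^'n)"
proof -
  have "isCont flux \<xi>" for \<xi> :: "real^'n"
  proof (cases "\<xi> = 0")
    case True
    have "((\<lambda>x::real^'n. m (norm x)) \<longlongrightarrow> m (norm \<xi>)) (at \<xi>)"
      by (rule isCont_tendsto_compose[OF isCont_m]) (intro tendsto_intros)
    then have "((\<lambda>x. norm (flux x :: real^'n)) \<longlongrightarrow> 0) (at \<xi>)" by (simp add: norm_flux True)
    then show ?thesis by (simp add: isCont_def True tendsto_norm_zero_iff flux_def[of 0])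
  next
    case False
    then have "isCont \<phi> (norm \<xi>)" using phi_cont by (simp add: continuous_on_eq_continuous_at)
    then have "isCont (\<lambda>x. \<phi> (norm x)) \<xi>" by (intro isCont_o2[where f = norm and g = \<phi>] continuous_intros)
    then show ?thesis unfolding flux_def[abs_def] by (intro continuous_intros)
  qed
  then show ?thesis by (simp add: continuous_at_imp_continuous_on)
qed

text \<open>Young's inequality with the conjugate function evaluated at \<open>m \<bar>a\<bar>\<close>.\<close>

lemma flux_young: "- (M (norm b) + (norm a * m (norm a) - M (norm a))) \<le> flux a \<bullet> b"
proof -
  have "- (flux a \<bullet> b) \<le> m (norm a) * norm b"
    using Cauchy_Schwarz_ineq2[of "flux a" b] norm_flux[of a] by simp
  also have "\<dots> \<le> M (norm b) + (norm a * m (norm a) - M (norm a))"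
    using M_tangent[of "norm a" "norm b"] by (simp add: algebra_simps)
  finally show ?thesis by simp
qed

text \<open>Cauchy--Schwarz on the two mixed terms reduces the vector inequality to a scalar one for
  \<open>m\<close>.\<close>

lemma flux_monotone_aux: "(m (norm a) - m (norm b)) * (norm a - norm b) \<le> (flux a - flux b) \<bullet> (a - b)"
proof -
  have "flux a \<bullet> b \<le> m (norm a) * norm b" "flux b \<bullet> a \<le> m (norm b) * norm a"
    using norm_cauchy_schwarz[of "flux a" b] norm_cauchy_schwarz[of "flux b" a] by (simp_all add: norm_flux)
  then show ?thesis
    using flux_inner_self[of a] flux_inner_self[of b] by (simp add: inner_diff_left inner_diff_right algebra_simps)
qed

lemma m_monotone_strict: "0 \<le> (m s - m t) * (s - t)" "(m s - m t) * (s - t) = 0 \<Longrightarrow> s = t"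
  using strict_monoD[OF m_mono, of s t] strict_monoD[OF m_mono, of t s]
  by (cases s t rule: linorder_cases; simp add: mult_neg_neg less_imp_le)+

lemma flux_monotone: "0 \<le> (flux a - flux b) \<bullet> (a - b)"
  using flux_monotone_aux m_monotone_strict(1) by (rule order_trans[rotated])

text \<open>Equality forces the norms to agree, by strict monotonicity of \<open>m\<close>. Then
  \<phi> of the common norm factors out and leaves |a - b|^2.\<close>

lemma flux_strict_monotone:
  assumes "(flux a - flux b) \<bullet> (a - b) = 0"
  shows "a = b"
proof -
  have "(m (norm a) - m (norm b)) * (norm a - norm b) = 0"
    using flux_monotone_aux[of a b] m_monotone_strict(1)[of "norm a" "norm b"] assms by linarith
  then have n: "norm a = norm b" by (rule m_monotone_strict(2))
  then have "\<phi> (norm a) * ((a - b) \<bullet> (a - b)) = 0"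
    using assms by (simp add: flux_def scaleR_diff_right[symmetric])
  then show ?thesis using phi_pos[of "norm b"] n by (cases "b = 0") auto
qed

end

section \<open>Passing to the limit\<close>

text \<open>In q_n u_n = q_n (u_n - u') + q_n u' the first term is controlled by the bound on q_n
  and the L1 convergence, the second by dominated convergence.\<close>

lemma tendsto_integral_mult_bounded:
  fixes q :: "nat \<Rightarrow> 'a \<Rightarrow> real"
  assumes "\<And>n. q n \<in> borel_measurable L" "\<And>n x. \<bar>q n x\<bar> \<le> B" "\<And>x. (\<lambda>n. q n x) \<longlonglongrightarrow> q' x"
    "\<And>n. integrable L (u n)" "integrable L u'" "(\<lambda>n. \<integral>x. \<bar>u n x - u' x\<bar> \<partial>L) \<longlonglongrightarrow> 0"
  shows "(\<lambda>n. \<integral>x. q n x * u n x \<partial>L) \<longlonglongrightarrow> (\<integral>x. q' x * u' x \<partial>L)"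
proof -
  have B: "B \<ge> 0" using assms(2) by (rule order_trans[OF abs_ge_zero])
  have i: "integrable L (\<lambda>x. q n x * u n x)" "integrable L (\<lambda>x. q n x * u' x)"
      "integrable L (\<lambda>x. q n x * (u n x - u' x))" for n
    using assms by (auto intro!: integrable_mult_bounded[where B = B])
  have "(\<lambda>n. \<integral>x. q n x * (u n x - u' x) \<partial>L) \<longlonglongrightarrow> 0"
  proof (rule Lim_null_comparison)
    show "eventually (\<lambda>n. norm (\<integral>x. q n x * (u n x - u' x) \<partial>L) \<le> B * (\<integral>x. \<bar>u n x - u' x\<bar> \<partial>L)) sequentially"
    proof (rule always_eventually, rule allI)
      fix n
      have "norm (\<integral>x. q n x * (u n x - u' x) \<partial>L) \<le> (\<integral>x. \<bar>q n x * (u n x - u' x)\<bar> \<partial>L)"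
        unfolding real_norm_def by (rule integral_abs_bound)
      also have "\<dots> \<le> (\<integral>x. B * \<bar>u n x - u' x\<bar> \<partial>L)"
      proof (rule integral_mono)
        show "\<bar>q n x * (u n x - u' x)\<bar> \<le> B * \<bar>u n x - u' x\<bar>" for x
          using assms(2)[of n x] by (simp add: abs_mult mult_right_mono)
      qed (use i assms(4,5) in auto)
      finally show "norm (\<integral>x. q n x * (u n x - u' x) \<partial>L) \<le> B * (\<integral>x. \<bar>u n x - u' x\<bar> \<partial>L)" by simp
    qed
    show "(\<lambda>n. B * (\<integral>x. \<bar>u n x - u' x\<bar> \<partial>L)) \<longlonglongrightarrow> 0" using tendsto_mult[OF tendsto_const assms(6), of B] by simp
  qed
  moreover have "(\<lambda>n. \<integral>x. q n x * u' x \<partial>L) \<longlonglongrightarrow> (\<integral>x. q' x * u' x \<partial>L)"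
  proof (rule integral_dominated_convergence[where w = "\<lambda>x. B * \<bar>u' x\<bar>"])
    show "AE x in L. norm (q n x * u' x) \<le> B * \<bar>u' x\<bar>" for n
      using assms(2)[of n] by (intro AE_I2) (simp add: abs_mult mult_right_mono)
    show "AE x in L. (\<lambda>n. q n x * u' x) \<longlonglongrightarrow> q' x * u' x"
      using assms(3) by (intro AE_I2 tendsto_intros)
    have "q' \<in> borel_measurable L" using assms(1,3) by (rule borel_measurable_LIMSEQ_real[rotated])
    then show "(\<lambda>x. q' x * u' x) \<in> borel_measurable L" using assms(5) by simp
  qed (use assms i in auto)
  ultimately have "(\<lambda>n. (\<integral>x. q n x * (u n x - u' x) \<partial>L) + (\<integral>x. q n x * u' x \<partial>L)) \<longlonglongrightarrow> 0 + (\<integral>x. q' x * u' x \<partial>L)"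
    by (rule tendsto_add)
  moreover have "(\<integral>x. q n x * (u n x - u' x) \<partial>L) + (\<integral>x. q n x * u' x \<partial>L) = (\<integral>x. q n x * u n x \<partial>L)" for n
    using i[of n] by (subst Bochner_Integration.integral_add[symmetric]) (auto simp: algebra_simps)
  ultimately show ?thesis by simp
qed

text \<open>A real-valued form of Fatou's lemma in which only upper bounds of the integrals are
  assumed to converge.\<close>

lemma Fatou_le:
  fixes f :: "nat \<Rightarrow> 'a \<Rightarrow> real"
  assumes "\<And>n. integrable L (f n)" "integrable L f'" "\<And>n x. 0 \<le> f n x"
    "AE x in L. (\<lambda>n. f n x) \<longlonglongrightarrow> f' x" "\<And>n. (\<integral>x. f n x \<partial>L) \<le> d n" "d \<longlonglongrightarrow> d'"
  shows "(\<integral>x. f' x \<partial>L) \<le> d'"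
proof -
  have pos: "AE x in L. 0 \<le> f' x"
    using assms(4) by eventually_elim (use assms(3) in \<open>auto intro: LIMSEQ_le_const\<close>)
  have "ennreal (\<integral>x. f' x \<partial>L) = (\<integral>\<^sup>+x. ennreal (f' x) \<partial>L)"
    using assms(2) pos by (simp add: nn_integral_eq_integral)
  also have "\<dots> = (\<integral>\<^sup>+x. liminf (\<lambda>n. ennreal (f n x)) \<partial>L)"
  proof (rule nn_integral_cong_AE)
    show "AE x in L. ennreal (f' x) = liminf (\<lambda>n. ennreal (f n x))"
      using assms(4)
    proof eventually_elim
      case (elim x)
      then show ?case by (intro lim_imp_Liminf[symmetric] tendsto_ennrealI) auto
    qed
  qed
  also have "\<dots> \<le> liminf (\<lambda>n. \<integral>\<^sup>+x. ennreal (f n x) \<partial>L)"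
    using assms(1) by (intro nn_integral_liminf) auto
  also have "\<dots> \<le> liminf (\<lambda>n. ennreal (d n))"
    using assms(1,3,5) by (intro Liminf_mono always_eventually) (auto simp: nn_integral_eq_integral intro: ennreal_leI)
  also have "\<dots> = ennreal d'" using assms(6) by (simp add: lim_imp_Liminf tendsto_ennrealI)
  finally have "ennreal (\<integral>x. f' x \<partial>L) \<le> ennreal d'" .
  moreover have "d n \<ge> 0" for n using assms(3,5) by (meson Bochner_Integration.integral_nonneg order_trans)
  then have "d' \<ge> 0" using assms(6) by (meson LIMSEQ_le_const)
  ultimately show ?thesis by simp
qed

lemma integrable_inner_bounded:
  fixes F b :: "'a \<Rightarrow> real^'n"
  assumes "\<And>i. integrable L (\<lambda>x. F x $ i)" "\<And>i. (\<lambda>x. b x $ i) \<in> borel_measurable L" "\<And>i x. \<bar>b x $ i\<bar> \<le> B"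
  shows "integrable L (\<lambda>x. F x \<bullet> b x)"
proof -
  have "integrable L (\<lambda>x. b x $ i * F x $ i)" for i
    using assms by (intro integrable_mult_bounded[where B = B]) auto
  then show ?thesis by (simp add: inner_vec_def mult.commute)
qed

lemma integral_mult_inner:
  fixes a W :: "'a \<Rightarrow> real^'n"
  assumes "\<And>i. integrable L (\<lambda>x. (q x * a x $ i) * W x $ i)"
  shows "(\<integral>x. q x * (a x \<bullet> W x) \<partial>L) = (\<Sum>i\<in>UNIV. \<integral>x. (q x * a x $ i) * W x $ i \<partial>L)"
proof -
  have "q x * (a x \<bullet> W x) = (\<Sum>i\<in>UNIV. (q x * a x $ i) * W x $ i)" for x
    by (simp only: inner_vec_def inner_real_def sum_distrib_left mult.assoc)
  then show ?thesis using assms by (simp only: Bochner_Integration.integral_sum)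
qed

text \<open>The products \<open>F \<bullet> W n\<close> need not be equi-integrable from above, but they are bounded below by
  an \<open>L\<^sup>1\<close>-convergent sequence, which is all that Fatou's lemma needs.\<close>

lemma limit_of_tested_inequalities:
  fixes F a b W' :: "'a \<Rightarrow> real^'n" and W :: "nat \<Rightarrow> 'a \<Rightarrow> real^'n" and q :: "nat \<Rightarrow> 'a \<Rightarrow> real"
  assumes q: "\<And>n. q n \<in> borel_measurable L" "\<And>n x. 0 \<le> q n x" "\<And>n x. q n x \<le> B" "\<And>x. (\<lambda>n. q n x) \<longlonglongrightarrow> q' x"
    and F: "\<And>i. integrable L (\<lambda>x. F x $ i)"
    and a: "\<And>i. integrable L (\<lambda>x. a x $ i)" "\<And>i x. \<bar>a x $ i\<bar> \<le> A"
    and b: "\<And>i. (\<lambda>x. b x $ i) \<in> borel_measurable L" "\<And>i x. \<bar>b x $ i\<bar> \<le> A"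
    and W: "\<And>n i. integrable L (\<lambda>x. W n x $ i)" "\<And>i. integrable L (\<lambda>x. W' x $ i)"
      "\<And>i. (\<lambda>n. \<integral>x. \<bar>W n x $ i - W' x $ i\<bar> \<partial>L) \<longlonglongrightarrow> 0"
    and G: "\<And>n. integrable L (G n)" "integrable L G'" "(\<lambda>n. \<integral>x. \<bar>G n x - G' x\<bar> \<partial>L) \<longlonglongrightarrow> 0"
    and P: "integrable L P"
    and FW: "\<And>n. integrable L (\<lambda>x. q n x * (F x \<bullet> W n x))" "integrable L (\<lambda>x. F x \<bullet> W' x)"
    and low: "\<And>n x. - (G n x + P x) \<le> F x \<bullet> W n x"
    and ineq: "\<And>n. 0 \<le> (\<integral>x. q n x * ((F x - a x) \<bullet> (b x - W n x)) \<partial>L)"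
  shows "0 \<le> (\<integral>x. q' x * ((F x - a x) \<bullet> (b x - W' x)) \<partial>L)"
    "integrable L (\<lambda>x. q' x * ((F x - a x) \<bullet> (b x - W' x)))"
proof -
  have qB: "\<bar>q n x\<bar> \<le> B" for n x using q(2,3)[of n x] by simp
  have q'm: "q' \<in> borel_measurable L" using q(1,4) by (rule borel_measurable_LIMSEQ_real[rotated])
  have q'B: "\<bar>q' x\<bar> \<le> B" for x using qB by (intro LIMSEQ_le_const2[OF tendsto_rabs[OF q(4)]]) auto
  have B: "B \<ge> 0" using qB by (rule order_trans[OF abs_ge_zero])
  have A: "A \<ge> 0" using a(2) by (rule order_trans[OF abs_ge_zero])
  have iFb: "integrable L (\<lambda>x. F x \<bullet> b x - a x \<bullet> b x)"
    using integrable_inner_bounded[OF F b] integrable_inner_bounded[OF a(1) b] by simp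
  have aW: "integrable L (\<lambda>x. a x \<bullet> W n x)" "integrable L (\<lambda>x. a x \<bullet> W' x)" for n
    using integrable_inner_bounded[of L "W n" a A] integrable_inner_bounded[of L W' a A] W a by (auto simp: inner_commute)
  have qi: "integrable L (\<lambda>x. q n x * u x)" "integrable L (\<lambda>x. q' x * u x)" if "integrable L u" for n u
    using that q(1) q'm qB q'B by (auto intro!: integrable_mult_bounded[where B = B])
  \<comment> \<open>These are the terms of the tested expression other than
    \<open>F \<bullet> W n\<close>, each a product of a bounded and an L1-convergent factor. The
    hypothesis \<open>ineq\<close> then says that the integral of q_n (F \<bullet> W_n) is at most
    c_n.\<close>
  define c where "c n = (\<integral>x. q n x * (F x \<bullet> b x - a x \<bullet> b x) \<partial>L) + (\<integral>x. q n x * (a x \<bullet> W n x) \<partial>L)" for n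
  define c' where "c' = (\<integral>x. q' x * (F x \<bullet> b x - a x \<bullet> b x) \<partial>L) + (\<integral>x. q' x * (a x \<bullet> W' x) \<partial>L)"
  have aWlim: "(\<lambda>n. \<integral>x. q n x * (a x \<bullet> W n x) \<partial>L) \<longlonglongrightarrow> (\<integral>x. q' x * (a x \<bullet> W' x) \<partial>L)"
  proof -
    have bd: "\<bar>q n x * a x $ i\<bar> \<le> B * A" for n i x
      unfolding abs_mult using qB a(2) B by (intro mult_mono) auto
    have lim: "(\<lambda>n. \<integral>x. (q n x * a x $ i) * W n x $ i \<partial>L) \<longlonglongrightarrow> (\<integral>x. (q' x * a x $ i) * W' x $ i \<partial>L)" for i
      using bd q(1) a(1) by (intro tendsto_integral_mult_bounded[where B = "B * A"] W tendsto_mult q(4) tendsto_const) auto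
    have bd': "\<bar>q' x * a x $ i\<bar> \<le> B * A" for i x
      unfolding abs_mult using q'B a(2) B by (intro mult_mono) auto
    have i1: "integrable L (\<lambda>x. (q n x * a x $ i) * W n x $ i)" for n i
      using bd q(1) a(1) W by (intro integrable_mult_bounded[where B = "B * A"]) auto
    have i2: "integrable L (\<lambda>x. (q' x * a x $ i) * W' x $ i)" for i
      using bd' q'm a(1) W by (intro integrable_mult_bounded[where B = "B * A"]) auto
    have "(\<lambda>n. \<Sum>i\<in>UNIV. \<integral>x. (q n x * a x $ i) * W n x $ i \<partial>L) \<longlonglongrightarrow> (\<Sum>i\<in>UNIV. \<integral>x. (q' x * a x $ i) * W' x $ i \<partial>L)"
      by (intro tendsto_sum lim)
    moreover have "(\<Sum>i\<in>UNIV. \<integral>x. (q n x * a x $ i) * W n x $ i \<partial>L) = (\<integral>x. q n x * (a x \<bullet> W n x) \<partial>L)" for n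
      using i1 by (rule integral_mult_inner[symmetric])
    moreover have "(\<Sum>i\<in>UNIV. \<integral>x. (q' x * a x $ i) * W' x $ i \<partial>L) = (\<integral>x. q' x * (a x \<bullet> W' x) \<partial>L)"
      using i2 by (rule integral_mult_inner[symmetric])
    ultimately show ?thesis by simp
  qed
  have clim: "c \<longlonglongrightarrow> c'" unfolding c_def[abs_def] c'_def
    by (intro tendsto_add aWlim tendsto_integral_mult_bounded[where B = B and u = "\<lambda>_ x. F x \<bullet> b x - a x \<bullet> b x"] q(1,4) qB iFb) simp
  have le: "(\<integral>x. q n x * (F x \<bullet> W n x) \<partial>L) \<le> c n" for n
  proof -
    have "(\<integral>x. q n x * ((F x - a x) \<bullet> (b x - W n x)) \<partial>L) =
        (\<integral>x. q n x * (F x \<bullet> b x - a x \<bullet> b x) + q n x * (a x \<bullet> W n x) - q n x * (F x \<bullet> W n x) \<partial>L)"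
      by (intro Bochner_Integration.integral_cong refl) (simp add: inner_diff_left inner_diff_right algebra_simps)
    also have "\<dots> = c n - (\<integral>x. q n x * (F x \<bullet> W n x) \<partial>L)"
      unfolding c_def
      by (subst Bochner_Integration.integral_diff[OF Bochner_Integration.integrable_add[OF qi(1)[OF iFb] qi(1)[OF aW(1)]] FW(1)])
         (simp only: Bochner_Integration.integral_add[OF qi(1)[OF iFb] qi(1)[OF aW(1)]])
    finally show ?thesis using ineq[of n] by simp
  qed
  \<comment> \<open>One sequence dominating all components of \<open>W n - W'\<close> and also
    \<open>G n - G'\<close>: a single subsequence then gives almost everywhere convergence of all of
    them at once.\<close>
  define u where "u n x = (\<Sum>i\<in>UNIV. \<bar>W n x $ i - W' x $ i\<bar>) + \<bar>G n x - G' x\<bar>" for n x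
  have iu: "integrable L (u n)" for n unfolding u_def[abs_def] using W G by auto
  have "(\<lambda>n. \<integral>x. norm (u n x) \<partial>L) \<longlonglongrightarrow> 0"
  proof -
    have "(\<integral>x. norm (u n x) \<partial>L) = (\<Sum>i\<in>UNIV. \<integral>x. \<bar>W n x $ i - W' x $ i\<bar> \<partial>L) + (\<integral>x. \<bar>G n x - G' x\<bar> \<partial>L)" for n
    proof -
      have "norm (u n x) = (\<Sum>i\<in>UNIV. \<bar>W n x $ i - W' x $ i\<bar>) + \<bar>G n x - G' x\<bar>" for x
        unfolding u_def by (simp add: sum_nonneg)
      then show ?thesis using W G by (simp add: Bochner_Integration.integral_sum)
    qed
    moreover have "(\<lambda>n. (\<Sum>i\<in>UNIV. \<integral>x. \<bar>W n x $ i - W' x $ i\<bar> \<partial>L) + (\<integral>x. \<bar>G n x - G' x\<bar> \<partial>L)) \<longlonglongrightarrow> (\<Sum>i\<in>(UNIV::'n set). 0) + 0"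
      by (intro tendsto_intros W G)
    ultimately show ?thesis by simp
  qed
  then obtain r where r: "strict_mono r" "AE x in L. (\<lambda>n. u (r n) x) \<longlonglongrightarrow> 0"
    using tendsto_L1_AE_subseq[of L u] iu by blast
  have ae: "AE x in L. (\<lambda>n. q (r n) x * (F x \<bullet> W (r n) x + G (r n) x + P x)) \<longlonglongrightarrow> q' x * (F x \<bullet> W' x + G' x + P x)"
    using r(2)
  proof eventually_elim
    case (elim x)
    have "(\<lambda>n. W (r n) x $ i) \<longlonglongrightarrow> W' x $ i" for i
    proof (rule Lim_transform2[OF tendsto_const])
      show "(\<lambda>n. W' x $ i - W (r n) x $ i) \<longlonglongrightarrow> 0"
      proof (rule Lim_null_comparison[OF always_eventually elim], rule allI)
        fix n
        have "\<bar>W (r n) x $ i - W' x $ i\<bar> \<le> (\<Sum>i\<in>UNIV. \<bar>W (r n) x $ i - W' x $ i\<bar>)"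
          by (rule member_le_sum) auto
        then show "norm (W' x $ i - W (r n) x $ i) \<le> u (r n) x" unfolding u_def by (simp add: abs_minus_commute)
      qed
    qed
    then have w: "(\<lambda>n. W (r n) x) \<longlonglongrightarrow> W' x" by (rule vec_tendstoI)
    have g: "(\<lambda>n. G (r n) x) \<longlonglongrightarrow> G' x"
    proof (rule Lim_transform2[OF tendsto_const])
      show "(\<lambda>n. G' x - G (r n) x) \<longlonglongrightarrow> 0"
        by (rule Lim_null_comparison[OF always_eventually elim]) (simp add: u_def sum_nonneg abs_minus_commute)
    qed
    have "(\<lambda>n. q (r n) x) \<longlonglongrightarrow> q' x" using LIMSEQ_subseq_LIMSEQ[OF q(4) r(1)] by (simp add: o_def)
    then show ?case by (intro tendsto_intros w g)
  qed
  have split: "(\<integral>x. p x * (f x + g x + P x) \<partial>L) = (\<integral>x. p x * f x \<partial>L) + (\<integral>x. p x * g x \<partial>L) + (\<integral>x. p x * P x \<partial>L)"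
    "integrable L (\<lambda>x. p x * (f x + g x + P x))"
    if "integrable L (\<lambda>x. p x * f x)" "integrable L (\<lambda>x. p x * g x)" "integrable L (\<lambda>x. p x * P x)" for p f g :: "'a \<Rightarrow> real"
    using that by (auto simp: distrib_left)
  define d where "d n = c n + (\<integral>x. q n x * G n x \<partial>L) + (\<integral>x. q n x * P x \<partial>L)" for n
  define d' where "d' = c' + (\<integral>x. q' x * G' x \<partial>L) + (\<integral>x. q' x * P x \<partial>L)"
  have "d \<longlonglongrightarrow> d'" unfolding d_def[abs_def] d'_def
    by (intro tendsto_add clim tendsto_integral_mult_bounded[where B = B] q(1,4) qB G P) simp
  then have "(\<lambda>n. d (r n)) \<longlonglongrightarrow> d'" using LIMSEQ_subseq_LIMSEQ[OF _ r(1)] by (simp add: o_def)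
  \<comment> \<open>Adding the lower bound from \<open>low\<close> makes the integrands nonnegative.
    The added terms converge, so they can be subtracted again after Fatou.\<close>
  have "(\<integral>x. q' x * (F x \<bullet> W' x + G' x + P x) \<partial>L) \<le> d'"
  proof (rule Fatou_le[OF _ _ _ ae _ \<open>(\<lambda>n. d (r n)) \<longlonglongrightarrow> d'\<close>])
    show "integrable L (\<lambda>x. q (r n) x * (F x \<bullet> W (r n) x + G (r n) x + P x))" for n
      by (intro split(2) FW qi G P)
    show "integrable L (\<lambda>x. q' x * (F x \<bullet> W' x + G' x + P x))"
      by (intro split(2) qi FW G P)
    show "0 \<le> q (r n) x * (F x \<bullet> W (r n) x + G (r n) x + P x)" for n x
      using q(2)[of "r n" x] low[of "r n" x] by (intro mult_nonneg_nonneg) auto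
    show "(\<integral>x. q (r n) x * (F x \<bullet> W (r n) x + G (r n) x + P x) \<partial>L) \<le> d (r n)" for n
      using le[of "r n"] split(1)[OF FW(1)[of "r n"] qi(1)[OF G(1)] qi(1)[OF P]] by (simp add: d_def)
  qed
  then have fin: "(\<integral>x. q' x * (F x \<bullet> W' x) \<partial>L) \<le> c'"
    using split(1)[OF qi(2)[OF FW(2)] qi(2)[OF G(2)] qi(2)[OF P]] by (simp add: d'_def)
  have eq: "q' x * ((F x - a x) \<bullet> (b x - W' x)) = q' x * (F x \<bullet> b x - a x \<bullet> b x) + q' x * (a x \<bullet> W' x) - q' x * (F x \<bullet> W' x)" for x
    by (simp add: inner_diff_left inner_diff_right algebra_simps)
  note ii = qi(2)[OF iFb] qi(2)[OF aW(2)] qi(2)[OF FW(2)]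
  show "integrable L (\<lambda>x. q' x * ((F x - a x) \<bullet> (b x - W' x)))"
    unfolding eq by (intro Bochner_Integration.integrable_add Bochner_Integration.integrable_diff ii)
  have "(\<integral>x. q' x * ((F x - a x) \<bullet> (b x - W' x)) \<partial>L) = c' - (\<integral>x. q' x * (F x \<bullet> W' x) \<partial>L)"
    unfolding eq c'_def
    by (subst Bochner_Integration.integral_diff[OF Bochner_Integration.integrable_add[OF ii(1,2)] ii(3)])
       (simp only: Bochner_Integration.integral_add[OF ii(1,2)])
  then show "0 \<le> (\<integral>x. q' x * ((F x - a x) \<bullet> (b x - W' x)) \<partial>L)" using fin by simp
qed

section \<open>The comparison principle\<close>

lemma compact_neighbourhood:
  fixes K :: "'a::euclidean_space set"
  assumes "compact K" "open \<Omega>" "K \<subseteq> \<Omega>"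
  obtains e D where "e > 0" "compact D" "D \<subseteq> \<Omega>" "\<And>x. x \<in> K \<Longrightarrow> cball x e \<subseteq> D"
proof -
  obtain d where d: "d > 0" "(\<Union>x\<in>K. ball x d) \<subseteq> \<Omega>"
    using compact_subset_open_imp_ball_epsilon_subset[OF assms] by metis
  let ?D = "{x + y | x y. x \<in> K \<and> y \<in> cball 0 (d/2)}"
  have "compact ?D" using assms(1) by (intro compact_sums) auto
  moreover have "?D \<subseteq> \<Omega>"
  proof
    fix z assume "z \<in> ?D"
    then obtain x y where "z = x + y" "x \<in> K" "norm y \<le> d/2" by auto
    then have "z \<in> ball x d" using d(1) by (simp add: dist_norm)
    then show "z \<in> \<Omega>" using d(2) \<open>x \<in> K\<close> by blast
  qed
  moreover have "cball x (d/2) \<subseteq> ?D" if "x \<in> K" for x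
  proof
    fix z assume "z \<in> cball x (d/2)"
    then have "z = x + (z - x)" "z - x \<in> cball 0 (d/2)" by (auto simp: dist_norm norm_minus_commute)
    then show "z \<in> ?D" using that by blast
  qed
  ultimately show ?thesis using that[of "d/2"] d(1) by simp
qed

lemma DERIV_positive_part_square: "((\<lambda>t::real. (max 0 t)^2) has_real_derivative 2 * max 0 t) (at t)"
proof -
  consider "t > 0" | "t < 0" | "t = 0" by linarith
  then show ?thesis
  proof cases
    case 1
    have "((\<lambda>t::real. t^2) has_real_derivative 2 * t) (at t)" by (auto intro!: derivative_eq_intros)
    then have "((\<lambda>t::real. (max 0 t)^2) has_real_derivative 2 * t) (at t)"
      by (rule has_field_derivative_transform_within_open[where S = "{0<..}"]) (use 1 in auto)
    then show ?thesis using 1 by simp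
  next
    case 2
    have "((\<lambda>t::real. 0) has_real_derivative 0) (at t)" by simp
    then have "((\<lambda>t::real. (max 0 t)^2) has_real_derivative 0) (at t)"
      by (rule has_field_derivative_transform_within_open[where S = "{..<0}"]) (use 2 in auto)
    then show ?thesis using 2 by simp
  next
    case 3
    have "((\<lambda>h::real. (max 0 h)^2 / h) \<longlongrightarrow> 0) (at 0)"
    proof (rule Lim_null_comparison)
      show "eventually (\<lambda>h::real. norm ((max 0 h)^2 / h) \<le> \<bar>h\<bar>) (at 0)"
        by (intro always_eventually allI) (auto simp: max_def power2_eq_square)
    qed (intro tendsto_rabs_zero tendsto_ident_at)
    then show ?thesis using 3 by (simp add: DERIV_def)
  qed
qed

text \<open>The open sets \<open>U\<close> and \<open>- C\<close> cover the space. On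
  \<open>U\<close> the cut-off at \<open>C\<close> changes nothing, because g \<le> 0 off
  \<open>C\<close> already makes the squared positive part and its gradient vanish; on
  \<open>- C\<close> everything is 0.\<close>

lemma C1_compact_positive_part_square:
  fixes g :: "real^'n \<Rightarrow> real"
  assumes "compact C" "open U" "C \<subseteq> U" "\<And>x. x \<in> U \<Longrightarrow> (g has_derivative (\<lambda>k. g' x \<bullet> k)) (at x)"
    "continuous_on U g'" "\<And>x. x \<in> U \<Longrightarrow> x \<notin> C \<Longrightarrow> g x \<le> 0"
  shows "C1_compact (\<lambda>x. if x \<in> C then (max 0 (g x))^2 else 0) (\<lambda>x. if x \<in> C then (2 * max 0 (g x)) *\<^sub>R g' x else 0)"
    (is "C1_compact ?Z ?Z'")
  unfolding C1_compact_def
proof (intro conjI allI)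
  have oC: "open (- C)" using assms(1) compact_imp_closed by blast
  fix x :: "real^'n"
  show "(?Z has_derivative (\<lambda>k. ?Z' x \<bullet> k)) (at x)"
  proof (cases "x \<in> U")
    case True
    have "((\<lambda>x. (max 0 (g x))^2) has_derivative (\<lambda>k. (g' x \<bullet> k) * (2 * max 0 (g x)))) (at x)"
      using has_derivative_compose[OF assms(4)[OF True] DERIV_positive_part_square[of "g x", unfolded has_field_derivative_def]]
      by (simp add: mult.commute)
    then have "(?Z has_derivative (\<lambda>k. (g' x \<bullet> k) * (2 * max 0 (g x)))) (at x)"
      by (rule has_derivative_transform_within_open[OF _ assms(2) True]) (use assms(6) in auto)
    moreover have "(\<lambda>k. (g' x \<bullet> k) * (2 * max 0 (g x))) = (\<lambda>k. ?Z' x \<bullet> k)" using assms(6)[OF True] by auto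
    ultimately show ?thesis by simp
  next
    case False
    have "((\<lambda>x. 0) has_derivative (\<lambda>k. 0)) (at x)" by simp
    then have "(?Z has_derivative (\<lambda>k. 0)) (at x)"
      by (rule has_derivative_transform_within_open[OF _ oC]) (use False assms(3) in auto)
    then show ?thesis using False assms(3) by auto
  qed
next
  have oC: "open (- C)" using assms(1) compact_imp_closed by blast
  have cg: "continuous_on U g"
    using assms(4) by (meson continuous_at_imp_continuous_on has_derivative_continuous)
  have "continuous_on U (\<lambda>x. (2 * max 0 (g x)) *\<^sub>R g' x)" by (intro continuous_intros cg assms(5))
  then have "continuous_on U ?Z'" by (rule continuous_on_eq) (use assms(6) in auto)
  moreover have "continuous_on (- C) ?Z'" by (rule continuous_on_eq[OF continuous_on_const[of _ 0]]) auto
  ultimately have "continuous_on (U \<union> - C) ?Z'" using assms(2) oC by (simp add: continuous_on_open_Un)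
  moreover have "U \<union> - C = UNIV" using assms(3) by auto
  ultimately show "continuous_on UNIV ?Z'" by simp
  obtain R where "\<And>x. x \<in> C \<Longrightarrow> norm x \<le> R" using assms(1) compact_imp_bounded bounded_iff by metis
  then show "\<exists>R. \<forall>x. R < norm x \<longrightarrow> ?Z x = 0" by (intro exI[of _ R]) force
qed

lemma mollified_has_derivative:
  fixes w :: "real^'n \<Rightarrow> real"
  assumes "open \<Omega>" "\<And>i. has_weak_partial \<Omega> i w (\<lambda>x. W x $ i)" "compact D" "D \<subseteq> \<Omega>" "r > 0" "cball x r \<subseteq> D"
  shows "(conv (mollifier r) (\<lambda>z. indicator D z * w z) has_derivative
      (\<lambda>k. (\<chi> i. conv (mollifier r) (\<lambda>z. indicator D z * W z $ i) x) \<bullet> k)) (at x)"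
proof -
  have i: "integrable lebesgue (\<lambda>z. indicator D z * w z)"
    \<comment> \<open>Any index will do: local integrability of \<open>w\<close> is part of each
      \<open>has_weak_partial\<close>.\<close>
    using assms(2)[of undefined] by (intro locally_integrable_indicator[OF _ assms(3,4)]) (simp add: has_weak_partial_def)
  note k = mollifier_smooth[OF assms(5)]
  have "conv (mollifier r) (\<lambda>z. indicator D z * w z) differentiable (at x)"
    by (rule partial_deriv_conv(1)[OF k i])
  then have "(conv (mollifier r) (\<lambda>z. indicator D z * w z) has_derivative
      (\<lambda>k. (\<chi> i. partial_deriv i (conv (mollifier r) (\<lambda>z. indicator D z * w z)) x) \<bullet> k)) (at x)"
    by (rule has_derivative_partials)
  moreover have "partial_deriv i (conv (mollifier r) (\<lambda>z. indicator D z * w z)) x =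
      conv (mollifier r) (\<lambda>z. indicator D z * W z $ i) x" for i
    unfolding partial_deriv_conv(2)[OF k i] by (rule weak_partial_conv[OF assms(1,2) k assms(6,4)])
  ultimately show ?thesis by simp
qed

lemma mollified_uniform:
  fixes w :: "real^'n \<Rightarrow> real"
  assumes "integrable lebesgue (\<lambda>z. indicator D z * w z)" "continuous_on D w" "compact D" "e > 0"
    "d > 0" "\<And>x. x \<in> K \<Longrightarrow> cball x d \<subseteq> D"
  obtains s where "s > 0" "s \<le> d" "\<And>r x. 0 < r \<Longrightarrow> r \<le> s \<Longrightarrow> x \<in> K \<Longrightarrow>
    \<bar>conv (mollifier r) (\<lambda>z. indicator D z * w z) x - w x\<bar> \<le> e"
proof -
  have "uniformly_continuous_on D w" using assms(2,3) by (rule compact_uniformly_continuous)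
  then obtain t where t: "t > 0" "\<And>x y. x \<in> D \<Longrightarrow> y \<in> D \<Longrightarrow> dist y x < t \<Longrightarrow> dist (w y) (w x) < e"
    using assms(4) unfolding uniformly_continuous_on_def by metis
  define s where "s = min d (t/2)"
  have "\<bar>conv (mollifier r) (\<lambda>z. indicator D z * w z) x - w x\<bar> \<le> e" if r: "0 < r" "r \<le> s" and x: "x \<in> K" for r x
  proof (rule conv_mollifier_approx[OF r(1) assms(1)])
    fix z assume z: "dist x z \<le> r"
    then have "z \<in> D" "x \<in> D" using assms(6)[OF x] r assms(5) by (auto simp: s_def)
    moreover have "dist z x < t" using z r t(1) by (auto simp: s_def dist_commute)
    ultimately show "\<bar>indicator D z * w z - w x\<bar> \<le> e" using t(2)[of x z] by (simp add: dist_real_def)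
  qed
  then show ?thesis using that[of s] assms(5) t(1) by (auto simp: s_def)
qed

lemma integrable_indicator_mult:
  fixes f :: "'a::euclidean_space \<Rightarrow> real"
  assumes "integrable (lebesgue_on S) f" "S \<in> sets lebesgue" "T \<in> sets lebesgue" "T \<subseteq> S"
  shows "integrable lebesgue (\<lambda>x. indicator T x * f x)"
proof -
  have "integrable lebesgue (\<lambda>x. indicator S x * f x)" using assms(1,2) by (simp add: integrable_restrict_space)
  then have "integrable lebesgue (\<lambda>x. indicator T x * (indicator S x * f x))"
  proof (rule integrable_mult_bounded[where B = 1])
    show "indicator T \<in> borel_measurable lebesgue" using assms(3) by (rule borel_measurable_indicator)
  qed (simp add: indicator_def)
  moreover have "indicator T x * (indicator S x * f x) = indicator T x * f x" for x using assms(4) by (auto simp: indicator_def)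
  ultimately show ?thesis by simp
qed

lemma continuous_indicator_integrable:
  fixes f :: "'a::euclidean_space \<Rightarrow> real"
  assumes "continuous_on C f" "compact C"
  shows "integrable lebesgue (\<lambda>x. indicator C x * f x)"
proof -
  have "integrable lborel (\<lambda>x. indicator C x *\<^sub>R f x)" using assms by (intro borel_integrable_compact)
  then have "integrable lebesgue (\<lambda>x. indicator C x *\<^sub>R f x)"
    by (subst integrable_completion) (auto dest: borel_measurable_integrable)
  then show ?thesis by simp
qed

context N_function
begin

text \<open>Everything is dominated by |W| m(|W|) = flux W \<bullet> W: one has M(t) \<le> t m(t),
  and m(t) is at most m(1) for t \<le> 1 and at most t m(t) for t > 1. The constant m(1) is
  integrable since \<Omega> is bounded.\<close>

lemma flux_integrable:
  fixes W :: "real^'n \<Rightarrow> real^'n"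
  assumes \<Omega>: "open \<Omega>" "bounded \<Omega>" and Wm: "\<And>i. (\<lambda>x. W x $ i) \<in> borel_measurable (lebesgue_on \<Omega>)"
    and fluxW: "integrable (lebesgue_on \<Omega>) (\<lambda>x. flux (W x) \<bullet> W x)"
  shows "integrable (lebesgue_on \<Omega>) (\<lambda>x. norm (W x) * m (norm (W x)))"
    "integrable (lebesgue_on \<Omega>) (\<lambda>x. M (norm (W x)))"
    "integrable (lebesgue_on \<Omega>) (\<lambda>x. flux (W x) $ i)"
proof -
  have \<Omega>s: "\<Omega> \<in> sets lebesgue" using \<Omega>(1) by simp
  have Wm': "W \<in> borel_measurable (lebesgue_on \<Omega>)"
  proof -
    have "(\<lambda>x. \<Sum>i\<in>UNIV. (W x $ i) *\<^sub>R axis i (1::real)) \<in> borel_measurable (lebesgue_on \<Omega>)"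
      by (intro borel_measurable_sum borel_measurable_scaleR Wm borel_measurable_const)
    moreover have "(\<Sum>i\<in>UNIV. (W x $ i) *\<^sub>R axis i 1) = W x" for x
      using basis_expansion[of "W x"] by (simp add: scalar_mult_eq_scaleR)
    ultimately show ?thesis by simp
  qed
  have fm: "(\<lambda>x. flux (W x)) \<in> borel_measurable (lebesgue_on \<Omega>)"
    using borel_measurable_continuous_onI[OF flux_continuous] Wm' by (rule measurable_compose[rotated])
  have nm: "(\<lambda>x. norm (W x)) \<in> borel_measurable (lebesgue_on \<Omega>)" using Wm' by simp
  have Mm: "(\<lambda>x. M (norm (W x))) \<in> borel_measurable (lebesgue_on \<Omega>)"
    using borel_measurable_continuous_onI[OF M_continuous] nm by (rule measurable_compose[rotated])
  show iN: "integrable (lebesgue_on \<Omega>) (\<lambda>x. norm (W x) * m (norm (W x)))" using fluxW by (simp add: flux_inner_self)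
  show iG: "integrable (lebesgue_on \<Omega>) (\<lambda>x. M (norm (W x)))"
    by (rule Bochner_Integration.integrable_bound[OF iN Mm]) (auto simp: M_nonneg m_nonneg M_le)
  have fin: "integrable (lebesgue_on \<Omega>) (\<lambda>x. c::real)" for c
  proof -
    have "\<Omega> \<in> lmeasurable" using \<Omega> by (simp add: bounded_set_imp_lmeasurable)
    then have "integrable lebesgue (indicator \<Omega> :: _ \<Rightarrow> real)" by (simp only: lmeasurable_iff_integrable)
    then have "integrable lebesgue (\<lambda>x. indicator \<Omega> x *\<^sub>R c)" by simp
    then show ?thesis using \<Omega>s by (simp add: integrable_restrict_space)
  qed
  show iF: "integrable (lebesgue_on \<Omega>) (\<lambda>x. flux (W x) $ i)"
  proof (rule Bochner_Integration.integrable_bound)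
    show "integrable (lebesgue_on \<Omega>) (\<lambda>x. m 1 + norm (W x) * m (norm (W x)))"
      by (intro Bochner_Integration.integrable_add fin iN)
    show "(\<lambda>x. flux (W x) $ i) \<in> borel_measurable (lebesgue_on \<Omega>)"
      using fm by (rule measurable_compose) (simp add: borel_measurable_continuous_onI continuous_on_component continuous_on_id)
    have "\<bar>flux (W x) $ i\<bar> \<le> m 1 + norm (W x) * m (norm (W x))" for x
    proof -
      have "\<bar>flux (W x) $ i\<bar> \<le> m (norm (W x))" using component_le_norm_cart[of "flux (W x)" i] by (simp add: norm_flux)
      also have "\<dots> \<le> m 1 + norm (W x) * m (norm (W x))"
      proof (cases "norm (W x) \<le> 1")
        case True
        then have "m (norm (W x)) \<le> m 1" using m_mono by (simp add: strict_mono_less_eq)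
        then show ?thesis using m_nonneg[of "norm (W x)"] by (simp add: add_increasing2)
      next
        case False
        then have "1 * m (norm (W x)) \<le> norm (W x) * m (norm (W x))" by (intro mult_right_mono m_nonneg) auto
        then show ?thesis using m_nonneg[of 1] by simp
      qed
      finally show ?thesis .
    qed
    then show "AE x in lebesgue_on \<Omega>. norm (flux (W x) $ i) \<le> norm (m 1 + norm (W x) * m (norm (W x)))"
      by (intro AE_I2) (smt (verit) real_norm_def)
  qed
qed

text \<open>\<open>super\<close> and \<open>sub\<close> are tested with the same function; in the
  limit their difference says that the integral of (v - \<kappa> - w)^+ (flux W - flux v') \<bullet>
  (v' - W) is nonnegative. Monotonicity of \<open>flux\<close> gives the integrand the opposite
  sign, so W = v' almost everywhere where v - \<kappa> > w, and that open set is then shown to be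
  negligible.\<close>

theorem comparison_principle:
  fixes w v :: "real^'n \<Rightarrow> real" and W v' :: "real^'n \<Rightarrow> real^'n"
  assumes \<Omega>: "open \<Omega>" "bounded \<Omega>" and w: "continuous_on \<Omega> w"
    and W: "\<And>i. has_weak_partial \<Omega> i w (\<lambda>x. W x $ i)"
    and fluxW: "integrable (lebesgue_on \<Omega>) (\<lambda>x. flux (W x) \<bullet> W x)"
    and super: "\<And>Z Z' K. C1_compact Z Z' \<Longrightarrow> compact K \<Longrightarrow> K \<subseteq> \<Omega> \<Longrightarrow> (\<And>x. x \<notin> K \<Longrightarrow> Z x = 0) \<Longrightarrow>
        (\<And>x. 0 \<le> Z x) \<Longrightarrow> 0 \<le> (\<integral>x. flux (W x) \<bullet> Z' x \<partial>lebesgue_on \<Omega>)"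
    and U: "open U" "closure U \<subseteq> \<Omega>"
    and v: "continuous_on (closure U) v" "\<And>x. x \<in> U \<Longrightarrow> (v has_derivative (\<lambda>k. v' x \<bullet> k)) (at x)" "continuous_on U v'"
    and sub: "\<And>Z Z' K. C1_compact Z Z' \<Longrightarrow> compact K \<Longrightarrow> K \<subseteq> U \<Longrightarrow> (\<And>x. x \<notin> K \<Longrightarrow> Z x = 0) \<Longrightarrow>
        (\<And>x. 0 \<le> Z x) \<Longrightarrow> (\<integral>x. flux (v' x) \<bullet> Z' x \<partial>lebesgue) \<le> 0"
    and bdry: "\<And>x. x \<in> frontier U \<Longrightarrow> v x \<le> w x"
    and x: "x \<in> U"
  shows "v x \<le> w x"
proof -
  let ?K = "closure U"
  have KK: "compact ?K" using \<Omega>(2) U(2) by (meson bounded_subset closed_closure compact_eq_bounded_closed)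
  obtain e0 D where D: "e0 > 0" "compact D" "D \<subseteq> \<Omega>" "\<And>x. x \<in> ?K \<Longrightarrow> cball x e0 \<subseteq> D"
    using compact_neighbourhood[OF KK \<Omega>(1) U(2)] by metis
  have \<Omega>s: "\<Omega> \<in> sets lebesgue" using \<Omega>(1) by simp
  have Ds: "D \<in> sets lebesgue" using D(2) by (simp add: lmeasurable_compact fmeasurableD)
  have Wm: "(\<lambda>x. W x $ i) \<in> borel_measurable (lebesgue_on \<Omega>)" for i
    using W[of i] locally_integrable_measurable[OF \<Omega>(1)] by (simp add: has_weak_partial_def)
  note iN = flux_integrable(1)[OF \<Omega> Wm fluxW] and iG = flux_integrable(2)[OF \<Omega> Wm fluxW]
    and iF = flux_integrable(3)[OF \<Omega> Wm fluxW]
  have iw: "integrable lebesgue (\<lambda>z. indicator D z * w z)"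
    using W[of undefined] by (intro locally_integrable_indicator[OF _ D(2,3)]) (simp add: has_weak_partial_def)
  have iW: "integrable lebesgue (\<lambda>z. indicator D z * W z $ i)" for i
    using W[of i] by (intro locally_integrable_indicator[OF _ D(2,3)]) (simp add: has_weak_partial_def)
  have cw: "continuous_on ?K w" "continuous_on D w" using w U(2) D(3) continuous_on_subset by blast+
  have "v x - \<kappa> \<le> w x" if \<kappa>: "\<kappa> > 0" for \<kappa>
  proof -
    obtain s where s: "s > 0" "s \<le> e0" "\<And>r x. 0 < r \<Longrightarrow> r \<le> s \<Longrightarrow> x \<in> ?K \<Longrightarrow>
        \<bar>conv (mollifier r) (\<lambda>z. indicator D z * w z) x - w x\<bar> \<le> \<kappa>/4"
      by (rule mollified_uniform[OF iw cw(2) D(2) _ D(1,4), of "\<kappa>/4"]) (use \<kappa> in auto)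
    define r where "r n = s / (real n + 1)" for n
    have r: "r n > 0" "r n \<le> s" for n using s(1) by (auto simp: r_def divide_simps)
    have r0: "filterlim r (at_right 0) sequentially"
    proof -
      have "r \<longlonglongrightarrow> 0" unfolding r_def by real_asymp
      then show ?thesis using r(1) by (intro tendsto_imp_filterlim_at_right) auto
    qed
    define wn where "wn n = conv (mollifier (r n)) (\<lambda>z. indicator D z * w z)" for n
    define Wn where "Wn n x = (\<chi> i. conv (mollifier (r n)) (\<lambda>z. indicator D z * W z $ i) x)" for n x
    have cWn: "continuous_on UNIV (\<lambda>x. Wn n x $ i)" for n i
      unfolding Wn_def using conv_continuous[OF mollifier_continuous[OF r(1)] iW] by simp
    have cWn': "continuous_on S (Wn n)" for n S
    proof -
      have "continuous_on UNIV (\<lambda>x. \<chi> i. Wn n x $ i)" by (rule continuous_on_vec_lambda[OF cWn])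
      then have "continuous_on UNIV (Wn n)" by simp
      then show ?thesis using continuous_on_subset by blast
    qed
    have dwn: "(wn n has_derivative (\<lambda>k. Wn n x \<bullet> k)) (at x)" if "x \<in> ?K" for n x
      unfolding wn_def Wn_def
    proof (rule mollified_has_derivative[OF \<Omega>(1) W D(2,3) r(1)])
      show "cball x (r n) \<subseteq> D" using D(4)[OF that] r(2)[of n] s(2) subset_cball[of "r n" e0 x] by auto
    qed
    have wnw: "\<bar>wn n x - w x\<bar> \<le> \<kappa>/4" if "x \<in> ?K" for n x unfolding wn_def using s(3) r that by blast
    have wn_lim: "(\<lambda>n. wn n x) \<longlonglongrightarrow> w x" if "x \<in> ?K" for x
    proof (rule tendstoI)
      fix e :: real assume "e > 0"
      obtain t where t: "t > 0" "\<And>r x. 0 < r \<Longrightarrow> r \<le> t \<Longrightarrow> x \<in> ?K \<Longrightarrow>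
          \<bar>conv (mollifier r) (\<lambda>z. indicator D z * w z) x - w x\<bar> \<le> e/2"
        by (rule mollified_uniform[OF iw cw(2) D(2) _ D(1,4), of "e/2"]) (use \<open>e > 0\<close> in auto)
      have "eventually (\<lambda>h. 0 < h \<and> h < t) (at_right 0)" using eventually_at_right_real[OF t(1)] by simp
      then have "eventually (\<lambda>n. 0 < r n \<and> r n < t) sequentially" by (rule eventually_compose_filterlim[OF _ r0])
      then show "eventually (\<lambda>n. dist (wn n x) (w x) < e) sequentially"
      proof eventually_elim
        case (elim n)
        then have "\<bar>wn n x - w x\<bar> \<le> e/2" unfolding wn_def using t(2) that by simp
        then show ?case using \<open>e > 0\<close> by (simp add: dist_real_def)
      qed
    qed
    \<comment> \<open>The budget for \<kappa>: since v \<le> w on the boundary, the threshold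
      \<kappa>/2 keeps \<open>C\<close> inside \<open>U\<close>. Off \<open>C\<close>, the
      mollification error \<kappa>/4 still leaves v - \<kappa> - w_n negative, so the test function
      vanishes there.\<close>
    define C where "C = {x\<in>?K. \<kappa>/2 \<le> v x - w x}"
    have "closed C" unfolding C_def
      by (intro continuous_on_closed_Collect_le continuous_intros v(1) cw(1)) simp
    from compact_Int_closed[OF KK this] have C: "compact C"
      by (simp add: C_def Int_def)
    have CU: "C \<subseteq> U"
    proof
      fix y assume y: "y \<in> C"
      show "y \<in> U"
      proof (rule ccontr)
        assume "y \<notin> U"
        then have "y \<in> frontier U" using y U(1) by (simp add: C_def frontier_def interior_open)
        then show False using bdry[of y] y \<kappa> by (simp add: C_def)
      qed
    qed
    have CK: "C \<subseteq> ?K" "C \<subseteq> D"  "C \<subseteq> \<Omega>"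
      using D(1,3,4) by (auto simp: C_def) force+
    have Cs: "C \<in> sets lebesgue" using C by (simp add: lmeasurable_compact fmeasurableD)
    \<comment> \<open>The test function is Z n = (q n)^2, and its gradient is 2 q_n (b - W_n): a
      bounded nonnegative weight times the difference of gradients, without a jump at the edge of
      the positivity set.\<close>
    define q where "q n x = indicator C x * max 0 (v x - \<kappa> - wn n x)" for n x
    define q' where "q' x = indicator C x * max 0 (v x - \<kappa> - w x)" for x
    define Z where "Z n x = (if x \<in> C then (max 0 (v x - \<kappa> - wn n x))^2 else 0)" for n x
    define Z' where "Z' n x = (if x \<in> C then (2 * max 0 (v x - \<kappa> - wn n x)) *\<^sub>R (v' x - Wn n x) else 0)" for n x
    have UK: "U \<subseteq> ?K" by (rule closure_subset)
    have Z: "C1_compact (Z n) (Z' n)" for n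
      unfolding Z_def[abs_def] Z'_def[abs_def]
    proof (rule C1_compact_positive_part_square[OF C U(1) CU])
      fix x assume x: "x \<in> U"
      show "((\<lambda>x. v x - \<kappa> - wn n x) has_derivative (\<lambda>k. (v' x - Wn n x) \<bullet> k)) (at x)"
        using v(2)[OF x] dwn[of x n] x UK by (auto intro!: derivative_eq_intros simp: inner_diff_left)
      assume "x \<notin> C"
      moreover have "x \<in> ?K" using x UK by blast
      ultimately have "v x - w x < \<kappa>/2" by (simp add: C_def)
      then show "v x - \<kappa> - wn n x \<le> 0" using wnw[OF \<open>x \<in> ?K\<close>, of n] by linarith
    qed (intro continuous_intros v(3) cWn')
    have Zpos: "Z n x \<ge> 0" "x \<notin> C \<Longrightarrow> Z n x = 0" for n x by (auto simp: Z_def)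
    have superZ: "0 \<le> (\<integral>x. flux (W x) \<bullet> Z' n x \<partial>lebesgue_on \<Omega>)" for n
      using super[OF Z C CK(3)] Zpos by blast
    have subZ: "(\<integral>x. flux (v' x) \<bullet> Z' n x \<partial>lebesgue) \<le> 0" for n
      using sub[OF Z C CU] Zpos by blast
    define F where "F x = indicator C x *\<^sub>R flux (W x)" for x
    define a where "a x = indicator C x *\<^sub>R flux (v' x)" for x
    define b where "b x = indicator C x *\<^sub>R v' x" for x
    define W' where "W' x = indicator D x *\<^sub>R W x" for x
    \<comment> \<open>The two halves of Young's bound. \<open>G\<close> gets mollified, so it is cut
      off at \<open>D\<close>, which contains the relevant balls about points of \<open>C\<close>.
      \<open>P\<close> stays at the point x; its value t m(t) - M(t) is the complementary function
      at m(t), for t = |W x|.\<close>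
    define G where "G x = indicator D x * M (norm (W x))" for x
    define P where "P x = indicator C x * (norm (W x) * m (norm (W x)) - M (norm (W x)))" for x
    have cv': "continuous_on C v'" using v(3) CU continuous_on_subset by blast
    have cfv': "continuous_on C (\<lambda>x. flux (v' x))"
      by (rule continuous_on_compose2[OF flux_continuous cv']) simp
    have cvw: "continuous_on C v" "continuous_on C w" using v(1) cw(1) CK(1) continuous_on_subset by blast+
    have bnd: "\<exists>B\<ge>0. \<forall>x\<in>C. norm (f x) \<le> B" if "continuous_on C f" for f :: "real^'n \<Rightarrow> 'z::real_normed_vector"
      using compact_imp_bounded[OF compact_continuous_image[OF that C]]
      by (metis bounded_pos imageI less_imp_le)
    obtain A1 where A1: "A1 \<ge> 0" "\<And>x. x \<in> C \<Longrightarrow> norm (v' x) \<le> A1" using bnd[OF cv'] by blast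
    obtain A2 where A2: "A2 \<ge> 0" "\<And>x. x \<in> C \<Longrightarrow> norm (flux (v' x)) \<le> A2" using bnd[OF cfv'] by blast
    obtain B1 where B1: "B1 \<ge> 0" "\<And>x. x \<in> C \<Longrightarrow> norm (v x - w x) \<le> B1"
      using bnd[OF continuous_on_diff[OF cvw]] by blast
    obtain R where R: "R \<ge> 0" "\<And>x. x \<in> C \<Longrightarrow> norm x \<le> R" using bnd[OF continuous_on_id] by blast
    define A where "A = max A1 A2"
    define B where "B = B1 + \<kappa>/4"
    have B: "B \<ge> 0" using B1(1) \<kappa> by (simp add: B_def)
    have aA: "\<bar>a x $ i\<bar> \<le> A" and bA: "\<bar>b x $ i\<bar> \<le> A" for i x
      using A1 A2 component_le_norm_cart[of "v' x" i] component_le_norm_cart[of "flux (v' x)" i]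
      by (cases "x \<in> C"; force simp: a_def b_def A_def)+
    have qB: "0 \<le> q n x" "q n x \<le> B" for n x
    proof -
      show "0 \<le> q n x" by (simp add: q_def)
      show "q n x \<le> B"
      proof (cases "x \<in> C")
        case True
        then have "x \<in> ?K" using CK(1) by blast
        then have "v x - \<kappa> - wn n x \<le> B"
          using B1(2)[OF True] wnw[of x n] \<kappa> unfolding B_def real_norm_def by linarith
        then show ?thesis using True B by (simp add: q_def)
      qed (use B in \<open>simp add: q_def\<close>)
    qed
    have cwn: "continuous_on C (wn n)" for n
      using dwn CK(1) by (meson continuous_at_imp_continuous_on has_derivative_continuous subsetD)
    have qint: "integrable lebesgue (q n)" for n
      unfolding q_def[abs_def] by (intro continuous_indicator_integrable continuous_intros cvw cwn C)
    have q'int: "integrable lebesgue q'"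
      unfolding q'_def[abs_def] by (intro continuous_indicator_integrable continuous_intros cvw C)
    have qlim: "(\<lambda>n. q n x) \<longlonglongrightarrow> q' x" for x
    proof (cases "x \<in> C")
      case True
      then show ?thesis unfolding q_def q'_def using CK(1) by (intro tendsto_intros wn_lim) auto
    qed (simp add: q_def q'_def)
    have Fi: "integrable lebesgue (\<lambda>x. F x $ i)" for i
      using integrable_indicator_mult[OF iF \<Omega>s Cs CK(3), of i] by (simp add: F_def)
    have ai: "integrable lebesgue (\<lambda>x. a x $ i)" for i
      using continuous_indicator_integrable[OF continuous_on_component[OF cfv'] C, of i] by (simp add: a_def)
    have bi: "integrable lebesgue (\<lambda>x. b x $ i)" for i
      using continuous_indicator_integrable[OF continuous_on_component[OF cv'] C, of i] by (simp add: b_def)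
    have W'i: "integrable lebesgue (\<lambda>x. W' x $ i)" for i using iW[of i] by (simp add: W'_def)
    have Wni: "integrable lebesgue (\<lambda>x. Wn n x $ i)" for n i
      unfolding Wn_def using conv_mollifier_L1(1)[OF r(1) iW] by simp
    have Wnlim: "(\<lambda>n. \<integral>x. \<bar>Wn n x $ i - W' x $ i\<bar> \<partial>lebesgue) \<longlonglongrightarrow> 0" for i
      using filterlim_compose[OF conv_mollifier_tendsto[OF iW[of i]] r0] by (simp add: Wn_def W'_def)
    have Gi: "integrable lebesgue G" unfolding G_def[abs_def] by (rule integrable_indicator_mult[OF iG \<Omega>s Ds D(3)])
    have Gni: "integrable lebesgue (conv (mollifier (r n)) G)" for n by (rule conv_mollifier_L1(1)[OF r(1) Gi])
    have Gnlim: "(\<lambda>n. \<integral>x. \<bar>conv (mollifier (r n)) G x - G x\<bar> \<partial>lebesgue) \<longlonglongrightarrow> 0"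
      by (rule filterlim_compose[OF conv_mollifier_tendsto[OF Gi] r0])
    have Pi: "integrable lebesgue P" unfolding P_def[abs_def]
      by (intro integrable_indicator_mult[OF _ \<Omega>s Cs CK(3)] Bochner_Integration.integrable_diff iN iG)
    have FWni: "integrable lebesgue (\<lambda>x. q n x * (F x \<bullet> Wn n x))" for n
    proof -
      have "integrable lebesgue (\<lambda>x. (q n x * Wn n x $ i) * F x $ i)" for i
      proof -
        obtain B' where B': "\<And>x. \<bar>Wn n x $ i\<bar> \<le> B'"
          using conv_bounded[OF mollifier_continuous[OF r(1)] iW[of i]] unfolding Wn_def vec_lambda_beta by metis
        have "\<bar>q n x * Wn n x $ i\<bar> \<le> B * B'" for x
          unfolding abs_mult using qB[of n x] B B' by (intro mult_mono) auto
        then show ?thesis using qint[of n] Wni[of n i]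
          by (intro integrable_mult_bounded[OF Fi] borel_measurable_times) (auto dest: borel_measurable_integrable)
      qed
      then have "integrable lebesgue (\<lambda>x. \<Sum>i\<in>UNIV. (q n x * Wn n x $ i) * F x $ i)"
        by (intro Bochner_Integration.integrable_sum)
      moreover have "(\<Sum>i\<in>UNIV. (q n x * Wn n x $ i) * F x $ i) = q n x * (F x \<bullet> Wn n x)" for x
        by (simp add: inner_vec_def sum_distrib_left mult_ac)
      ultimately show ?thesis by simp
    qed
    have FW'i: "integrable lebesgue (\<lambda>x. F x \<bullet> W' x)"
    proof -
      have "F x \<bullet> W' x = indicator C x * (flux (W x) \<bullet> W x)" for x
        using CK(2) by (auto simp: F_def W'_def indicator_def)
      then show ?thesis using integrable_indicator_mult[OF fluxW \<Omega>s Cs CK(3)] by simp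
    qed
    \<comment> \<open>Young's inequality between flux(W x) and W z, averaged over z with the weight
      \<open>mollifier (r n) (x - z)\<close>. The term \<open>P x\<close> survives unchanged because
      the kernel has mass 1.\<close>
    have low: "- (conv (mollifier (r n)) G x + P x) \<le> F x \<bullet> Wn n x" for n x
    proof (cases "x \<in> C")
      case False
      have "conv (mollifier (r n)) G x \<ge> 0" unfolding conv_def
        by (intro Bochner_Integration.integral_nonneg mult_nonneg_nonneg mollifier_nonneg[OF r(1)]) (simp add: G_def M_nonneg)
      then show ?thesis using False by (simp add: F_def P_def)
    next
      case True
      let ?\<eta> = "\<lambda>z. mollifier (r n) (x - z)"
      have \<eta>D: "?\<eta> z = 0" if "z \<notin> D" for z
      proof -
        have "cball x (r n) \<subseteq> D" using D(4)[of x] True CK(1) r(2)[of n] s(2) subset_cball[of "r n" e0 x] by auto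
        then have "z \<notin> cball x (r n)" using that by blast
        then have "norm (x - z) > r n" by (simp add: dist_norm)
        then show ?thesis by (rule mollifier_continuous(2)[OF r(1)])
      qed
      have iWz: "integrable lebesgue (\<lambda>z. ?\<eta> z * (indicator D z * W z $ i))" for i
        by (rule conv_mollifier_integrable[OF r(1) iW])
      have iGz: "integrable lebesgue (\<lambda>z. ?\<eta> z * G z)" by (rule conv_mollifier_integrable[OF r(1) Gi])
      have i\<eta>: "integrable lebesgue ?\<eta>" by (rule mollifier_shift_integrable[OF r(1)])
      have "- (conv (mollifier (r n)) G x + P x) = (\<integral>z. - (?\<eta> z * G z) - P x * ?\<eta> z \<partial>lebesgue)"
        using iGz i\<eta> mollifier_integral[OF r(1), of n x] by (simp add: conv_def)
      also have "\<dots> \<le> (\<integral>z. (\<Sum>i\<in>UNIV. F x $ i * (?\<eta> z * (indicator D z * W z $ i))) \<partial>lebesgue)"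
      proof (rule integral_mono)
        show "integrable lebesgue (\<lambda>z. - (?\<eta> z * G z) - P x * ?\<eta> z)" using iGz i\<eta> by simp
        show "integrable lebesgue (\<lambda>z. \<Sum>i\<in>UNIV. F x $ i * (?\<eta> z * (indicator D z * W z $ i)))" using iWz by simp
        fix z
        have "- (?\<eta> z * G z) - P x * ?\<eta> z \<le> ?\<eta> z * (F x \<bullet> W z)"
        proof (cases "z \<in> D")
          case zD: True
          have "- (M (norm (W z)) + P x) \<le> F x \<bullet> W z"
            using flux_young[of "W z" "W x"] True by (simp add: F_def P_def)
          then have "?\<eta> z * (- (M (norm (W z)) + P x)) \<le> ?\<eta> z * (F x \<bullet> W z)"
            by (intro mult_left_mono mollifier_nonneg[OF r(1)])
          then show ?thesis using zD by (simp add: G_def algebra_simps)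
        qed (simp add: \<eta>D)
        also have "\<dots> = (\<Sum>i\<in>UNIV. F x $ i * (?\<eta> z * (indicator D z * W z $ i)))"
        proof (cases "z \<in> D")
          case True
          then show ?thesis by (simp add: inner_vec_def sum_distrib_left mult_ac)
        qed (simp add: \<eta>D)
        finally show "- (?\<eta> z * G z) - P x * ?\<eta> z \<le> (\<Sum>i\<in>UNIV. F x $ i * (?\<eta> z * (indicator D z * W z $ i)))" .
      qed
      also have "\<dots> = (\<Sum>i\<in>UNIV. F x $ i * Wn n x $ i)"
        using iWz by (simp add: Bochner_Integration.integral_sum Wn_def conv_def)
      also have "\<dots> = F x \<bullet> Wn n x" by (simp add: inner_vec_def)
      finally show ?thesis .
    qed
    have qm: "q n \<in> borel_measurable lebesgue" for n using qint[of n] by (rule borel_measurable_integrable)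
    have qabs: "\<bar>q n x\<bar> \<le> B" for n x using qB[of n x] by simp
    have bWi: "integrable lebesgue (\<lambda>x. (b x - Wn n x) $ i)" for n i using bi Wni by simp
    have Zq: "Z' n x = (2 * q n x) *\<^sub>R (b x - Wn n x)" "Z n x = (q n x)^2" for n x
      by (auto simp: Z'_def Z_def q_def b_def indicator_def)
    have ineq: "0 \<le> (\<integral>x. q n x * ((F x - a x) \<bullet> (b x - Wn n x)) \<partial>lebesgue)" for n
    proof -
      have "integrable lebesgue (\<lambda>x. (b x - Wn n x) \<bullet> a x)"
        by (rule integrable_inner_bounded[OF bWi borel_measurable_integrable[OF ai] aA])
      from integrable_mult_bounded[OF this qm qabs]
      have iY: "integrable lebesgue (\<lambda>x. q n x * (a x \<bullet> (b x - Wn n x)))" by (simp add: inner_commute)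
      have "integrable lebesgue (\<lambda>x. F x \<bullet> b x)"
        by (rule integrable_inner_bounded[OF Fi borel_measurable_integrable[OF bi] bA])
      from Bochner_Integration.integrable_diff[OF integrable_mult_bounded[OF this qm qabs] FWni[of n]]
      have iX: "integrable lebesgue (\<lambda>x. q n x * (F x \<bullet> (b x - Wn n x)))"
        by (simp add: inner_diff_right right_diff_distrib)
      have "indicator \<Omega> x *\<^sub>R (flux (W x) \<bullet> Z' n x) = 2 * (q n x * (F x \<bullet> (b x - Wn n x)))" for x
        using CK(3) by (auto simp: Zq F_def q_def indicator_def)
      then have X: "0 \<le> (\<integral>x. q n x * (F x \<bullet> (b x - Wn n x)) \<partial>lebesgue)"
        using superZ[of n] \<Omega>s by (simp add: integral_restrict_space)
      have "flux (v' x) \<bullet> Z' n x = 2 * (q n x * (a x \<bullet> (b x - Wn n x)))" for x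
        by (auto simp: Zq a_def q_def indicator_def)
      then have Y: "(\<integral>x. q n x * (a x \<bullet> (b x - Wn n x)) \<partial>lebesgue) \<le> 0" using subZ[of n] by simp
      have "(\<integral>x. q n x * ((F x - a x) \<bullet> (b x - Wn n x)) \<partial>lebesgue) =
          (\<integral>x. q n x * (F x \<bullet> (b x - Wn n x)) - q n x * (a x \<bullet> (b x - Wn n x)) \<partial>lebesgue)"
        by (simp add: inner_diff_left right_diff_distrib)
      then show ?thesis using X Y Bochner_Integration.integral_diff[OF iX iY] by simp
    qed
    have lim: "0 \<le> (\<integral>x. q' x * ((F x - a x) \<bullet> (b x - W' x)) \<partial>lebesgue)"
        "integrable lebesgue (\<lambda>x. q' x * ((F x - a x) \<bullet> (b x - W' x)))"
      using limit_of_tested_inequalities[where q = q and L = lebesgue and F = F and a = a and b = b and W = Wn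
          and G = "\<lambda>n. conv (mollifier (r n)) G" and W' = W' and q' = q' and B = B and A = A and P = P and G' = G,
          OF qm qB qlim Fi ai aA borel_measurable_integrable[OF bi] bA Wni W'i Wnlim Gni Gi Gnlim Pi FWni FW'i low ineq]
      by blast+
    \<comment> \<open>On \<open>C\<close> all cut-offs disappear, and what remains is minus the
      weight times the monotonicity expression. Together with \<open>lim(1)\<close> this makes the
      integral vanish.\<close>
    have le0: "q' x * ((F x - a x) \<bullet> (b x - W' x)) = - (q' x * ((flux (W x) - flux (v' x)) \<bullet> (W x - v' x)))" for x
      using CK(2) by (cases "x \<in> C") (auto simp: q'_def F_def a_def b_def W'_def indicator_def inner_diff_right algebra_simps)
    have q'pos: "q' x \<ge> 0" for x by (simp add: q'_def)
    have "AE x in lebesgue. q' x * ((flux (W x) - flux (v' x)) \<bullet> (W x - v' x)) = 0"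
    proof -
      have i: "integrable lebesgue (\<lambda>x. q' x * ((flux (W x) - flux (v' x)) \<bullet> (W x - v' x)))"
        using lim(2) unfolding le0 by simp
      have p: "0 \<le> q' x * ((flux (W x) - flux (v' x)) \<bullet> (W x - v' x))" for x
        by (intro mult_nonneg_nonneg q'pos flux_monotone)
      have "(\<integral>x. q' x * ((flux (W x) - flux (v' x)) \<bullet> (W x - v' x)) \<partial>lebesgue) = 0"
        using lim(1) p unfolding le0 by (simp add: antisym Bochner_Integration.integral_nonneg)
      then show ?thesis using integral_nonneg_eq_0_iff_AE[OF i AE_I2[OF p]] by blast
    qed
    then have ae: "AE x in lebesgue. q' x = 0 \<or> W x = v' x"
      by eventually_elim (use flux_strict_monotone in auto)
    define i :: 'n where "i = undefined"
    \<comment> \<open>Integration by parts of x_i against (q_n)^2, the substitute for a Poincare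
      inequality. Any coordinate \<open>i\<close> serves; on \<open>C\<close> the factor x_i is
      bounded, so the left side converges by \<open>tendsto_integral_mult_bounded\<close>.\<close>
    have Zint: "(\<integral>x. (2 * (indicator C x * x $ i) * q n x) * (b x - Wn n x) $ i \<partial>lebesgue) = - (\<integral>x. (q n x)^2 \<partial>lebesgue)" for n
    proof -
      have ax: "x $ i = axis i 1 \<bullet> x" for x :: "real^'n" by (simp add: inner_axis inner_commute)
      have "((\<lambda>x::real^'n. x $ i) has_derivative (\<lambda>k. axis i 1 \<bullet> k)) (at x)" for x
        unfolding ax by (intro bounded_linear_imp_has_derivative bounded_linear_inner_right)
      from C1_compact_mult[OF Z[of n] this]
      have h: "C1_compact (\<lambda>x. x $ i * Z n x) (\<lambda>x. (x $ i) *\<^sub>R Z' n x + Z n x *\<^sub>R axis i 1)" by simp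
      have iZ: "integrable lebesgue (Z n)" by (rule C1_compact_integrable(1)[OF Z])
      have "integrable lebesgue (\<lambda>x. ((x $ i) *\<^sub>R Z' n x + Z n x *\<^sub>R axis i 1) $ i)"
        by (rule C1_compact_integrable(3)[OF h])
      then have i1: "integrable lebesgue (\<lambda>x. x $ i * Z' n x $ i + Z n x)" by (simp add: axis_def)
      from Bochner_Integration.integrable_diff[OF this iZ]
      have i2: "integrable lebesgue (\<lambda>x. x $ i * Z' n x $ i)" by simp
      have "(\<integral>x. x $ i * Z' n x $ i + Z n x \<partial>lebesgue) = 0"
        using integral_partial_eq_0[OF h, of i] by (simp add: axis_def)
      then have "(\<integral>x. x $ i * Z' n x $ i \<partial>lebesgue) = - (\<integral>x. Z n x \<partial>lebesgue)"
        using Bochner_Integration.integral_add[OF i2 iZ] by simp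
      moreover have "x $ i * Z' n x $ i = (2 * (indicator C x * x $ i) * q n x) * (b x - Wn n x) $ i" for x
        unfolding Zq(1) by (cases "x \<in> C") (simp_all add: q_def)
      ultimately show ?thesis by (simp add: Zq(2))
    qed
    have L1: "(\<lambda>n. \<integral>x. (2 * (indicator C x * x $ i) * q n x) * (b x - Wn n x) $ i \<partial>lebesgue) \<longlonglongrightarrow>
        (\<integral>x. (2 * (indicator C x * x $ i) * q' x) * (b x - W' x) $ i \<partial>lebesgue)"
    proof (rule tendsto_integral_mult_bounded[where B = "2 * R * B"])
      have "integrable lebesgue (\<lambda>x. indicator C x * x $ i)"
        by (intro continuous_indicator_integrable continuous_on_component continuous_on_id C)
      from borel_measurable_integrable[OF this]
      show "(\<lambda>x. 2 * (indicator C x * x $ i) * q n x) \<in> borel_measurable lebesgue" for n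
        by (rule borel_measurable_times[OF borel_measurable_times[OF borel_measurable_const] qm])
      show "\<bar>2 * (indicator C x * x $ i) * q n x\<bar> \<le> 2 * R * B" for n x
      proof -
        have "\<bar>indicator C x * x $ i\<bar> \<le> R"
          using R(1) R(2)[of x] component_le_norm_cart[of x i] by (cases "x \<in> C") auto
        then have "\<bar>indicator C x * x $ i\<bar> * \<bar>q n x\<bar> \<le> R * B" using qabs[of n x] R(1) by (intro mult_mono) auto
        then show ?thesis by (simp add: abs_mult mult.assoc)
      qed
      show "(\<lambda>n. 2 * (indicator C x * x $ i) * q n x) \<longlonglongrightarrow> 2 * (indicator C x * x $ i) * q' x" for x
        by (intro tendsto_intros qlim)
      show "integrable lebesgue (\<lambda>x. (b x - W' x) $ i)" using bi W'i by simp
      show "(\<lambda>n. \<integral>x. \<bar>(b x - Wn n x) $ i - (b x - W' x) $ i\<bar> \<partial>lebesgue) \<longlonglongrightarrow> 0"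
        using Wnlim[of i] by (simp add: abs_minus_commute)
    qed (rule bWi)
    \<comment> \<open>Almost everywhere on \<open>C\<close> either the weight q' vanishes or the two
      gradients coincide, by \<open>ae\<close>; so the integrals of (q_n)^2 tend to 0.\<close>
    have "(\<integral>x. (2 * (indicator C x * x $ i) * q' x) * (b x - W' x) $ i \<partial>lebesgue) = (\<integral>x. 0 \<partial>(lebesgue :: (real^'n) measure))"
    proof (rule integral_cong_AE)
      have "integrable lebesgue (\<lambda>x. indicator C x * x $ i)"
        by (intro continuous_indicator_integrable continuous_on_component continuous_on_id C)
      note im = borel_measurable_times[OF borel_measurable_times[OF borel_measurable_const borel_measurable_integrable[OF this]]
          borel_measurable_integrable[OF q'int], of 2]
      have "(\<lambda>x. (b x - W' x) $ i) \<in> borel_measurable lebesgue"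
        using borel_measurable_diff[OF borel_measurable_integrable[OF bi[of i]] borel_measurable_integrable[OF W'i[of i]]] by simp
      with im show "(\<lambda>x. (2 * (indicator C x * x $ i) * q' x) * (b x - W' x) $ i) \<in> borel_measurable lebesgue"
        by (rule borel_measurable_times)
      show "AE x in lebesgue. (2 * (indicator C x * x $ i) * q' x) * (b x - W' x) $ i = 0"
        using ae
      proof eventually_elim
        case (elim x)
        then show ?case using CK(2) by (cases "x \<in> C") (auto simp: b_def W'_def)
      qed
    qed simp
    with L1 Zint have "(\<lambda>n. - (\<integral>x. (q n x)^2 \<partial>lebesgue)) \<longlonglongrightarrow> 0" by simp
    then have to0: "(\<lambda>n. \<integral>x. (q n x)^2 \<partial>lebesgue) \<longlonglongrightarrow> 0" using tendsto_minus by fastforce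
    have iq': "integrable lebesgue (\<lambda>x. (q' x)^2)" and toq': "(\<lambda>n. \<integral>x. (q n x)^2 \<partial>lebesgue) \<longlonglongrightarrow> (\<integral>x. (q' x)^2 \<partial>lebesgue)"
    proof -
      have ind: "integrable lebesgue (\<lambda>x. indicator C x * B^2)"
        by (intro continuous_indicator_integrable continuous_on_const C)
      have le: "norm ((q n x)^2) \<le> indicator C x * B^2" for n x
        using qB[of n x] power_mono[of "q n x" B 2] by (cases "x \<in> C") (auto simp: q_def)
      have l: "(\<lambda>n. (q n x)^2) \<longlonglongrightarrow> (q' x)^2" for x by (intro tendsto_intros qlim)
      have m1: "(\<lambda>x. (q' x)^2) \<in> borel_measurable lebesgue" using borel_measurable_integrable[OF q'int] by simp
      have m2: "(\<lambda>x. (q n x)^2) \<in> borel_measurable lebesgue" for n using qm[of n] by simp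
      show "integrable lebesgue (\<lambda>x. (q' x)^2)"
        by (rule integrable_dominated_convergence[OF m1 m2 ind AE_I2[OF l] AE_I2[OF le]])
      show "(\<lambda>n. \<integral>x. (q n x)^2 \<partial>lebesgue) \<longlonglongrightarrow> (\<integral>x. (q' x)^2 \<partial>lebesgue)"
        by (rule integral_dominated_convergence[OF m1 m2 ind AE_I2[OF l] AE_I2[OF le]])
    qed
    have "(\<integral>x. (q' x)^2 \<partial>lebesgue) = 0" using LIMSEQ_unique[OF toq' to0] .
    then have "AE x in lebesgue. (q' x)^2 = 0"
      using integral_nonneg_eq_0_iff_AE[OF iq' AE_I2] by (metis zero_le_power2)
    then have neg: "negligible {x. (q' x)^2 \<noteq> 0}" by (simp only: AE_lebesgue_iff_negligible)
    show ?thesis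
    proof (rule ccontr)
      assume "\<not> v x - \<kappa> \<le> w x"
      \<comment> \<open>That q' vanishes almost everywhere makes this set negligible. Continuity
        makes it open, and a nonempty open set is not negligible.\<close>
      let ?S = "{y\<in>U. w y < v y - \<kappa>}"
      have xS: "x \<in> ?S" using \<open>\<not> v x - \<kappa> \<le> w x\<close> x by simp
      have "continuous_on U v" "continuous_on U w" using v(1) cw(1) UK continuous_on_subset by blast+
      then have "continuous_on U (\<lambda>y. v y - \<kappa> - w y)" by (intro continuous_intros)
      from continuous_open_preimage[OF this U(1), of "{0<..}"]
      have "open (U \<inter> (\<lambda>y. v y - \<kappa> - w y) -` {0<..})" by simp
      moreover have "U \<inter> (\<lambda>y. v y - \<kappa> - w y) -` {0<..} = ?S" by auto
      ultimately have "open ?S" by simp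
      have "negligible ?S"
        by (rule negligible_subset[OF neg]) (use UK \<kappa> in \<open>auto simp: q'_def C_def\<close>)
      then show False using xS open_not_negligible[OF \<open>open ?S\<close>] by blast
    qed
  qed
  then have "v x \<le> w x + \<kappa>" if "\<kappa> > 0" for \<kappa> using that by (simp add: diff_le_eq)
  then show ?thesis by (rule field_le_epsilon)
qed

end

section \<open>The strong maximum principle\<close>

text \<open>Mollifying \<open>Z\<close> keeps it nonnegative and, for radii at most
  \<open>e\<close>, supported in \<Omega>. The gradients stay bounded and converge pointwise, which
  suffices against the merely integrable field \<open>F\<close>.\<close>

lemma tested_with_C1_compact:
  fixes F :: "real^'n \<Rightarrow> real^'n"
  assumes \<Omega>: "open \<Omega>" and F: "\<And>i. integrable (lebesgue_on \<Omega>) (\<lambda>x. F x $ i)"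
    and test: "\<And>\<psi>. \<psi> \<in> test_functions \<Omega> \<Longrightarrow> (\<And>x. 0 \<le> \<psi> x) \<Longrightarrow>
      0 \<le> (\<integral>x. F x \<bullet> (\<chi> i. partial_deriv i \<psi> x) \<partial>lebesgue_on \<Omega>)"
    and Z: "C1_compact Z Z'" "compact K" "K \<subseteq> \<Omega>" "\<And>x. x \<notin> K \<Longrightarrow> Z x = 0" "\<And>x. 0 \<le> Z x"
  shows "0 \<le> (\<integral>x. F x \<bullet> Z' x \<partial>lebesgue_on \<Omega>)"
proof -
  obtain e D where D: "e > 0" "D \<subseteq> \<Omega>" "\<And>x. x \<in> K \<Longrightarrow> cball x e \<subseteq> D"
    using compact_neighbourhood[OF Z(2) \<Omega> Z(3)] by metis
  define r where "r n = e / (real n + 1)" for n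
  have r: "r n > 0" "r n \<le> e" for n using D(1) by (auto simp: r_def divide_simps)
  have rlim: "r \<longlonglongrightarrow> 0" unfolding r_def by real_asymp
  have iZ: "integrable lebesgue Z" by (rule C1_compact_integrable(1)[OF Z(1)])
  have iZ': "integrable lebesgue (\<lambda>x. Z' x $ i)" for i by (rule C1_compact_integrable(3)[OF Z(1)])
  obtain R where R: "\<And>x. norm x > R \<Longrightarrow> Z' x = 0" "continuous_on UNIV Z'" using C1_compactE[OF Z(1)] by metis
  obtain B where B: "B > 0" "\<And>x. norm (Z' x) \<le> B" using compact_support_bounded[OF R(2,1)] by metis
  define \<psi> where "\<psi> n = conv (mollifier (r n)) Z" for n
  define q where "q n i x = conv (mollifier (r n)) (\<lambda>x. Z' x $ i) x" for n i x
  have d: "partial_deriv i (\<psi> n) x = q n i x" for i n x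
  proof -
    have "partial_deriv i (\<psi> n) x = conv (partial_deriv i (mollifier (r n))) Z x"
      unfolding \<psi>_def by (rule partial_deriv_conv(2)[OF mollifier_smooth[OF r(1)] iZ])
    also have "\<dots> = q n i x"
      \<comment> \<open>Taking the whole space as domain moves the derivative from the kernel onto
        \<open>Z\<close>.\<close>
      using weak_partial_conv[OF open_UNIV C1_compact_has_weak_partial[OF open_UNIV Z(1)] mollifier_smooth[OF r(1)], of x n UNIV i]
      by (simp add: q_def)
    finally show ?thesis .
  qed
  have t: "\<psi> n \<in> test_functions \<Omega>" for n unfolding \<psi>_def
  proof (rule conv_test_function[OF mollifier_smooth[OF r(1)] iZ Z(2,4)])
    fix x z assume "z \<in> K" "dist x z \<le> r n"
    then have "x \<in> cball z e" using r(2)[of n] by (simp add: dist_commute)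
    then show "x \<in> \<Omega>" using D \<open>z \<in> K\<close> by blast
  qed
  have pos: "0 \<le> \<psi> n x" for n x unfolding \<psi>_def conv_def
    by (intro Bochner_Integration.integral_nonneg mult_nonneg_nonneg Z(5) mollifier_nonneg[OF r(1)])
  have Z'B: "\<bar>Z' x $ i\<bar> \<le> B" for x i using component_le_norm_cart[of "Z' x" i] B(2)[of x] by linarith
  have qB: "\<bar>q n i x\<bar> \<le> B" for n i x
    using conv_mollifier_approx[OF r(1) iZ', of x n i 0 B] Z'B by (simp add: q_def)
  have cq: "continuous_on UNIV (q n i)" for n i
    unfolding q_def[abs_def] by (rule conv_continuous[OF mollifier_continuous[OF r(1)] iZ'])
  have qm: "q n i \<in> borel_measurable (lebesgue_on \<Omega>)" for n i
    using borel_measurable_lebesgue_continuous[OF cq] by (rule measurable_restrict_space1)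
  have Z'm: "(\<lambda>x. Z' x $ i) \<in> borel_measurable (lebesgue_on \<Omega>)" for i
    using borel_measurable_integrable[OF iZ'] by (rule measurable_restrict_space1)
  have qlim: "(\<lambda>n. q n i x) \<longlonglongrightarrow> Z' x $ i" for i x
  proof (rule tendstoI)
    fix c :: real assume "c > 0"
    have "isCont (\<lambda>x. Z' x $ i) x"
      using continuous_on_component[OF R(2), of i] by (simp add: continuous_on_eq_continuous_at)
    then obtain s where s: "s > 0" "\<And>z. dist z x < s \<Longrightarrow> dist (Z' z $ i) (Z' x $ i) < c/2"
      using \<open>c > 0\<close> unfolding continuous_at_eps_delta by (metis half_gt_zero)
    have "eventually (\<lambda>n. r n < s) sequentially" using rlim s(1) by (rule order_tendstoD)
    then show "eventually (\<lambda>n. dist (q n i x) (Z' x $ i) < c) sequentially"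
    proof eventually_elim
      case (elim n)
      have "\<bar>q n i x - Z' x $ i\<bar> \<le> c/2" unfolding q_def
      proof (rule conv_mollifier_approx[OF r(1) iZ'])
        fix z assume "dist x z \<le> r n"
        then have "dist (Z' z $ i) (Z' x $ i) < c/2" using elim by (intro s(2)) (simp add: dist_commute)
        then show "\<bar>Z' z $ i - Z' x $ i\<bar> \<le> c/2" unfolding dist_real_def by simp
      qed
      then show ?case using \<open>c > 0\<close> by (simp add: dist_real_def)
    qed
  qed
  have lim: "(\<lambda>n. \<integral>x. q n i x * F x $ i \<partial>lebesgue_on \<Omega>) \<longlonglongrightarrow> (\<integral>x. Z' x $ i * F x $ i \<partial>lebesgue_on \<Omega>)" for i
    by (rule tendsto_integral_mult_bounded[where B = B and u = "\<lambda>_ x. F x $ i"]) (auto intro: qm qB qlim F)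
  have eq1: "(\<integral>x. F x \<bullet> (\<chi> i. partial_deriv i (\<psi> n) x) \<partial>lebesgue_on \<Omega>) = (\<Sum>i\<in>UNIV. \<integral>x. q n i x * F x $ i \<partial>lebesgue_on \<Omega>)" for n
    using integral_mult_inner[of "lebesgue_on \<Omega>" "\<lambda>_. 1" "\<lambda>x. \<chi> i. q n i x" F] integrable_mult_bounded[OF F qm qB]
    by (simp add: d inner_commute)
  have eq2: "(\<integral>x. F x \<bullet> Z' x \<partial>lebesgue_on \<Omega>) = (\<Sum>i\<in>UNIV. \<integral>x. Z' x $ i * F x $ i \<partial>lebesgue_on \<Omega>)"
    using integral_mult_inner[of "lebesgue_on \<Omega>" "\<lambda>_. 1" Z' F] integrable_mult_bounded[OF F Z'm Z'B]
    by (simp add: inner_commute)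
  have "(\<lambda>n. \<Sum>i\<in>UNIV. \<integral>x. q n i x * F x $ i \<partial>lebesgue_on \<Omega>) \<longlonglongrightarrow> (\<Sum>i\<in>UNIV. \<integral>x. Z' x $ i * F x $ i \<partial>lebesgue_on \<Omega>)"
    by (intro tendsto_sum lim)
  then show ?thesis unfolding eq1[symmetric] eq2[symmetric]
    by (rule LIMSEQ_le_const) (use test[OF t pos] in blast)
qed

text \<open>With N the dimension, the divergence of -E(x) (x - y), for E = c exp(-\<alpha> |x -
  y|^2), is E (2 \<alpha> |x - y|^2 - N). It is nonnegative wherever |x - y|^2 \<ge> s, and
  \<open>Z\<close> vanishes on the remaining ball. The claim is the integrated form, obtained
  component by component.\<close>

lemma exp_field_subsolution:
  fixes y :: "real^'n"
  assumes "C1_compact Z Z'" "\<And>x. 0 \<le> Z x" "c \<ge> 0" "s > 0" "2 * \<alpha> * s \<ge> real CARD('n)"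
    "\<And>x. (x - y) \<bullet> (x - y) < s \<Longrightarrow> Z x = 0"
  shows "(\<integral>x. (- (c * exp (- \<alpha> * ((x - y) \<bullet> (x - y)))) *\<^sub>R (x - y)) \<bullet> Z' x \<partial>lebesgue) \<le> 0"
proof -
  define E where "E x = c * exp (- \<alpha> * ((x - y) \<bullet> (x - y)))" for x
  define X where "X i x = - E x * (x - y) $ i" for i x
  define dX where "dX i x = (2 * \<alpha> * E x * (x - y) $ i) *\<^sub>R (x - y) - E x *\<^sub>R axis i 1" for i x
  have E: "E x \<ge> 0" for x using assms(3) by (simp add: E_def)
  have cE: "continuous_on UNIV E" unfolding E_def[abs_def] by (intro continuous_intros)
  have DX: "(X i has_derivative (\<lambda>k. dX i x \<bullet> k)) (at x)" for i x
  proof -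
    have ax: "(x - y) $ i = axis i 1 \<bullet> (x - y)" for x :: "real^'n"
      by (subst inner_commute) (simp add: inner_axis)
    show ?thesis unfolding X_def[abs_def] dX_def E_def ax
      by (rule has_derivative_eq_rhs, (rule derivative_intros)+)
         (auto simp: inner_commute inner_diff_left algebra_simps)
  qed
  have cX: "continuous_on UNIV (dX i)" for i
    unfolding dX_def[abs_def] by (intro continuous_intros cE)
  have h: "C1_compact (\<lambda>x. X i x * Z x) (\<lambda>x. X i x *\<^sub>R Z' x + Z x *\<^sub>R dX i x)" for i
    by (rule C1_compact_mult[OF assms(1) DX cX])
  obtain R where R: "\<And>x. norm x > R \<Longrightarrow> Z x = 0" "\<And>x. norm x > R \<Longrightarrow> Z' x = 0" "continuous_on UNIV Z" "continuous_on UNIV Z'"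
    using C1_compactE[OF assms(1)] by metis
  have cXi: "continuous_on UNIV (X i)" for i using DX by (meson continuous_at_imp_continuous_on has_derivative_continuous)
  have i1: "integrable lebesgue (\<lambda>x. X i x * Z' x $ i)" for i
    by (rule compact_support_integrable[where R = R]) (auto simp: R intro!: continuous_intros cXi R)
  have i2: "integrable lebesgue (\<lambda>x. Z x * dX i x $ i)" for i
    by (rule compact_support_integrable[where R = R]) (auto simp: R intro!: continuous_intros cX R)
  have "(\<integral>x. X i x * Z' x $ i \<partial>lebesgue) = - (\<integral>x. Z x * dX i x $ i \<partial>lebesgue)" for i
    using integral_partial_eq_0[OF h[of i], of i] i1[of i] i2[of i] by simp
  then have "(\<Sum>i\<in>UNIV. \<integral>x. X i x * Z' x $ i \<partial>lebesgue) = - (\<Sum>i\<in>UNIV. \<integral>x. Z x * dX i x $ i \<partial>lebesgue)"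
    by (simp add: sum_negf)
  also have "\<dots> = - (\<integral>x. (\<Sum>i\<in>UNIV. Z x * dX i x $ i) \<partial>lebesgue)" using i2 by (simp add: Bochner_Integration.integral_sum)
  also have "\<dots> \<le> 0"
  proof -
    have "(\<Sum>i\<in>UNIV. Z x * dX i x $ i) = Z x * (E x * (2 * \<alpha> * ((x - y) \<bullet> (x - y)) - real CARD('n)))" for x
    proof -
      have "(\<Sum>i\<in>UNIV. dX i x $ i) = (\<Sum>i\<in>UNIV. 2 * \<alpha> * E x * ((x - y) $ i * (x - y) $ i) - E x)"
        by (simp add: dX_def axis_def algebra_simps)
      also have "\<dots> = E x * (2 * \<alpha> * ((x - y) \<bullet> (x - y)) - real CARD('n))"
      proof -
        have "(\<Sum>i\<in>UNIV. (x - y) $ i * (x - y) $ i) = (x - y) \<bullet> (x - y)" by (simp only: inner_vec_def inner_real_def)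
        then have "(\<Sum>i\<in>UNIV. 2 * \<alpha> * E x * ((x - y) $ i * (x - y) $ i) - E x) =
            2 * \<alpha> * E x * ((x - y) \<bullet> (x - y)) - real CARD('n) * E x"
          by (simp only: sum_subtractf sum_distrib_left[symmetric] sum_constant)
        then show ?thesis by (simp only: right_diff_distrib mult_ac)
      qed
      finally show ?thesis by (simp add: sum_distrib_left[symmetric])
    qed
    moreover have "0 \<le> Z x * (E x * (2 * \<alpha> * ((x - y) \<bullet> (x - y)) - real CARD('n)))" for x
    proof (cases "(x - y) \<bullet> (x - y) < s")
      case False
      have "0 < real CARD('n)" by simp
      then have "0 < \<alpha> * s" using assms(5) by linarith
      then have "\<alpha> > 0" using assms(4) by (simp add: zero_less_mult_iff)
      then have "2 * \<alpha> * s \<le> 2 * \<alpha> * ((x - y) \<bullet> (x - y))" using False by simp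
      then show ?thesis using assms(2,5) E by (intro mult_nonneg_nonneg) auto
    qed (simp add: assms(6))
    ultimately show ?thesis by (simp add: Bochner_Integration.integral_nonneg)
  qed
  finally have "(\<Sum>i\<in>UNIV. \<integral>x. X i x * Z' x $ i \<partial>lebesgue) \<le> 0" .
  moreover have "(- (c * exp (- \<alpha> * ((x - y) \<bullet> (x - y)))) *\<^sub>R (x - y)) \<bullet> Z' x = (\<Sum>i\<in>UNIV. X i x * Z' x $ i)" for x
    by (simp add: inner_vec_def X_def E_def)
  ultimately show ?thesis using i1 by (simp add: Bochner_Integration.integral_sum)
qed

context N_function
begin

section \<open>The inverse of \<open>m\<close> and the radial barrier\<close>

lemma surj_m: "\<exists>t. m t = s"
proof -
  have up: "\<exists>t. m t = s" if "s \<ge> 0" for s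
  proof -
    have "eventually (\<lambda>x. s \<le> m x) at_top" using m_top by (simp add: filterlim_at_top)
    then obtain b where b: "m b \<ge> s" by (auto simp: eventually_at_top_linorder)
    have "m 0 \<le> m (max b 0)" "m b \<le> m (max b 0)" using m_mono by (simp_all only: strict_mono_less_eq max.cobounded1 max.cobounded2)
    then show ?thesis using IVT[of m 0 s "max b 0"] that b isCont_m by auto
  qed
  show ?thesis
  proof (cases "s \<ge> 0")
    case False
    then obtain t where "m t = - s" using up[of "-s"] by auto
    then have "m (- t) = s" by (simp add: m_odd)
    then show ?thesis ..
  qed (rule up)
qed

definition m_inv :: "real \<Rightarrow> real" where "m_inv s = (THE t. m t = s)"

lemma m_inv_m [simp]: "m_inv (m t) = t"
  unfolding m_inv_def using strict_mono_eq[OF m_mono] by auto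

lemma m_m_inv [simp]: "m (m_inv s) = s"
  using surj_m[of s] by auto

lemma m_inv_le_iff: "m_inv a \<le> t \<longleftrightarrow> a \<le> m t"
  using strict_mono_less_eq[OF m_mono, of "m_inv a" t] by simp

lemma m_inv_pos: "a > 0 \<Longrightarrow> m_inv a > 0"
  using m_inv_le_iff[of a 0] by (simp add: not_le[symmetric])

lemma isCont_m_inv: "isCont m_inv s"
  using isCont_inverse_function[of 1 "m_inv s" m_inv m] isCont_m by simp

text \<open>The barrier is a decreasing radial function on an annulus about \<open>y\<close>, equal
  to 0 on the outer sphere and at most \<mu> < w on the inner one. Comparison gives w \<ge> v > 0 in
  the annulus, while continuity of \<open>w\<close> at \<open>y\<close> handles the inner
  ball.\<close>

lemma positive_on_ball:
  fixes w :: "real^'n \<Rightarrow> real" and W :: "real^'n \<Rightarrow> real^'n"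
  assumes \<Omega>: "open \<Omega>" "bounded \<Omega>" and w: "continuous_on \<Omega> w"
    and W: "\<And>i. has_weak_partial \<Omega> i w (\<lambda>x. W x $ i)"
    and fluxW: "integrable (lebesgue_on \<Omega>) (\<lambda>x. flux (W x) \<bullet> W x)"
    and super: "\<And>Z Z' K. C1_compact Z Z' \<Longrightarrow> compact K \<Longrightarrow> K \<subseteq> \<Omega> \<Longrightarrow> (\<And>x. x \<notin> K \<Longrightarrow> Z x = 0) \<Longrightarrow>
        (\<And>x. 0 \<le> Z x) \<Longrightarrow> 0 \<le> (\<integral>x. flux (W x) \<bullet> Z' x \<partial>lebesgue_on \<Omega>)"
    and nonneg: "\<And>x. x \<in> \<Omega> \<Longrightarrow> 0 \<le> w x"
    and ball: "cball y R \<subseteq> \<Omega>" "w y > 0" and x: "x \<in> ball y R"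
  shows "w x > 0"
proof -
  have R: "R > 0" using x by (metis ball_eq_empty empty_iff not_le)
  then have "y \<in> \<Omega>" using ball(1) by auto
  define \<mu> where "\<mu> = w y / 2"
  have \<mu>: "\<mu> > 0" using ball(2) by (simp add: \<mu>_def)
  have "isCont w y" using w \<Omega>(1) \<open>y \<in> \<Omega>\<close> by (simp add: continuous_on_eq_continuous_at)
  then obtain d where d: "d > 0" "\<And>z. dist z y < d \<Longrightarrow> dist (w z) (w y) < \<mu>"
    using \<mu> unfolding continuous_at_eps_delta by blast
  \<comment> \<open>Below \<open>d\<close> so that w > \<mu> on the closed inner ball, and below
    \<open>R\<close> so that the annulus is genuine.\<close>
  define \<rho> where "\<rho> = min (d/2) (R/2)"
  have \<rho>: "\<rho> > 0" "\<rho> < d" "\<rho> < R" using d(1) R by (auto simp: \<rho>_def)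
  have core: "w z > \<mu>" if "dist y z \<le> \<rho>" for z
  proof -
    have "dist (w z) (w y) < \<mu>" using that \<rho> by (intro d(2)) (simp add: dist_commute)
    then show ?thesis unfolding dist_real_def \<mu>_def by linarith
  qed
  \<comment> \<open>Chosen so that 2 \<alpha> \<rho>^2 is the dimension, the threshold in
    \<open>exp_field_subsolution\<close> with s = \<rho>^2.\<close>
  define \<alpha> where "\<alpha> = real CARD('n) / (2 * \<rho>^2)"
  \<comment> \<open>Then the size of the flux is at most c R = m(\<mu> / R), so the slope of the
    barrier is at most \<mu> / R and its total rise at most \<mu>.\<close>
  define c where "c = m (\<mu> / R) / R"
  have c: "c > 0" using strict_monoD[OF m_mono, of 0 "\<mu> / R"] \<mu> R by (simp add: c_def)
  have \<alpha>: "\<alpha> \<ge> 0" by (simp add: \<alpha>_def)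
  \<comment> \<open>The slope is read off from the prescribed flux through the inverse of
    \<open>m\<close>; this is the only place where the barrier depends on \<phi>.\<close>
  define k where "k s = m_inv (c * s * exp (- \<alpha> * s^2))" for s
  have ck: "continuous_on S k" for S
    unfolding k_def[abs_def]
    by (rule continuous_on_compose2[of UNIV m_inv]) (auto intro!: continuous_intros continuous_at_imp_continuous_on isCont_m_inv)
  have kpos: "k s > 0" if "s > 0" for s unfolding k_def using that c by (intro m_inv_pos) simp
  have kle: "k s \<le> \<mu> / R" if "0 \<le> s" "s \<le> R" for s
  proof -
    have "c * s * exp (- \<alpha> * s^2) \<le> c * R * 1" using that c R \<alpha> by (intro mult_mono) auto
    then show ?thesis unfolding k_def m_inv_le_iff using R by (simp add: c_def)
  qed
  define I where "I t = integral {0..t} k" for t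
  have DI: "(I has_real_derivative k t) (at t)" if "t > 0" for t
  proof -
    have "(I has_real_derivative k t) (at t within {0..t+1})"
      unfolding I_def[abs_def] using that by (intro integral_has_real_derivative ck) auto
    moreover have "at t within {0..t+1} = at t" using that by (intro at_within_interior) (auto simp: interior_atLeastAtMost_real)
    ultimately show ?thesis by simp
  qed
  define v where "v z = I R - I (norm (z - y))" for z
  define v' where "v' z = (- k (norm (z - y))) *\<^sub>R sgn (z - y)" for z
  define U where "U = ball y R - cball y \<rho>"
  have oU: "open U" unfolding U_def by (intro open_Diff) auto
  have "closure U \<subseteq> cball y R - ball y \<rho>"
    unfolding U_def by (intro closure_minimal closed_Diff) auto
  then have clU: "\<rho> \<le> dist y z" "dist y z \<le> R" if "z \<in> closure U" for z using that by auto
  have UO: "closure U \<subseteq> \<Omega>" using clU ball(1) by auto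
  have ne: "z \<noteq> y" "norm (z - y) > 0" if "z \<in> closure U" for z using clU[OF that] \<rho> by auto
  have UK: "U \<subseteq> closure U" by (rule closure_subset)
  have Dv: "(v has_derivative (\<lambda>h. v' z \<bullet> h)) (at z)" if "z \<in> closure U" for z
  proof -
    have "(norm has_derivative (\<lambda>h. h \<bullet> sgn (z - y))) (at (z - y))" using ne[OF that] by (intro has_derivative_norm) simp
    then have "((\<lambda>z. norm (z - y)) has_derivative (\<lambda>h. h \<bullet> sgn (z - y))) (at z)"
      by (rule has_derivative_compose[rotated]) (auto intro!: derivative_eq_intros)
    from has_derivative_compose[OF this DI[OF ne(2)[OF that], unfolded has_field_derivative_def]]
    have "(v has_derivative (\<lambda>h. 0 - k (norm (z - y)) * (h \<bullet> sgn (z - y)))) (at z)"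
      unfolding v_def[abs_def] by (intro has_derivative_diff has_derivative_const)
    then show ?thesis by (simp add: v'_def inner_commute)
  qed
  have fl: "flux (v' z) = - (c * exp (- \<alpha> * ((z - y) \<bullet> (z - y)))) *\<^sub>R (z - y)" if "z \<in> U" for z
  proof -
    have n: "norm (z - y) > 0" using ne UK that by blast
    then have kp: "k (norm (z - y)) > 0" by (rule kpos)
    have "norm (sgn (z - y)) = 1" using n by (simp add: norm_sgn)
    then have "norm (v' z) = k (norm (z - y))" using kp by (simp add: v'_def)
    then have "flux (v' z) = - (\<phi> (k (norm (z - y))) * k (norm (z - y))) *\<^sub>R sgn (z - y)"
      by (simp add: flux_def v'_def)
    also have "\<phi> (k (norm (z - y))) * k (norm (z - y)) = m (k (norm (z - y)))" using kp by (simp add: m_fun_def)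
    also have "\<dots> = c * norm (z - y) * exp (- \<alpha> * (norm (z - y))^2)" by (simp add: k_def)
    finally show ?thesis using n by (simp add: sgn_div_norm power2_norm_eq_inner)
  qed
  have le: "v x \<le> w x" if "x \<in> U" for x
  proof (rule comparison_principle[OF \<Omega> w W fluxW super oU UO _ _ _ _ _ that])
    show "continuous_on (closure U) v" using Dv by (meson continuous_at_imp_continuous_on has_derivative_continuous)
    show "(v has_derivative (\<lambda>k. v' z \<bullet> k)) (at z)" if "z \<in> U" for z using Dv UK that by blast
    show "continuous_on U v'" unfolding v'_def[abs_def] sgn_div_norm
      by (intro continuous_intros continuous_on_compose2[OF ck[of UNIV]]) (use ne UK in auto)
  next
    fix Z Z' K assume Z: "C1_compact Z Z'" "compact K" "K \<subseteq> U" "\<And>x. x \<notin> K \<Longrightarrow> Z x = 0" "\<And>x. 0 \<le> Z x"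
    \<comment> \<open>The formula \<open>fl\<close> for the flux holds in the annulus only. Outside
      the support of \<open>Z\<close> the gradient \<open>Z'\<close> vanishes, so the integrands
      agree everywhere.\<close>
    have "flux (v' z) \<bullet> Z' z = (- (c * exp (- \<alpha> * ((z - y) \<bullet> (z - y)))) *\<^sub>R (z - y)) \<bullet> Z' z" for z
    proof (cases "z \<in> K")
      case True
      then show ?thesis by (simp only: fl[OF subsetD[OF Z(3)]])
    next
      case False
      have "open (- K)" using Z(2) compact_imp_closed by blast
      then have "Z' z = 0" using gradient_zero_outside[of Z "Z' z" z "- K"] Z(1,4) False by (auto simp: C1_compact_def)
      then show ?thesis by simp
    qed
    moreover have "(\<integral>z. (- (c * exp (- \<alpha> * ((z - y) \<bullet> (z - y)))) *\<^sub>R (z - y)) \<bullet> Z' z \<partial>lebesgue) \<le> 0"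
    proof (rule exp_field_subsolution[OF Z(1,5), where s = "\<rho>^2"])
      fix z assume "(z - y) \<bullet> (z - y) < \<rho>^2"
      then have "norm (z - y) < \<rho>" using \<rho>(1) by (metis power2_norm_eq_inner power_less_imp_less_base less_imp_le)
      then have "z \<notin> U" by (simp add: U_def dist_norm norm_minus_commute)
      then show "Z z = 0" using Z(3,4) by blast
    qed (use c \<rho> in \<open>auto simp: \<alpha>_def\<close>)
    ultimately show "(\<integral>z. flux (v' z) \<bullet> Z' z \<partial>lebesgue) \<le> 0" by simp
  next
    fix z assume z: "z \<in> frontier U"
    then have zc: "z \<in> closure U" "z \<notin> U" using oU by (auto simp: frontier_def interior_open)
    \<comment> \<open>The frontier lies on two spheres. On the outer one v = 0 \<le> w; on the inner
      one v is the integral of the slope over [\<rho>, R], at most (R - \<rho>) \<mu> / R, hence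
      below w.\<close>
    then consider "dist y z = R" | "dist y z = \<rho>" using clU[of z] by (force simp: U_def)
    then show "v z \<le> w z"
    proof cases
      case 1
      then show ?thesis using nonneg[of z] zc UO by (auto simp: v_def dist_norm norm_minus_commute)
    next
      case 2
      have "integral {0..\<rho>} k + integral {\<rho>..R} k = integral {0..R} k"
        using \<rho> by (intro Henstock_Kurzweil_Integration.integral_combine integrable_continuous_real ck) auto
      then have "v z = integral {\<rho>..R} k" using 2 by (simp add: v_def I_def dist_norm norm_minus_commute)
      also have "\<dots> \<le> integral {\<rho>..R} (\<lambda>s. \<mu> / R)"
        using \<rho> by (intro integral_le integrable_continuous_real ck kle) auto
      also have "\<dots> = (R - \<rho>) * (\<mu> / R)" using \<rho> by simp
      also have "\<dots> \<le> R * (\<mu> / R)" using \<rho> \<mu> R by (intro mult_right_mono) auto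
      also have "\<dots> = \<mu>" using R by simp
      finally show ?thesis using core[of z] 2 by simp
    qed
  qed
  show ?thesis
  proof (cases "x \<in> U")
    case True
    let ?t = "norm (x - y)"
    have t: "0 < ?t" "?t < R" using ne UK True x by (auto simp: dist_norm norm_minus_commute)
    have "I ?t < I R"
    proof (rule DERIV_pos_imp_increasing_open[OF t(2)])
      show "\<exists>y. DERIV I s :> y \<and> y > 0" if "?t < s" "s < R" for s
        using DI[of s] kpos[of s] t(1) that by (intro exI[of _ "k s"]) auto
      show "continuous_on {?t..R} I"
      proof (intro continuous_at_imp_continuous_on ballI)
        fix s assume "s \<in> {?t..R}"
        then have "s > 0" using t(1) by (simp only: atLeastAtMost_iff) linarith
        then show "isCont I s" using DI DERIV_isCont by blast
      qed
    qed
    then have "v x > 0" by (simp add: v_def)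
    then show ?thesis using le[OF True] by simp
  next
    case False
    then have "dist y x \<le> \<rho>" using x by (simp add: U_def)
    then show ?thesis using core[of x] \<mu> by simp
  qed
qed

end

section \<open>Application to the eigenfunction\<close>

lemma (in N_function) weak_solution_gradient:
  assumes "weak_solution \<Omega> \<phi> \<rho> lam w"
  shows "has_weak_partial \<Omega> i w (\<lambda>x. weak_grad \<Omega> w x $ i)"
    "integrable (lebesgue_on \<Omega>) (\<lambda>x. flux (weak_grad \<Omega> w x) \<bullet> weak_grad \<Omega> w x)"
proof -
  have wW: "w \<in> W10L M \<Omega>" using assms by (simp add: weak_solution_def)
  show "has_weak_partial \<Omega> i w (\<lambda>x. weak_grad \<Omega> w x $ i)"
    using wW weak_partial_works unfolding W10L_def W1L_def weak_grad_def by fastforce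
  show "integrable (lebesgue_on \<Omega>) (\<lambda>x. flux (weak_grad \<Omega> w x) \<bullet> weak_grad \<Omega> w x)"
    \<comment> \<open>The integrability clause of the weak formulation is used with the solution
      itself as test function; this is the source of the integrability of |W| m(|W|).\<close>
    using assms wW unfolding weak_solution_def flux_def by blast
qed

text \<open>For a nonnegative smooth test function every factor on the right-hand side of the
  equation is nonnegative. Smooth functions are the ones known to be admissible, so C1 functions are
  reached through \<open>tested_with_C1_compact\<close>.\<close>

lemma (in N_function) weak_solution_supersolution:
  fixes \<Omega> :: "(real^'n) set"
  assumes \<Omega>: "open \<Omega>" "bounded \<Omega>" and lam: "lam \<ge> 0"
    and sol: "weak_solution \<Omega> \<phi> \<rho> lam w" and nonneg: "\<And>x. x \<in> \<Omega> \<Longrightarrow> w x \<ge> 0"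
    and rho: "AE x in lebesgue_on \<Omega>. \<rho> x \<ge> 0"
    and Z: "C1_compact Z Z'" "compact K" "K \<subseteq> \<Omega>" "\<And>x. x \<notin> K \<Longrightarrow> Z x = 0" "\<And>x. 0 \<le> Z x"
  shows "0 \<le> (\<integral>x. flux (weak_grad \<Omega> w x) \<bullet> Z' x \<partial>lebesgue_on \<Omega>)"
proof -
  let ?W = "weak_grad \<Omega> w"
  note W = weak_solution_gradient(1)[OF sol] and FW = weak_solution_gradient(2)[OF sol]
  have Wm: "(\<lambda>x. ?W x $ i) \<in> borel_measurable (lebesgue_on \<Omega>)" for i
    using W[of i] locally_integrable_measurable[OF \<Omega>(1)] by (simp add: has_weak_partial_def)
  note iF = flux_integrable(3)[OF \<Omega> Wm FW]
  show "0 \<le> (\<integral>x. flux (?W x) \<bullet> Z' x \<partial>lebesgue_on \<Omega>)"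
  proof (rule tested_with_C1_compact[OF \<Omega>(1) iF _ Z])
    fix \<psi> :: "real^'n \<Rightarrow> real" assume \<psi>: "\<psi> \<in> test_functions \<Omega>" "\<And>x. 0 \<le> \<psi> x"
    have \<psi>W: "\<psi> \<in> W10L M \<Omega>" by (rule test_function_in_W10L[OF \<Omega> M_continuous \<psi>(1)])
    have i1: "integrable (lebesgue_on \<Omega>) (\<lambda>x. flux (?W x) \<bullet> weak_grad \<Omega> \<psi> x)"
      and eq: "(\<integral>x. flux (?W x) \<bullet> weak_grad \<Omega> \<psi> x \<partial>lebesgue_on \<Omega>) =
          lam * (\<integral>x. \<rho> x * (\<phi> \<bar>w x\<bar> * w x) * \<psi> x \<partial>lebesgue_on \<Omega>)"
      using sol \<psi>W unfolding weak_solution_def flux_def by blast+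
    have "AE x in lebesgue_on \<Omega>. 0 \<le> \<rho> x * (\<phi> \<bar>w x\<bar> * w x) * \<psi> x"
      using rho AE_space
    proof eventually_elim
      case (elim x)
      then have "0 \<le> m (w x)" using nonneg m_nonneg by simp
      then show ?case using elim \<psi>(2) by (simp add: m_fun_def)
    qed
    then have "0 \<le> (\<integral>x. flux (?W x) \<bullet> weak_grad \<Omega> \<psi> x \<partial>lebesgue_on \<Omega>)"
      unfolding eq using lam by (intro mult_nonneg_nonneg integral_nonneg_AE)
    \<comment> \<open>The weak formulation speaks of the chosen weak gradient of \<psi>, the
      approximation lemma of the classical one; they agree almost everywhere.\<close>
    also have "\<dots> = (\<integral>x. flux (?W x) \<bullet> (\<chi> i. partial_deriv i \<psi> x) \<partial>lebesgue_on \<Omega>)"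
    proof (rule integral_cong_AE)
      show "(\<lambda>x. flux (?W x) \<bullet> weak_grad \<Omega> \<psi> x) \<in> borel_measurable (lebesgue_on \<Omega>)"
        using i1 by (rule borel_measurable_integrable)
      obtain R where R: "\<And>x. norm x > R \<Longrightarrow> (\<chi> i. partial_deriv i \<psi> x) = 0" "continuous_on UNIV (\<lambda>x. \<chi> i. partial_deriv i \<psi> x)"
        using C1_compactE[OF test_function_C1_compact[OF \<psi>(1)]] by metis
      obtain B where B: "\<And>x. norm (\<chi> i. partial_deriv i \<psi> x) \<le> B" using compact_support_bounded[OF R(2,1)] by metis
      have "integrable (lebesgue_on \<Omega>) (\<lambda>x. flux (?W x) \<bullet> (\<chi> i. partial_deriv i \<psi> x))"
      proof (rule integrable_inner_bounded[OF iF])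
        show "(\<lambda>x. (\<chi> i. partial_deriv i \<psi> x) $ i) \<in> borel_measurable (lebesgue_on \<Omega>)" for i
          by (intro measurable_restrict_space1 borel_measurable_lebesgue_continuous continuous_on_component[OF R(2)])
        show "\<bar>(\<chi> i. partial_deriv i \<psi> x) $ i\<bar> \<le> B" for i x
          by (rule order_trans[OF component_le_norm_cart B])
      qed
      then show "(\<lambda>x. flux (?W x) \<bullet> (\<chi> i. partial_deriv i \<psi> x)) \<in> borel_measurable (lebesgue_on \<Omega>)"
        by (rule borel_measurable_integrable)
      show "AE x in lebesgue_on \<Omega>. flux (?W x) \<bullet> weak_grad \<Omega> \<psi> x = flux (?W x) \<bullet> (\<chi> i. partial_deriv i \<psi> x)"
        using weak_grad_test_function[OF \<Omega>(1) \<psi>(1)] by eventually_elim simp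
    qed
    finally show "0 \<le> (\<integral>x. flux (?W x) \<bullet> (\<chi> i. partial_deriv i \<psi> x) \<partial>lebesgue_on \<Omega>)" .
  qed
qed

theorem theorem2p2:
  fixes \<Omega> :: "(real^'n) set"
    and \<phi> :: "real \<Rightarrow> real"
    and \<rho> w :: "real^'n \<Rightarrow> real"
    and \<delta> :: ereal
  assumes dim: "CARD('n) \<ge> 2"
    and domain: "open \<Omega>" "connected \<Omega>" "\<Omega> \<noteq> {}" "bounded \<Omega>" "segment_property \<Omega>"
    and phi: "continuous_on {0<..} \<phi>" "\<And>t. t > 0 \<Longrightarrow> \<phi> t > 0"
    and m: "strict_mono (m_fun \<phi>)" "(m_fun \<phi> \<longlongrightarrow> 0) (at 0)" "filterlim (m_fun \<phi>) at_top at_top"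
    and rho: "\<rho> \<in> borel_measurable (lebesgue_on \<Omega>)"
             "\<exists>C. AE x in lebesgue_on \<Omega>. \<bar>\<rho> x\<bar> \<le> C"
             "AE x in lebesgue_on \<Omega>. \<rho> x \<ge> 0"
             "\<not> (AE x in lebesgue_on \<Omega>. \<rho> x = 0)"
    and eigen: "eigenfunction \<Omega> \<phi> \<rho> (lambda1 \<Omega> \<phi> \<rho>) w"
    and cont: "continuous_on \<Omega> w"
    and nonneg: "\<And>x. x \<in> \<Omega> \<Longrightarrow> w x \<ge> 0"
    and delta: "\<delta> = (SUP x\<in>\<Omega>. ereal (w x))"
    and diverges: "(\<integral>\<^sup>+s\<in>{s. 0 < s \<and> ereal s < \<delta>}. ennreal (1 / H_inv \<phi> (M_fun \<phi> s)) \<partial>lborel) = \<infinity>"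
  shows "\<forall>x\<in>\<Omega>. w x > 0"
proof -
  interpret N_function \<phi> by unfold_locales (use phi m in auto)
  have sol: "weak_solution \<Omega> \<phi> \<rho> (lambda1 \<Omega> \<phi> \<rho>) w" and ne: "\<not> (AE x in lebesgue_on \<Omega>. w x = 0)"
    using eigen by (auto simp: eigenfunction_def)
  \<comment> \<open>Nonnegative by construction, as the image of an infimum in [0,\<infinity>] under
    \<open>enn2real\<close>.\<close>
  have lam: "lambda1 \<Omega> \<phi> \<rho> \<ge> 0" by (simp add: lambda1_def)
  have ball: "w x > 0" if "cball y r \<subseteq> \<Omega>" "w y > 0" "x \<in> ball y r" for x y r
    by (rule positive_on_ball[OF domain(1,4) cont weak_solution_gradient[OF sol]
          weak_solution_supersolution[OF domain(1,4) lam sol nonneg rho(3)] nonneg that])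
  let ?P = "{x\<in>\<Omega>. w x > 0}" and ?N = "{x\<in>\<Omega>. w x = 0}"
  have "open ?P"
    unfolding open_contains_ball
  proof
    fix y assume y: "y \<in> ?P"
    then obtain r where r: "r > 0" "cball y r \<subseteq> \<Omega>" using domain(1) open_contains_cball by blast
    have "ball y r \<subseteq> ?P" using ball[OF r(2)] y r(2) ball_subset_cball[of y r] by blast
    then show "\<exists>e>0. ball y e \<subseteq> ?P" using r(1) by blast
  qed
  \<comment> \<open>A positive value at a point \<open>y\<close> near \<open>x\<close> would spread,
    through \<open>ball\<close> centred at \<open>y\<close>, to the zero \<open>x\<close>. Radius
    r/2 keeps the closed ball about \<open>y\<close> inside \<open>cball x r\<close> and still has
    \<open>x\<close> in its interior.\<close>
  moreover have "open ?N"
    unfolding open_contains_ball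
  proof
    fix x assume x: "x \<in> ?N"
    then obtain r where r: "r > 0" "cball x r \<subseteq> \<Omega>" using domain(1) open_contains_cball by blast
    have "y \<in> ?N" if y: "y \<in> ball x (r/2)" for y
    proof -
      have sub: "cball y (r/2) \<subseteq> cball x r" using y by (auto simp: cball_subset_cball_iff dist_commute)
      have "y \<in> cball y (r/2)" using r(1) by simp
      then have "y \<in> \<Omega>" using sub r(2) by blast
      moreover have "\<not> w y > 0"
      proof
        assume "w y > 0"
        have "w x > 0"
        proof (rule ball[OF _ \<open>w y > 0\<close>])
          show "cball y (r/2) \<subseteq> \<Omega>" using sub r(2) by blast
          show "x \<in> ball y (r/2)" using y by (simp add: dist_commute)
        qed
        then show False using x by simp
      qed
      ultimately show ?thesis using nonneg[of y] by simp
    qed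
    then show "\<exists>e>0. ball x e \<subseteq> ?N" using r(1) by (intro exI[of _ "r/2"]) auto
  qed
  moreover have "\<Omega> \<subseteq> ?P \<union> ?N" using nonneg by (auto simp: less_le)
  moreover have "?P \<inter> ?N \<inter> \<Omega> = {}" by auto
  ultimately have "?P \<inter> \<Omega> = {} \<or> ?N \<inter> \<Omega> = {}" using domain(2) by (intro connectedD)
  moreover have "?P \<noteq> {}"
  proof
    assume "?P = {}"
    then have "w x = 0" if "x \<in> \<Omega>" for x using nonneg[OF that] that by (auto simp: less_le)
    then have "AE x in lebesgue_on \<Omega>. w x = 0" by (intro AE_I2) simp
    then show False using ne by simp
  qed
  ultimately show ?thesis using nonneg by (auto simp: less_le)
qed

end
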